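(* Let $\epsilon\in\mathbb{R}$ with $\epsilon\geq 1$ and let $h_{\epsilon}(n)=\epsilon\cdot\log(n)$. If $\epsilon>1$, then for any two omega numbers $\Omega_0,\Omega_1$, the real $\Omega_1$ is computable from $\Omega_0$ with redundancy $h_{\epsilon}$. If $\epsilon=1$, then for every omega number $\Omega$ there exists another omega number which is not computable from $\Omega$ with redundancy $h_{1}$ (i.e. with redundancy $\log(n)$).
   Context: Logarithms are base 2, with the convention $\log(0)=0$. Reals in $[0,1]$ are identified with their infinite binary expansions, whose bits are indexed starting from 1, so $\alpha=\alpha(1)\alpha(2)\alpha(3)\cdots$, and $\alpha\restriction_n$ denotes the first $n$ bits. An omega number is the halting probability of a universal prefix-free (self-delimiting) Turing machine; equivalently, a left-c.e. real (limit of a computable nondecreasing sequence of rationals) that is Martin-Löf random. Redundancy: if a real $\beta$ computes a real $\alpha$ (via a Turing reduction with oracle $\beta$), and for each $n$ the computation of the first $n$ bits of $\alpha$ uses at most the first $\lfloor n+g(n)\rfloor$ bits of the oracle $\beta$, we say that $\beta$ computes $\alpha$ with redundancy $g$. *)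

theory Defs
  imports "HOL-Analysis.Analysis" "HOL-Library.Sublist"
begin

section \<open>Partial recursive functions with an oracle\<close>

datatype recf =
    Zero
  | Succ
  | Proj nat
  | Oracle
  | Comp recf "recf list"
  | Prec recf recf
  | Mu recf

text \<open>
  \<open>eval A p xs y Q\<close>: with oracle \<open>A\<close>, the program \<open>p\<close> halts on the arguments \<open>xs\<close> with
  output \<open>y\<close>, and \<open>Q\<close> is the set of positions of the oracle queried in the computation.
\<close>

inductive eval :: "(nat \<Rightarrow> nat) \<Rightarrow> recf \<Rightarrow> nat list \<Rightarrow> nat \<Rightarrow> nat set \<Rightarrow> bool" for A where
  eval_Zero: "eval A Zero xs 0 {}"
| eval_Succ: "eval A Succ [x] (Suc x) {}"
| eval_Proj: "i < length xs \<Longrightarrow> eval A (Proj i) xs (xs ! i) {}"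
| eval_Oracle: "eval A Oracle [k] (A k) {k}"
| eval_Comp: "length ys = length gs \<Longrightarrow> (\<And>i. i < length gs \<Longrightarrow> eval A (gs ! i) xs (ys ! i) (R i))
    \<Longrightarrow> eval A f ys y Q \<Longrightarrow> eval A (Comp f gs) xs y (Q \<union> (\<Union>i<length gs. R i))"
| eval_Prec_0: "eval A f xs y Q \<Longrightarrow> eval A (Prec f g) (0 # xs) y Q"
| eval_Prec_Suc: "eval A (Prec f g) (n # xs) z Q \<Longrightarrow> eval A g (n # z # xs) y R
    \<Longrightarrow> eval A (Prec f g) (Suc n # xs) y (Q \<union> R)"
| eval_Mu: "eval A f (y # xs) 0 Q \<Longrightarrow> (\<And>i. i < y \<Longrightarrow> eval A f (i # xs) (Suc (z i)) (R i))
    \<Longrightarrow> eval A (Mu f) xs y (Q \<union> (\<Union>i<y. R i))"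

lemma eval_deterministic:
  assumes "eval A p xs y Q" "eval A p xs y' Q'"
  shows "y = y' \<and> Q = Q'"
  using assms
proof (induction arbitrary: y' Q' rule: eval.induct)
  case (eval_Comp ys gs xs R f y Q)
  from eval_Comp.prems show ?case
  proof cases
    case (eval_Comp ys' R' Q'')
    have "ys ! i = ys' ! i \<and> R i = R' i" if "i < length gs" for i
      using eval_Comp.IH(1)[OF that] eval_Comp(3)[OF that] by blast
    moreover from this have "ys = ys'"
      using eval_Comp.hyps(1) eval_Comp(2) by (auto intro: nth_equalityI)
    ultimately show ?thesis
      using eval_Comp.IH(2) eval_Comp(1,4) by auto
  qed
next
  case (eval_Prec_0 f xs y Q g)
  from eval_Prec_0.prems show ?case
    by cases (use eval_Prec_0.IH in auto)
next
  case (eval_Prec_Suc f g n xs z Q y R)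
  from eval_Prec_Suc.prems show ?case
  proof cases
    case (eval_Prec_Suc z' Q'' R'')
    then show ?thesis using eval_Prec_Suc.IH by blast
  qed
next
  case (eval_Mu f y xs Q z R)
  from eval_Mu.prems show ?case
  proof cases
    case (eval_Mu Q'' z' R')
    have "\<not> y < y'"
      using eval_Mu(3)[of y] eval_Mu.IH(1) by fastforce
    moreover have "\<not> y' < y"
      using eval_Mu.IH(2)[of y'] eval_Mu(2) by fastforce
    ultimately have y: "y = y'" by simp
    have "R i = R' i" if "i < y" for i
      using eval_Mu.IH(2)[OF that] eval_Mu(3)[of i] that y by blast
    then show ?thesis
      using eval_Mu.IH(1) eval_Mu(1,2) y by auto
  qed
qed (auto elim: eval.cases)


section \<open>Binary strings and binary expansions\<close>

text \<open>Bijective base-2 numeration, least significant digit first: a computable bijection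
  between the binary strings and the natural numbers.\<close>

fun string_code :: "bool list \<Rightarrow> nat" where
  "string_code [] = 0"
| "string_code (b # \<sigma>) = (if b then 2 else 1) + 2 * string_code \<sigma>"

lemma inj_string_code: "inj string_code"
proof (rule injI)
  fix \<sigma> \<tau> :: "bool list"
  assume "string_code \<sigma> = string_code \<tau>"
  then show "\<sigma> = \<tau>"
  proof (induction \<sigma> arbitrary: \<tau>)
    case Nil
    then show ?case by (cases \<tau>) (auto split: if_splits)
  next
    case (Cons b \<sigma>)
    then obtain c \<tau>' where \<tau>: "\<tau> = c # \<tau>'" by (cases \<tau>) (auto split: if_splits)
    with Cons.prems have "b = c \<and> string_code \<sigma> = string_code \<tau>'"
      by (cases b; cases c) (simp_all, presburger+)
    with Cons.IH \<tau> show ?case by blast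
  qed
qed

lemma surj_string_code: "surj string_code"
proof -
  have "\<exists>\<sigma>. string_code \<sigma> = n" for n
  proof (induction n rule: less_induct)
    case (less n)
    show ?case
    proof (cases "n = 0")
      case True
      then show ?thesis by (metis string_code.simps(1))
    next
      case False
      then have "(n - 1) div 2 < n" by linarith
      with less obtain \<sigma> where "string_code \<sigma> = (n - 1) div 2" by blast
      then have "string_code (even n # \<sigma>) = n"
        using False by (cases "even n") (auto elim!: evenE oddE)
      then show ?thesis by blast
    qed
  qed
  then show ?thesis by (metis surjI)
qed

text \<open>The bit \<open>x(i)\<close> of a real \<open>x\<close> in \<open>[0,1)\<close>, for \<open>i \<ge> 1\<close>. A dyadic rational gets the
  expansion ending in zeros; an omega number is irrational, so its expansion is unique.\<close>

definition binary_digit :: "real \<Rightarrow> nat \<Rightarrow> bool" where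
  "binary_digit x i \<longleftrightarrow> odd \<lfloor>2 ^ i * x\<rfloor>"

definition initial_bits :: "real \<Rightarrow> nat \<Rightarrow> bool list" where
  "initial_bits x n = map (binary_digit x) [1..<Suc n]"


section \<open>Omega numbers\<close>

text \<open>Computations without an oracle are those with the zero oracle.\<close>

definition partial_computable :: "(bool list \<rightharpoonup> bool list) \<Rightarrow> bool" where
  "partial_computable M \<longleftrightarrow> (\<exists>p. \<forall>\<sigma> \<tau>.
     M \<sigma> = Some \<tau> \<longleftrightarrow> (\<exists>Q. eval (\<lambda>_. 0) p [string_code \<sigma>] (string_code \<tau>) Q))"

definition prefix_free_machine :: "(bool list \<rightharpoonup> bool list) \<Rightarrow> bool" where
  "prefix_free_machine M \<longleftrightarrow> partial_computable M \<and> pairwise (\<parallel>) (dom M)"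

definition universal_prefix_free_machine :: "(bool list \<rightharpoonup> bool list) \<Rightarrow> bool" where
  "universal_prefix_free_machine U \<longleftrightarrow> prefix_free_machine U \<and>
     (\<forall>M. prefix_free_machine M \<longrightarrow> (\<exists>\<rho>. \<forall>\<tau>. U (\<rho> @ \<tau>) = M \<tau>))"

text \<open>By Kraft's inequality the sum converges whenever the domain of \<open>M\<close> is prefix-free.\<close>

definition halting_probability :: "(bool list \<rightharpoonup> bool list) \<Rightarrow> real" where
  "halting_probability M = (\<Sum>\<^sub>\<infinity>\<sigma>\<in>dom M. (1 / 2) ^ length \<sigma>)"

definition omega_number :: "real \<Rightarrow> bool" where
  "omega_number x \<longleftrightarrow> (\<exists>U. universal_prefix_free_machine U \<and> x = halting_probability U)"


section \<open>Computation with bounded redundancy\<close>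

text \<open>On input \<open>n\<close> the program outputs the first \<open>n\<close> bits of \<open>\<alpha>\<close>. Query \<open>k\<close> to the oracle
  returns the bit \<open>\<beta>(k)\<close>; since bits are indexed from 1, position 0 may not be queried.\<close>

definition computes_with_redundancy :: "real \<Rightarrow> real \<Rightarrow> (nat \<Rightarrow> real) \<Rightarrow> bool" where
  "computes_with_redundancy \<beta> \<alpha> g \<longleftrightarrow> (\<exists>p. \<forall>n. \<exists>Q.
     eval (\<lambda>k. of_bool (binary_digit \<beta> k)) p [n] (string_code (initial_bits \<alpha> n)) Q \<and>
     (\<forall>k\<in>Q. 1 \<le> k \<and> int k \<le> \<lfloor>real n + g n\<rfloor>))"

definition h :: "real \<Rightarrow> nat \<Rightarrow> real" where
  "h \<epsilon> n = \<epsilon> * (if n = 0 then 0 else log 2 (real n))"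

end

(*
Approximations. If U(\<rho> \<tau>) = V(\<tau>) for all \<tau>, then the part of the halting probability of V that is missing
at a stage of U is at most 2^|\<rho>| times the missing part of the halting probability of U. So n + O(1) bits of
one omega number give a stage at which the other one is known up to 2^-n.

Redundancy above log. Such an approximation determines the first n bits unless the number lies just
to the right of a multiple of 2^-n. For large n it is not within 2^-(n + (1 + 1/q) log n + O(1)) of one: the
machine that reads a description of j/2^n of that length, waits until the halting probability
has reached j/2^n and then outputs a string not produced by U so far adds, up to a constant factor, its
own weight to the halting probability afterwards.

Redundancy log. For an omega number \<Omega>, 3/4 \<Omega> is again one (use three of the four prefixes of length 2).
If m = n + log n, then every dyadic interval of length 2^-(n - 2) contains one of
length 2^-m that is cut by a multiple of 4/3 2^-n in the ratio 1 : 2 or 2 : 1. A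
reduction with use m has to decide on which side of the cut \<Omega> is, and thereby
excludes a quarter of the short interval, that is a fraction of about 1/n of the long one. With n = n_k
and n_(k+1) = n_k + log n_k + O(1), the sum of 1/n_k diverges (like log log), hence a correct reduction
puts \<Omega> into effectively open sets of arbitrarily small measure, which is impossible for an omega number.
*)

theory Submission
  imports Defs
begin

text \<open>Both halves rest on one mechanism: a universal machine gives each string of an effective
  prefix-free set of descriptions a weight 2^-(length + c), and this weight can be forced to appear
  late. So cheap descriptions become gaps in the approximation. The threshold comes from the cost of
  naming n. A description has to mark its own end: t in unary announces a field of q t bits, so n
  costs about (1 + 1/q) log n bits, and 1 + 1/q < \<epsilon> leaves room for all constants. The log
  n bits alone are not self-delimiting. The factor 3/4 serves because the first n bits of 3/4
  \<Omega> change at the multiples of 4/3 2^-n, and two out of three of these are not dyadic. No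
  prefix of \<Omega>, however long, determines an interval with such an endpoint, so around it two
  answers stay possible. The losses for different n must combine. The excluded quarter has length
  2^-(m + 2), and the next n is chosen with n - 2 = m + 2. Thus every surviving interval is treated
  afresh and the surviving fractions multiply; the divergence of the sum makes their product tend to
  0.\<close>

section \<open>Total computable functions\<close>

text \<open>The program is the same for every oracle and makes no query, so it can be a subroutine
  of a reduction without enlarging the set of queried positions.\<close>

definition total_computable :: "nat \<Rightarrow> (nat list \<Rightarrow> nat) \<Rightarrow> bool" where
  "total_computable k f \<longleftrightarrow> (\<exists>p. \<forall>A xs. length xs = k \<longrightarrow> eval A p xs (f xs) {})"

abbreviation decidable :: "nat \<Rightarrow> (nat list \<Rightarrow> bool) \<Rightarrow> bool" where
  "decidable k P \<equiv> total_computable k (\<lambda>xs. of_bool (P xs))"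

named_theorems computable_intros

lemma total_computable_cong:
  assumes "total_computable k f" "\<And>xs. length xs = k \<Longrightarrow> f xs = g xs"
  shows "total_computable k g"
  using assms unfolding total_computable_def by metis

lemma total_computable_compose:
  assumes f: "total_computable (length gs) f" and gs: "\<And>g. g \<in> set gs \<Longrightarrow> total_computable k g"
  shows "total_computable k (\<lambda>xs. f (map (\<lambda>g. g xs) gs))"
proof -
  from f obtain p where p: "\<And>A xs. length xs = length gs \<Longrightarrow> eval A p xs (f xs) {}"
    unfolding total_computable_def by blast
  from gs obtain P where P: "\<And>g A xs. g \<in> set gs \<Longrightarrow> length xs = k \<Longrightarrow> eval A (P g) xs (g xs) {}"
    unfolding total_computable_def by metis
  have "eval A (Comp p (map P gs)) xs (f (map (\<lambda>g. g xs) gs)) {}" if "length xs = k" for A xs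
  proof -
    have "eval A (Comp p (map P gs)) xs (f (map (\<lambda>g. g xs) gs)) ({} \<union> (\<Union>i<length (map P gs). {}))"
      by (rule eval_Comp[where ys = "map (\<lambda>g. g xs) gs"]) (use p P that in auto)
    then show ?thesis by simp
  qed
  then show ?thesis unfolding total_computable_def by blast
qed

lemma total_computable_compose1:
  assumes "total_computable 1 (\<lambda>xs. f (xs ! 0))" "total_computable k a"
  shows "total_computable k (\<lambda>xs. f (a xs))"
  using total_computable_compose[of "[a]" "\<lambda>xs. f (xs ! 0)" k] assms by simp

lemma total_computable_compose2:
  assumes "total_computable 2 (\<lambda>xs. f (xs ! 0) (xs ! 1))" "total_computable k a" "total_computable k b"
  shows "total_computable k (\<lambda>xs. f (a xs) (b xs))"
  using total_computable_compose[of "[a, b]" "\<lambda>xs. f (xs ! 0) (xs ! 1)" k] assms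
  by (auto simp: numeral_2_eq_2)

lemma total_computable_compose3:
  assumes "total_computable 3 (\<lambda>xs. f (xs ! 0) (xs ! 1) (xs ! 2))"
    "total_computable k a" "total_computable k b" "total_computable k c"
  shows "total_computable k (\<lambda>xs. f (a xs) (b xs) (c xs))"
  using total_computable_compose[of "[a, b, c]" "\<lambda>xs. f (xs ! 0) (xs ! 1) (xs ! 2)" k] assms
  by (auto simp: numeral_3_eq_3 numeral_2_eq_2)

lemma total_computable_nth [computable_intros]:
  "i < k \<Longrightarrow> total_computable k (\<lambda>xs. xs ! i)"
  unfolding total_computable_def by (metis eval_Proj)

text \<open>The tails come from the rules for binders: a bounded sum, quantifier or search puts one
  bound variable in front of the parameters, a recursion puts two.\<close>

lemma total_computable_nth_tl [computable_intros]:
  "Suc i < k \<Longrightarrow> total_computable k (\<lambda>xs. tl xs ! i)"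
  by (rule total_computable_cong[OF total_computable_nth[of "Suc i"]]) (auto simp: nth_tl)

lemma total_computable_nth_tl2 [computable_intros]:
  "Suc (Suc i) < k \<Longrightarrow> total_computable k (\<lambda>xs. tl (tl xs) ! i)"
  by (rule total_computable_cong[OF total_computable_nth[of "Suc (Suc i)"]]) (auto simp: nth_tl)

lemma total_computable_Suc [computable_intros]:
  assumes "total_computable k f"
  shows "total_computable k (\<lambda>xs. Suc (f xs))"
proof (rule total_computable_compose1[OF _ assms])
  have "eval A Succ xs (Suc (xs ! 0)) {}" if "length xs = 1" for A xs
    using that eval_Succ[of A "xs ! 0"] by (cases xs) auto
  then show "total_computable 1 (\<lambda>xs. Suc (xs ! 0))"
    unfolding total_computable_def by blast
qed

lemma total_computable_const [computable_intros]: "total_computable k (\<lambda>xs. c)"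
proof (induction c)
  case 0
  then show ?case unfolding total_computable_def by (metis eval_Zero)
qed (rule total_computable_Suc)

text \<open>\<open>Prec\<close> recurses on its first argument and keeps the others. Composing it
  with \<open>n\<close> and all projections gives recursion up to a computed bound.\<close>

lemma total_computable_rec_nat [computable_intros]:
  assumes n: "total_computable k n" and a: "total_computable k a"
    and g: "total_computable (Suc (Suc k)) (\<lambda>ys. g (ys ! 0) (ys ! 1) (tl (tl ys)))"
  shows "total_computable k (\<lambda>xs. rec_nat (a xs) (\<lambda>i z. g i z xs) (n xs))"
proof -
  obtain pa where pa: "\<And>A xs. length xs = k \<Longrightarrow> eval A pa xs (a xs) {}"
    using a unfolding total_computable_def by blast
  obtain pg where pg: "\<And>A ys. length ys = Suc (Suc k) \<Longrightarrow>
      eval A pg ys (g (ys ! 0) (ys ! 1) (tl (tl ys))) {}"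
    using g unfolding total_computable_def by blast
  have "eval A (Prec pa pg) (i # xs) (rec_nat (a xs) (\<lambda>i z. g i z xs) i) {}"
    if "length xs = k" for A i xs
  proof (induction i)
    case 0
    show ?case by (simp add: eval_Prec_0 pa that)
  next
    case (Suc i)
    let ?z = "rec_nat (a xs) (\<lambda>i z. g i z xs) i"
    have "eval A pg (i # ?z # xs) (g i ?z xs) {}"
      using pg[of "i # ?z # xs"] that by simp
    with Suc show ?case
      using eval_Prec_Suc by fastforce
  qed
  then have "eval A (Prec pa pg) ys (rec_nat (a (tl ys)) (\<lambda>i z. g i z (tl ys)) (ys ! 0)) {}"
    if "length ys = Suc k" for A ys
    using that by (cases ys) auto
  then have "total_computable (Suc k) (\<lambda>ys. rec_nat (a (tl ys)) (\<lambda>i z. g i z (tl ys)) (ys ! 0))"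
    unfolding total_computable_def by blast
  then have "total_computable k (\<lambda>xs. (\<lambda>ys. rec_nat (a (tl ys)) (\<lambda>i z. g i z (tl ys)) (ys ! 0))
      (map (\<lambda>g. g xs) (n # map (\<lambda>i xs. xs ! i) [0..<k])))"
    by (intro total_computable_compose) (auto intro: n total_computable_nth)
  then show ?thesis
  proof (rule total_computable_cong)
    fix xs :: "nat list" assume "length xs = k"
    then have "map ((!) xs) [0..<k] = xs"
      using map_nth[of xs] by simp
    then show "(\<lambda>ys. rec_nat (a (tl ys)) (\<lambda>i z. g i z (tl ys)) (ys ! 0))
      (map (\<lambda>g. g xs) (n # map (\<lambda>i xs. xs ! i) [0..<k])) = rec_nat (a xs) (\<lambda>i z. g i z xs) (n xs)"
      by (simp add: comp_def)
  qed
qed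

lemma total_computable_add [computable_intros]:
  assumes "total_computable k f" "total_computable k g"
  shows "total_computable k (\<lambda>xs. f xs + g xs)"
proof -
  have "rec_nat a (\<lambda>i. Suc) b = a + b" for a b by (induction b) auto
  with total_computable_rec_nat[where g = "\<lambda>i z xs. Suc z", OF assms(2,1)] show ?thesis
    by (simp add: computable_intros)
qed

lemma total_computable_mult [computable_intros]:
  assumes "total_computable k f" "total_computable k g"
  shows "total_computable k (\<lambda>xs. f xs * g xs)"
proof (rule total_computable_compose2[OF _ assms])
  have "rec_nat 0 (\<lambda>i z. z + a) b = a * b" for a b :: nat by (induction b) auto
  then show "total_computable 2 (\<lambda>xs. xs ! 0 * xs ! 1)"
    using total_computable_rec_nat[where g = "\<lambda>i z xs. z + xs ! 0" and k = 2
        and n = "\<lambda>xs. xs ! 1" and a = "\<lambda>xs. 0"]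
    by (simp add: computable_intros)
qed

lemma total_computable_diff [computable_intros]:
  assumes "total_computable k f" "total_computable k g"
  shows "total_computable k (\<lambda>xs. f xs - g xs)"
proof (rule total_computable_compose2[OF _ assms])
  \<comment> \<open>The predecessor is a recursion that forgets the previous value; iterating it
    gives truncated subtraction.\<close>
  have pred: "rec_nat 0 (\<lambda>i z. i) b = b - 1" for b by (cases b) auto
  have "total_computable 1 (\<lambda>xs. xs ! 0 - 1)"
    using total_computable_rec_nat[where g = "\<lambda>i z xs. i" and k = 1
        and n = "\<lambda>xs. xs ! 0" and a = "\<lambda>xs. 0"]
    by (simp add: computable_intros pred)
  from total_computable_compose1[OF this] have "total_computable k (\<lambda>xs. f xs - 1)"
    if "total_computable k f" for k f using that .
  note * = this[where f = "\<lambda>xs. xs ! 1"]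
  have "rec_nat a (\<lambda>i z. z - 1) b = a - b" for a b :: nat by (induction b) auto
  then show "total_computable 2 (\<lambda>xs. xs ! 0 - xs ! 1)"
    using total_computable_rec_nat[where g = "\<lambda>i z xs. z - 1" and k = 2
        and n = "\<lambda>xs. xs ! 1" and a = "\<lambda>xs. xs ! 0"] *
    by (simp add: computable_intros)
qed

lemma total_computable_power [computable_intros]:
  assumes "total_computable k f" "total_computable k g"
  shows "total_computable k (\<lambda>xs. f xs ^ g xs)"
proof (rule total_computable_compose2[OF _ assms])
  have "rec_nat 1 (\<lambda>i z. z * a) b = a ^ b" for a b :: nat by (induction b) auto
  then show "total_computable 2 (\<lambda>xs. xs ! 0 ^ xs ! 1)"
    using total_computable_rec_nat[where g = "\<lambda>i z xs. z * xs ! 0" and k = 2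
        and n = "\<lambda>xs. xs ! 1" and a = "\<lambda>xs. 1"]
    by (simp add: computable_intros)
qed

text \<open>With summands 0 and 1 this yields bounded quantifiers, division and counting.\<close>

lemma total_computable_sum [computable_intros]:
  assumes "total_computable k b" "total_computable (Suc k) (\<lambda>ys. f (ys ! 0) (tl ys))"
  shows "total_computable k (\<lambda>xs. \<Sum>i<b xs. f i xs)"
proof -
  have "total_computable (Suc (Suc k)) (\<lambda>xs. (\<lambda>ys. f (ys ! 0) (tl ys))
      (map (\<lambda>g. g xs) ((\<lambda>xs. xs ! 0) # map (\<lambda>i xs. xs ! Suc (Suc i)) [0..<k])))"
    by (intro total_computable_compose) (auto intro: assms(2) total_computable_nth)
  then have "total_computable (Suc (Suc k)) (\<lambda>xs. f (xs ! 0) (tl (tl xs)))"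
  proof (rule total_computable_cong)
    fix xs :: "nat list" assume "length xs = Suc (Suc k)"
    then have "map ((!) (tl (tl xs))) [0..<k] = tl (tl xs)"
      by (intro nth_equalityI) auto
    moreover have "map ((!) (tl (tl xs))) [0..<k] = map (\<lambda>i. xs ! Suc (Suc i)) [0..<k]"
      using \<open>length xs = _\<close> by (auto simp: nth_tl)
    ultimately show "(\<lambda>ys. f (ys ! 0) (tl ys))
      (map (\<lambda>g. g xs) ((\<lambda>xs. xs ! 0) # map (\<lambda>i xs. xs ! Suc (Suc i)) [0..<k])) = f (xs ! 0) (tl (tl xs))"
      by (simp add: comp_def)
  qed
  then have "total_computable k (\<lambda>xs. rec_nat 0 (\<lambda>i z. z + f i xs) (b xs))"
    by (intro computable_intros assms) simp_all
  moreover have "rec_nat 0 (\<lambda>i z. z + f i xs) n = (\<Sum>i<n. f i xs)" for n xs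
    by (induction n) auto
  ultimately show ?thesis by simp
qed

section \<open>Decidable predicates and bounded quantifiers\<close>

lemma decidable_not [computable_intros]:
  assumes "decidable k P" shows "decidable k (\<lambda>xs. \<not> P xs)"
proof -
  have "total_computable k (\<lambda>xs. 1 - of_bool (P xs))" by (intro computable_intros assms)
  then show ?thesis by (rule total_computable_cong) auto
qed

lemma decidable_conj [computable_intros]:
  assumes "decidable k P" "decidable k Q" shows "decidable k (\<lambda>xs. P xs \<and> Q xs)"
  using total_computable_mult[OF assms] by (simp flip: of_bool_conj)

lemma decidable_disj [computable_intros]:
  assumes "decidable k P" "decidable k Q" shows "decidable k (\<lambda>xs. P xs \<or> Q xs)"
proof -
  have "decidable k (\<lambda>xs. \<not> (\<not> P xs \<and> \<not> Q xs))" by (intro computable_intros assms)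
  then show ?thesis by simp
qed

lemma decidable_imp [computable_intros]:
  assumes "decidable k P" "decidable k Q" shows "decidable k (\<lambda>xs. P xs \<longrightarrow> Q xs)"
  by (rule total_computable_cong[OF decidable_disj[OF decidable_not[OF assms(1)] assms(2)]]) auto

lemma decidable_eq_0: 
  assumes "total_computable k f" shows "decidable k (\<lambda>xs. f xs = 0)"
proof -
  have "total_computable k (\<lambda>xs. 1 - f xs)" by (intro computable_intros assms)
  then show ?thesis by (rule total_computable_cong) auto
qed

lemma decidable_le [computable_intros]:
  assumes "total_computable k f" "total_computable k g"
  shows "decidable k (\<lambda>xs. f xs \<le> g xs)"
  using decidable_eq_0[OF total_computable_diff[OF assms]] by simp

lemma decidable_less [computable_intros]:
  assumes "total_computable k f" "total_computable k g"
  shows "decidable k (\<lambda>xs. f xs < g xs)"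
  using decidable_le[OF total_computable_Suc[OF assms(1)] assms(2)] by (simp add: Suc_le_eq)

lemma decidable_eq [computable_intros]:
  assumes "total_computable k f" "total_computable k g"
  shows "decidable k (\<lambda>xs. f xs = g xs)"
proof -
  have "decidable k (\<lambda>xs. f xs \<le> g xs \<and> g xs \<le> f xs)" by (intro computable_intros assms)
  then show ?thesis by (rule total_computable_cong) auto
qed

lemma total_computable_if [computable_intros]:
  assumes "decidable k P" "total_computable k f" "total_computable k g"
  shows "total_computable k (\<lambda>xs. if P xs then f xs else g xs)"
proof -
  have "total_computable k (\<lambda>xs. of_bool (P xs) * f xs + of_bool (\<not> P xs) * g xs)"
    by (intro computable_intros assms)
  then show ?thesis by (rule total_computable_cong) auto
qed

lemma decidable_all_less [computable_intros]:
  assumes "total_computable k b" "decidable (Suc k) (\<lambda>ys. P (ys ! 0) (tl ys))"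
  shows "decidable k (\<lambda>xs. \<forall>i<b xs. P i xs)"
proof -
  have "decidable k (\<lambda>xs. (\<Sum>i<b xs. of_bool (\<not> P i xs)) = (0::nat))"
    by (intro computable_intros assms)
  then show ?thesis by (rule total_computable_cong) auto
qed

lemma decidable_ex_less [computable_intros]:
  assumes "total_computable k b" "decidable (Suc k) (\<lambda>ys. P (ys ! 0) (tl ys))"
  shows "decidable k (\<lambda>xs. \<exists>i<b xs. P i xs)"
proof -
  have "decidable k (\<lambda>xs. \<not> (\<forall>i<b xs. \<not> P i xs))" by (intro computable_intros assms)
  then show ?thesis by simp
qed

lemma total_computable_div [computable_intros]:
  assumes "total_computable k f" "total_computable k g"
  shows "total_computable k (\<lambda>xs. f xs div g xs)"
proof (rule total_computable_compose2[OF _ assms])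
  \<comment> \<open>The quotient is the number of positive multiples of the divisor up to the
    dividend. For divisor 0 every index would be counted, hence the case distinction.\<close>
  have "total_computable 2 (\<lambda>xs. if xs ! 1 = 0 then 0 else \<Sum>i<xs ! 0. of_bool (Suc i * xs ! 1 \<le> xs ! 0))"
    by (intro computable_intros) simp_all
  moreover have *: "(if b = 0 then 0 else \<Sum>i<a. of_bool (Suc i * b \<le> a)) = a div b" for a b :: nat
  proof (cases "b = 0")
    case False
    then have "{i. i < a \<and> Suc i * b \<le> a} = {..<a div b}"
      by (auto simp: Suc_le_eq[symmetric] less_eq_div_iff_mult_less_eq simp del: mult_Suc
          intro: le_trans[OF _ div_le_dividend[of a b]])
    with False show ?thesis
      by (simp add: sum.If_cases of_bool_def Int_def del: mult_Suc)
  qed simp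
  ultimately show "total_computable 2 (\<lambda>xs. xs ! 0 div xs ! 1)" by (simp only: *)
qed

lemma total_computable_mod [computable_intros]:
  assumes "total_computable k f" "total_computable k g"
  shows "total_computable k (\<lambda>xs. f xs mod g xs)"
  using total_computable_diff[OF assms(1) total_computable_mult[OF assms(2) total_computable_div[OF assms]]]
  by (simp add: minus_mult_div_eq_mod)

section \<open>Computations in stages\<close>

text \<open>Bounding the queries by a fixed \<open>D\<close> instead of naming the exact set
  \<open>Q\<close> gives equations that recurse along the program with the same
  \<open>D\<close>.\<close>

definition halts_within :: "(nat \<Rightarrow> nat) \<Rightarrow> nat set \<Rightarrow> recf \<Rightarrow> nat list \<Rightarrow> nat \<Rightarrow> bool" where
  "halts_within A D p xs y \<longleftrightarrow> (\<exists>Q. eval A p xs y Q \<and> Q \<subseteq> D)"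

lemma halts_within_Zero: "halts_within A D Zero xs y \<longleftrightarrow> y = 0"
  unfolding halts_within_def by (auto intro: eval_Zero elim: eval.cases)

lemma halts_within_Succ: "halts_within A D Succ xs y \<longleftrightarrow> length xs = 1 \<and> y = Suc (xs ! 0)"
proof
  assume "length xs = 1 \<and> y = Suc (xs ! 0)"
  then have "xs = [xs ! 0]" "y = Suc (xs ! 0)" by (cases xs; simp)+
  then have "eval A Succ xs y {}" by (metis eval_Succ)
  then show "halts_within A D Succ xs y" unfolding halts_within_def by blast
qed (auto simp: halts_within_def elim: eval.cases)

lemma halts_within_Proj: "halts_within A D (Proj i) xs y \<longleftrightarrow> i < length xs \<and> y = xs ! i"
  unfolding halts_within_def by (auto intro: eval_Proj elim: eval.cases)

lemma halts_within_Oracle: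
  "halts_within A D Oracle xs y \<longleftrightarrow> length xs = 1 \<and> xs ! 0 \<in> D \<and> y = A (xs ! 0)"
proof
  assume "length xs = 1 \<and> xs ! 0 \<in> D \<and> y = A (xs ! 0)"
  then have "xs = [xs ! 0]" "xs ! 0 \<in> D" "y = A (xs ! 0)" by (cases xs; simp)+
  then have "eval A Oracle xs y {xs ! 0}" by (metis eval_Oracle)
  with \<open>xs ! 0 \<in> D\<close> show "halts_within A D Oracle xs y" unfolding halts_within_def by blast
qed (auto simp: halts_within_def elim: eval.cases)

lemma halts_within_Comp:
  "halts_within A D (Comp f gs) xs y \<longleftrightarrow>
    (\<exists>ys. length ys = length gs \<and> (\<forall>i<length gs. halts_within A D (gs ! i) xs (ys ! i)) \<and>
      halts_within A D f ys y)"
proof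
  assume "halts_within A D (Comp f gs) xs y"
  then obtain Q where "eval A (Comp f gs) xs y Q" "Q \<subseteq> D" unfolding halts_within_def by blast
  then show "\<exists>ys. length ys = length gs \<and> (\<forall>i<length gs. halts_within A D (gs ! i) xs (ys ! i)) \<and>
      halts_within A D f ys y"
    unfolding halts_within_def by cases blast
next
  assume "\<exists>ys. length ys = length gs \<and> (\<forall>i<length gs. halts_within A D (gs ! i) xs (ys ! i)) \<and>
      halts_within A D f ys y"
  then obtain ys Q R where ys: "length ys = length gs" "eval A f ys y Q" "Q \<subseteq> D"
    and R: "\<And>i. i < length gs \<Longrightarrow> eval A (gs ! i) xs (ys ! i) (R i) \<and> R i \<subseteq> D"
    unfolding halts_within_def by metis
  then have "eval A (Comp f gs) xs y (Q \<union> (\<Union>i<length gs. R i))" by (intro eval_Comp) auto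
  then show "halts_within A D (Comp f gs) xs y"
    unfolding halts_within_def using ys(3) R
    by (intro exI[of _ "Q \<union> (\<Union>i<length gs. R i)"] conjI) auto
qed

lemma halts_within_Prec_Nil: "\<not> halts_within A D (Prec f g) [] y"
  unfolding halts_within_def by (auto elim: eval.cases)

lemma halts_within_Prec_0:
  "halts_within A D (Prec f g) (0 # xs) y \<longleftrightarrow> halts_within A D f xs y"
  unfolding halts_within_def by (auto intro: eval_Prec_0 elim: eval.cases)

lemma halts_within_Prec_Suc:
  "halts_within A D (Prec f g) (Suc n # xs) y \<longleftrightarrow>
    (\<exists>z. halts_within A D (Prec f g) (n # xs) z \<and> halts_within A D g (n # z # xs) y)"
proof
  assume "halts_within A D (Prec f g) (Suc n # xs) y"
  then obtain Q where "eval A (Prec f g) (Suc n # xs) y Q" "Q \<subseteq> D"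
    unfolding halts_within_def by blast
  then show "\<exists>z. halts_within A D (Prec f g) (n # xs) z \<and> halts_within A D g (n # z # xs) y"
    unfolding halts_within_def by cases auto
next
  assume "\<exists>z. halts_within A D (Prec f g) (n # xs) z \<and> halts_within A D g (n # z # xs) y"
  then show "halts_within A D (Prec f g) (Suc n # xs) y"
    unfolding halts_within_def by (meson Un_least eval_Prec_Suc)
qed

lemma halts_within_Mu:
  "halts_within A D (Mu f) xs y \<longleftrightarrow>
    halts_within A D f (y # xs) 0 \<and> (\<forall>i<y. \<exists>z. halts_within A D f (i # xs) (Suc z))"
proof
  assume "halts_within A D (Mu f) xs y"
  then obtain Q where "eval A (Mu f) xs y Q" "Q \<subseteq> D" unfolding halts_within_def by blast
  then show "halts_within A D f (y # xs) 0 \<and> (\<forall>i<y. \<exists>z. halts_within A D f (i # xs) (Suc z))"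
    unfolding halts_within_def by cases (auto, blast)
next
  assume *: "halts_within A D f (y # xs) 0 \<and> (\<forall>i<y. \<exists>z. halts_within A D f (i # xs) (Suc z))"
  then obtain Q where Q: "eval A f (y # xs) 0 Q" "Q \<subseteq> D" unfolding halts_within_def by blast
  from * obtain z R where R: "\<And>i. i < y \<Longrightarrow> eval A f (i # xs) (Suc (z i)) (R i) \<and> R i \<subseteq> D"
    unfolding halts_within_def by metis
  with Q have "eval A (Mu f) xs y (Q \<union> (\<Union>i<y. R i))" by (intro eval_Mu) auto
  then show "halts_within A D (Mu f) xs y"
    unfolding halts_within_def using Q(2) R
    by (intro exI[of _ "Q \<union> (\<Union>i<y. R i)"] conjI) auto
qed

text \<open>The use principle. It allows a reduction to be run on a finite prefix of its
  oracle.\<close>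

lemma eval_oracle_cong:
  assumes "eval A p xs y Q" "\<And>k. k \<in> Q \<Longrightarrow> A k = B k"
  shows "eval B p xs y Q"
  using assms
proof (induction rule: eval.induct)
  case (eval_Oracle k)
  then show ?case using eval.eval_Oracle[of B k] by simp
qed (auto intro!: eval.intros)

text \<open>The parameters \<open>m\<close> and \<open>x\<close> select the oracle: \<open>G m x k\<close> is \<open>0\<close> if the oracle is not
  available at position \<open>k\<close>, and the successor of its value otherwise. On the arguments
  \<open>s # m # x # xs\<close> the stage function returns \<open>0\<close> if the program has not halted by stage \<open>s\<close>, and
  the successor of its output otherwise.\<close>

definition stage_function :: "(nat \<Rightarrow> nat \<Rightarrow> nat \<Rightarrow> nat) \<Rightarrow> nat \<Rightarrow> recf \<Rightarrow> (nat list \<Rightarrow> nat) \<Rightarrow> bool" where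
  "stage_function G k p F \<longleftrightarrow> total_computable (3 + k) F \<and>
    (\<forall>s m x xs y s'. length xs = k \<longrightarrow> s \<le> s' \<longrightarrow> F (s # m # x # xs) = Suc y \<longrightarrow>
      F (s' # m # x # xs) = Suc y) \<and>
    (\<forall>m x xs y. length xs = k \<longrightarrow>
      halts_within (\<lambda>q. G m x q - 1) {q. G m x q \<noteq> 0} p xs y \<longleftrightarrow> (\<exists>s. F (s # m # x # xs) = Suc y))"

lemma stage_functionI:
  assumes "total_computable (3 + k) F"
    and "\<And>s m x xs y s'. length xs = k \<Longrightarrow> s \<le> s' \<Longrightarrow> F (s # m # x # xs) = Suc y \<Longrightarrow>
      F (s' # m # x # xs) = Suc y"
    and "\<And>m x xs y. length xs = k \<Longrightarrow>
      halts_within (\<lambda>q. G m x q - 1) {q. G m x q \<noteq> 0} p xs y \<longleftrightarrow> (\<exists>s. F (s # m # x # xs) = Suc y)"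
  shows "stage_function G k p F"
  using assms unfolding stage_function_def by blast

lemma
  assumes "stage_function G k p F"
  shows stage_function_computable: "total_computable (3 + k) F"
    and stage_function_mono: "\<lbrakk>length xs = k; F (s # m # x # xs) = Suc y; s \<le> s'\<rbrakk> \<Longrightarrow>
      F (s' # m # x # xs) = Suc y"
    and stage_function_iff: "length xs = k \<Longrightarrow>
      halts_within (\<lambda>q. G m x q - 1) {q. G m x q \<noteq> 0} p xs y \<longleftrightarrow> (\<exists>s. F (s # m # x # xs) = Suc y)"
  using assms unfolding stage_function_def by blast+

lemma total_computable_append_drop:
  assumes F: "total_computable (length hs + k) F"
    and hs: "\<And>h. h \<in> set hs \<Longrightarrow> total_computable (a + k) h"
  shows "total_computable (a + k) (\<lambda>ys. F (map (\<lambda>h. h ys) hs @ drop a ys))"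
proof -
  let ?gs = "hs @ map (\<lambda>i ys. ys ! (a + i)) [0..<k]"
  have "total_computable (a + k) (\<lambda>ys. F (map (\<lambda>g. g ys) ?gs))"
    by (rule total_computable_compose) (use F hs in \<open>auto intro: total_computable_nth\<close>)
  then show ?thesis
  proof (rule total_computable_cong)
    fix ys :: "nat list" assume "length ys = a + k"
    then have "map (\<lambda>i. ys ! (a + i)) [0..<k] = drop a ys"
      by (intro nth_equalityI) auto
    then show "F (map (\<lambda>g. g ys) ?gs) = F (map (\<lambda>h. h ys) hs @ drop a ys)"
      by (simp add: comp_def)
  qed
qed

lemma decidable_ball_list:
  "(\<And>P. P \<in> set Ps \<Longrightarrow> decidable k P) \<Longrightarrow> decidable k (\<lambda>xs. \<forall>P\<in>set Ps. P xs)"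
proof (induction Ps)
  case Nil
  then show ?case using total_computable_const[of k 1] by simp
next
  case (Cons P Ps)
  then have "decidable k (\<lambda>xs. P xs \<and> (\<forall>P\<in>set Ps. P xs))" by (intro decidable_conj) auto
  then show ?case by simp
qed

text \<open>All subprograms run up to the same stage. Outputs persist once they have appeared, so
  the sum of finitely many stages serves for all of them.\<close>

lemma stage_function_Comp:
  assumes f: "stage_function G (length gs) f Ff"
    and g: "\<And>g. g \<in> set gs \<Longrightarrow> stage_function G k g (Fg g)"
  shows "\<exists>F. stage_function G k (Comp f gs) F"
proof -
  define F where "F ys = (if \<forall>g\<in>set gs. Fg g ys \<noteq> 0
      then Ff (take 3 ys @ map (\<lambda>g. Fg g ys - 1) gs) else 0)" for ys
  have "stage_function G k (Comp f gs) F"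
  proof (rule stage_functionI)
    let ?hs = "map (\<lambda>i ys. ys ! i) [0..<3] @ map (\<lambda>g ys. Fg g ys - 1) gs"
    have "total_computable (3 + k) (\<lambda>ys. Ff (map (\<lambda>h. h ys) ?hs))"
      by (rule total_computable_compose)
        (use f g in \<open>auto intro!: computable_intros dest: stage_function_computable\<close>)
    then have "total_computable (3 + k) (\<lambda>ys. Ff (take 3 ys @ map (\<lambda>g. Fg g ys - 1) gs))"
    proof (rule total_computable_cong)
      fix ys :: "nat list" assume "length ys = 3 + k"
      then have "map ((!) ys) [0..<3] = take 3 ys"
        by (intro nth_equalityI) auto
      then show "Ff (map (\<lambda>h. h ys) ?hs) = Ff (take 3 ys @ map (\<lambda>g. Fg g ys - 1) gs)"
        by (simp add: comp_def)
    qed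
    moreover have "decidable (3 + k) (\<lambda>ys. \<forall>P\<in>set (map (\<lambda>g ys. Fg g ys \<noteq> 0) gs). P ys)"
      by (rule decidable_ball_list)
        (use g in \<open>auto intro!: computable_intros dest: stage_function_computable\<close>)
    ultimately show "total_computable (3 + k) F"
      unfolding F_def by (intro total_computable_if total_computable_const) simp_all
  next
    fix s m x xs y s' assume *: "length xs = k" "s \<le> s'" "F (s # m # x # xs) = Suc y"
    then have nz: "Fg g (s # m # x # xs) \<noteq> 0" if "g \<in> set gs" for g
      using that by (auto simp: F_def split: if_splits)
    have eq: "Fg g (s' # m # x # xs) = Fg g (s # m # x # xs)" if "g \<in> set gs" for g
      using nz[OF that] stage_function_mono[OF g[OF that] *(1) _ *(2)] by (metis not0_implies_Suc)
    have "Ff (s # m # x # map (\<lambda>g. Fg g (s # m # x # xs) - 1) gs) = Suc y"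
      using *(3) nz by (auto simp: F_def)
    from stage_function_mono[OF f _ this *(2)] show "F (s' # m # x # xs) = Suc y"
      using nz eq by (auto simp: F_def cong: map_cong)
  next
    fix m x y and xs :: "nat list" assume k: "length xs = k"
    let ?H = "halts_within (\<lambda>q. G m x q - 1) {q. G m x q \<noteq> 0}"
    show "?H (Comp f gs) xs y \<longleftrightarrow> (\<exists>s. F (s # m # x # xs) = Suc y)"
    proof
      assume "?H (Comp f gs) xs y"
      then obtain zs where zs: "length zs = length gs"
        "\<And>i. i < length gs \<Longrightarrow> ?H (gs ! i) xs (zs ! i)" "?H f zs y"
        unfolding halts_within_Comp by blast
      have "\<exists>s. Fg (gs ! i) (s # m # x # xs) = Suc (zs ! i)" if "i < length gs" for i
        using zs(2)[OF that] stage_function_iff[OF g k] that by simp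
      then obtain S where S: "\<And>i. i < length gs \<Longrightarrow> Fg (gs ! i) (S i # m # x # xs) = Suc (zs ! i)"
        by metis
      obtain s0 where s0: "Ff (s0 # m # x # zs) = Suc y"
        using zs(3) stage_function_iff[OF f zs(1)] by blast
      define s where "s = s0 + (\<Sum>i<length gs. S i)"
      have Sle: "S i \<le> s" if "i < length gs" for i
        unfolding s_def using member_le_sum[of i "{..<length gs}" S] that by (simp add: trans_le_add2)
      have *: "Fg (gs ! i) (s # m # x # xs) = Suc (zs ! i)" if "i < length gs" for i
        by (rule stage_function_mono[OF g k S[OF that] Sle[OF that]])
          (use that in simp)
      then have "map (\<lambda>g. Fg g (s # m # x # xs) - 1) gs = zs"
        using zs(1) by (intro nth_equalityI) auto
      moreover have "Ff (s # m # x # zs) = Suc y"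
        by (rule stage_function_mono[OF f zs(1) s0]) (simp add: s_def)
      moreover have "\<forall>g\<in>set gs. Fg g (s # m # x # xs) \<noteq> 0"
        using * by (metis in_set_conv_nth nat.distinct(1))
      ultimately show "\<exists>s. F (s # m # x # xs) = Suc y"
        by (intro exI[of _ s]) (simp add: F_def)
    next
      assume "\<exists>s. F (s # m # x # xs) = Suc y"
      then obtain s where s: "F (s # m # x # xs) = Suc y" by blast
      then have nz: "Fg g (s # m # x # xs) \<noteq> 0" if "g \<in> set gs" for g
        using that by (auto simp: F_def split: if_splits)
      let ?zs = "map (\<lambda>g. Fg g (s # m # x # xs) - 1) gs"
      have "?H (gs ! i) xs (?zs ! i)" if "i < length gs" for i
        using nz[of "gs ! i"] that stage_function_iff[OF g k] by (metis Suc_pred' bot_nat_0.not_eq_extremum nth_map nth_mem)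
      moreover have "?H f ?zs y"
        using s nz stage_function_iff[OF f, of ?zs] by (auto simp: F_def)
      ultimately show "?H (Comp f gs) xs y"
        unfolding halts_within_Comp by (intro exI[of _ ?zs]) simp
    qed
  qed
  then show ?thesis by blast
qed

text \<open>\<open>R\<close> runs the recursion on shifted values: 0, for a run that has not halted,
  is passed through, and an earlier result \<open>z\<close> is handed on as
  \<open>z - 1\<close>.\<close>

lemma stage_function_Prec:
  assumes f: "stage_function G k f Ff" and g: "stage_function G (Suc (Suc k)) g Fg"
  shows "\<exists>F. stage_function G (Suc k) (Prec f g) F"
proof -
  define R where "R s m x xs n = rec_nat (Ff (s # m # x # xs))
      (\<lambda>i z. if z = 0 then 0 else Fg (s # m # x # i # (z - 1) # xs)) n" for s m x xs n
  define F where "F ys = R (ys ! 0) (ys ! 1) (ys ! 2) (drop 4 ys) (ys ! 3)" for ys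
  have F: "F (s # m # x # n # xs) = R s m x xs n" for s m x n xs
    by (simp add: F_def numeral_2_eq_2 numeral_3_eq_3)
  have R_0: "R s m x xs 0 = Ff (s # m # x # xs)" for s m x xs
    by (simp add: R_def)
  have R_Suc: "R s m x xs (Suc n) = (if R s m x xs n = 0 then 0
      else Fg (s # m # x # n # (R s m x xs n - 1) # xs))" for s m x xs n
    by (simp add: R_def)
  have R_mono: "R s' m x xs n = Suc y" if "R s m x xs n = Suc y" "s \<le> s'" "length xs = k" for s s' m x xs n y
    using that(1)
  proof (induction n arbitrary: y)
    case 0
    then show ?case using stage_function_mono[OF f that(3) _ that(2)] by (simp add: R_0)
  next
    case (Suc n)
    then obtain z where z: "R s m x xs n = Suc z" by (cases "R s m x xs n") (auto simp: R_Suc)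
    with Suc have "Fg (s # m # x # n # z # xs) = Suc y" by (simp add: R_Suc)
    then have "Fg (s' # m # x # n # z # xs) = Suc y"
      using stage_function_mono[OF g _ _ that(2), of "n # z # xs"] that(3) by simp
    then show ?case using Suc.IH[OF z] by (simp add: R_Suc)
  qed
  have "stage_function G (Suc k) (Prec f g) F"
  proof (rule stage_functionI)
    have 1: "total_computable (4 + k)
        (\<lambda>ys. Ff (map (\<lambda>h. h ys) [\<lambda>ys. ys ! 0, \<lambda>ys. ys ! 1, \<lambda>ys. ys ! 2] @ drop 4 ys))"
      by (rule total_computable_append_drop)
        (use stage_function_computable[OF f] in \<open>auto intro: computable_intros simp: numeral_3_eq_3\<close>)
    have 2: "total_computable (6 + k)
        (\<lambda>ys. Fg (map (\<lambda>h. h ys) [\<lambda>ys. ys ! 2, \<lambda>ys. ys ! 3, \<lambda>ys. ys ! 4, \<lambda>ys. ys ! 0, \<lambda>ys. ys ! 1 - 1] @ drop 6 ys))"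
      by (rule total_computable_append_drop)
        (use stage_function_computable[OF g] in \<open>auto intro!: computable_intros simp: numeral_3_eq_3\<close>)
    have "total_computable (4 + k) F"
    proof -
      have "total_computable (Suc (Suc (4 + k))) (\<lambda>ys. Fg (map (\<lambda>h. h ys)
        [\<lambda>ys. ys ! 2, \<lambda>ys. ys ! 3, \<lambda>ys. ys ! 4, \<lambda>ys. ys ! 0, \<lambda>ys. ys ! 1 - 1] @ drop 6 ys))"
        using 2 by simp
      then have "total_computable (Suc (Suc (4 + k))) (\<lambda>ys. Fg (tl (tl ys) ! 0 # tl (tl ys) ! 1 # tl (tl ys) ! 2 #
          ys ! 0 # (ys ! 1 - 1) # drop 4 (tl (tl ys))))"
      proof (rule total_computable_cong)
        fix ys :: "nat list" assume "length ys = Suc (Suc (4 + k))"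
        then obtain i z us where "ys = i # z # us" by (metis length_Suc_conv)
        then show "Fg (map (\<lambda>h. h ys) [\<lambda>ys. ys ! 2, \<lambda>ys. ys ! 3, \<lambda>ys. ys ! 4, \<lambda>ys. ys ! 0, \<lambda>ys. ys ! 1 - 1] @ drop 6 ys) =
          Fg (tl (tl ys) ! 0 # tl (tl ys) ! 1 # tl (tl ys) ! 2 # ys ! 0 # (ys ! 1 - 1) # drop 4 (tl (tl ys)))"
          by simp
      qed
      then have "total_computable (Suc (Suc (4 + k))) (\<lambda>ys. if ys ! 1 = 0 then 0 else
          Fg (tl (tl ys) ! 0 # tl (tl ys) ! 1 # tl (tl ys) ! 2 # ys ! 0 # (ys ! 1 - 1) # drop 4 (tl (tl ys))))"
        by (intro total_computable_if total_computable_const decidable_eq total_computable_nth) simp_all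
      moreover have "total_computable (4 + k) (\<lambda>ys. Ff (ys ! 0 # ys ! 1 # ys ! 2 # drop 4 ys))"
        using 1 by simp
      moreover have "total_computable (4 + k) (\<lambda>ys. ys ! 3)"
        by (rule total_computable_nth) simp
      ultimately show ?thesis
        unfolding F_def R_def
        by - (rule total_computable_rec_nat[where n = "\<lambda>ys. ys ! 3" and g = "\<lambda>i z ys. if z = 0 then 0 else
          Fg (ys ! 0 # ys ! 1 # ys ! 2 # i # (z - 1) # drop 4 ys)"])
    qed
    then show "total_computable (3 + Suc k) F" by simp
  next
    fix s m x xs y s' assume *: "length xs = Suc k" "s \<le> s'" "F (s # m # x # xs) = Suc y"
    then obtain n xs' where "xs = n # xs'" "length xs' = k" by (metis length_Suc_conv)
    with * R_mono[of s m x xs' n y s'] show "F (s' # m # x # xs) = Suc y" by (simp add: F)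
  next
    fix m x y and xs :: "nat list" assume "length xs = Suc k"
    then obtain n xs' where xs: "xs = n # xs'" and k: "length xs' = k" by (cases xs) auto
    let ?H = "halts_within (\<lambda>q. G m x q - 1) {q. G m x q \<noteq> 0}"
    have "?H (Prec f g) (n # xs') y \<longleftrightarrow> (\<exists>s. R s m x xs' n = Suc y)"
    proof (induction n arbitrary: y)
      case 0
      then show ?case by (simp only: halts_within_Prec_0 R_0 stage_function_iff[OF f k])
    next
      case (Suc n)
      have g': "?H g (n # z # xs') y \<longleftrightarrow> (\<exists>s. Fg (s # m # x # n # z # xs') = Suc y)" for z
        using stage_function_iff[OF g, of "n # z # xs'"] k by simp
      show ?case
        unfolding halts_within_Prec_Suc Suc g'
      proof
        assume "\<exists>z. (\<exists>s. R s m x xs' n = Suc z) \<and> (\<exists>s. Fg (s # m # x # n # z # xs') = Suc y)"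
        then obtain z s t where st: "R s m x xs' n = Suc z" "Fg (t # m # x # n # z # xs') = Suc y" by blast
        have "R (max s t) m x xs' n = Suc z" using R_mono[OF st(1)] k by simp
        moreover have "Fg (max s t # m # x # n # z # xs') = Suc y"
          using stage_function_mono[OF g _ st(2)] k by simp
        ultimately show "\<exists>s. R s m x xs' (Suc n) = Suc y"
          by (intro exI[of _ "max s t"]) (simp add: R_Suc)
      next
        assume "\<exists>s. R s m x xs' (Suc n) = Suc y"
        then obtain s where s: "R s m x xs' (Suc n) = Suc y" by blast
        then obtain z where z: "R s m x xs' n = Suc z" by (cases "R s m x xs' n") (auto simp: R_Suc)
        with s have "Fg (s # m # x # n # z # xs') = Suc y" by (simp add: R_Suc)
        with z show "\<exists>z. (\<exists>s. R s m x xs' n = Suc z) \<and> (\<exists>s. Fg (s # m # x # n # z # xs') = Suc y)"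
          by blast
      qed
    qed
    then show "?H (Prec f g) xs y \<longleftrightarrow> (\<exists>s. F (s # m # x # xs) = Suc y)"
      by (simp add: xs F)
  qed
  then show ?thesis by blast
qed

text \<open>At stage \<open>s\<close> only candidates below \<open>s\<close> are tried. At most one
  satisfies \<open>P\<close>, since it has output 0 and all smaller ones have positive outputs; so
  the sum has at most one nonzero term.\<close>

lemma stage_function_Mu:
  assumes f: "stage_function G (Suc k) f Ff"
  shows "\<exists>F. stage_function G k (Mu f) F"
proof -
  define P where "P s m x xs y \<longleftrightarrow> Ff (s # m # x # y # xs) = 1 \<and> (\<forall>i<y. 1 < Ff (s # m # x # i # xs))"
    for s m x xs y
  define F where "F ys = (\<Sum>y<ys ! 0. if P (ys ! 0) (ys ! 1) (ys ! 2) (drop 3 ys) y then Suc y else 0)" for ys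
  have P_unique: "y = y'" if "P s m x xs y" "P s m x xs y'" for s m x xs y y'
    using that unfolding P_def by (metis less_irrefl linorder_neqE_nat)
  have F: "F (s # m # x # xs) = Suc y \<longleftrightarrow> y < s \<and> P s m x xs y" for s m x xs y
  proof -
    have F': "F (s # m # x # xs) = (\<Sum>y<s. if P s m x xs y then Suc y else 0)"
      by (simp add: F_def numeral_2_eq_2 numeral_3_eq_3)
    have *: "F (s # m # x # xs) = Suc y" if "y < s" "P s m x xs y" for y
    proof -
      have "(\<Sum>y<s. if P s m x xs y then Suc y else 0) = (\<Sum>y'<s. if y' = y then Suc y else 0)"
        using P_unique that by (intro sum.cong) auto
      with that F' show ?thesis by simp
    qed
    show ?thesis
    proof (cases "\<exists>y<s. P s m x xs y")
      case True
      then show ?thesis using * P_unique by fastforce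
    next
      case False
      then have "F (s # m # x # xs) = 0" unfolding F' by (intro sum.neutral) auto
      with False show ?thesis by auto
    qed
  qed
  have P_mono: "P s' m x xs y" if "P s m x xs y" "s \<le> s'" "length xs = k" for s s' m x xs y
  proof -
    have "Ff (s' # m # x # i # xs) = Ff (s # m # x # i # xs)" if "Ff (s # m # x # i # xs) > 0" for i
      using stage_function_mono[OF f _ _ \<open>s \<le> s'\<close>, of "i # xs"] \<open>length xs = k\<close> that
      by (metis Suc_pred' length_Cons)
    with that show ?thesis unfolding P_def by (metis less_Suc_eq_0_disj less_trans One_nat_def)
  qed
  have "stage_function G k (Mu f) F"
  proof (rule stage_functionI)
    have Ff: "total_computable (a + k) (\<lambda>ys. Ff (u ys # v ys # w ys # z ys # drop a ys))"
      if "total_computable (a + k) u" "total_computable (a + k) v" "total_computable (a + k) w"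
        "total_computable (a + k) z" for a u v w z
      using total_computable_append_drop[of "[u, v, w, z]" k Ff a] stage_function_computable[OF f] that
      by (auto simp: numeral_3_eq_3)
    have 1: "total_computable (Suc (3 + k)) (\<lambda>ys. Ff (tl ys ! 0 # tl ys ! 1 # tl ys ! 2 # ys ! 0 # drop 3 (tl ys)))"
    proof -
      have "total_computable (4 + k) (\<lambda>ys. Ff (ys ! 1 # ys ! 2 # ys ! 3 # ys ! 0 # drop 4 ys))"
        by (intro Ff computable_intros) simp_all
      then have "total_computable (Suc (3 + k)) (\<lambda>ys. Ff (ys ! 1 # ys ! 2 # ys ! 3 # ys ! 0 # drop 4 ys))"
        by simp
      then show ?thesis
      proof (rule total_computable_cong)
        fix ys :: "nat list" assume "length ys = Suc (3 + k)"
        then obtain i us where "ys = i # us" by (metis length_Suc_conv)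
        then show "Ff (ys ! 1 # ys ! 2 # ys ! 3 # ys ! 0 # drop 4 ys) =
          Ff (tl ys ! 0 # tl ys ! 1 # tl ys ! 2 # ys ! 0 # drop 3 (tl ys))"
          by simp
      qed
    qed
    have 2: "total_computable (Suc (Suc (3 + k)))
      (\<lambda>ys. Ff (tl (tl ys) ! 0 # tl (tl ys) ! 1 # tl (tl ys) ! 2 # ys ! 0 # drop 3 (tl (tl ys))))"
    proof -
      have "total_computable (5 + k) (\<lambda>ys. Ff (ys ! 2 # ys ! 3 # ys ! 4 # ys ! 0 # drop 5 ys))"
        by (intro Ff computable_intros) simp_all
      then have "total_computable (Suc (Suc (3 + k))) (\<lambda>ys. Ff (ys ! 2 # ys ! 3 # ys ! 4 # ys ! 0 # drop 5 ys))"
        by simp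
      then show ?thesis
      proof (rule total_computable_cong)
        fix ys :: "nat list" assume "length ys = Suc (Suc (3 + k))"
        then obtain i z us where "ys = i # z # us" by (metis length_Suc_conv)
        then show "Ff (ys ! 2 # ys ! 3 # ys ! 4 # ys ! 0 # drop 5 ys) =
          Ff (tl (tl ys) ! 0 # tl (tl ys) ! 1 # tl (tl ys) ! 2 # ys ! 0 # drop 3 (tl (tl ys)))"
          by simp
      qed
    qed
    show "total_computable (3 + k) F"
      unfolding F_def P_def
      by (intro computable_intros 1 2) (use 1 2 in simp_all)
  next
    fix s m x xs y s' assume *: "length xs = k" "s \<le> s'" "F (s # m # x # xs) = Suc y"
    then show "F (s' # m # x # xs) = Suc y" using P_mono by (auto simp: F)
  next
    fix m x y and xs :: "nat list" assume k: "length xs = k"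
    let ?H = "halts_within (\<lambda>q. G m x q - 1) {q. G m x q \<noteq> 0}"
    have f': "?H f (i # xs) y \<longleftrightarrow> (\<exists>s. Ff (s # m # x # i # xs) = Suc y)" for i y
      using stage_function_iff[OF f, of "i # xs"] k by simp
    show "?H (Mu f) xs y \<longleftrightarrow> (\<exists>s. F (s # m # x # xs) = Suc y)"
      unfolding halts_within_Mu f' F
    proof
      assume "(\<exists>s. Ff (s # m # x # y # xs) = Suc 0) \<and> (\<forall>i<y. \<exists>z s. Ff (s # m # x # i # xs) = Suc (Suc z))"
      then obtain s0 z S where S: "Ff (s0 # m # x # y # xs) = Suc 0"
        "\<And>i. i < y \<Longrightarrow> Ff (S i # m # x # i # xs) = Suc (Suc (z i))" by metis
      define s where "s = Suc y + s0 + (\<Sum>i<y. S i)"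
      have Sle: "S i \<le> s" if "i < y" for i
        unfolding s_def using member_le_sum[of i "{..<y}" S] that by (simp add: trans_le_add2)
      have "Ff (s # m # x # i # xs) = Suc (Suc (z i))" if "i < y" for i
        by (rule stage_function_mono[OF f _ S(2)[OF that] Sle[OF that]]) (use that k in simp_all)
      moreover have "Ff (s # m # x # y # xs) = Suc 0"
        using stage_function_mono[OF f _ S(1), of s] k by (simp add: s_def)
      ultimately have "P s m x xs y" by (simp add: P_def)
      moreover have "y < s" by (simp add: s_def)
      ultimately show "\<exists>s. y < s \<and> P s m x xs y" by blast
    next
      assume "\<exists>s. y < s \<and> P s m x xs y"
      then obtain s where s: "P s m x xs y" by blast
      have "Ff (s # m # x # i # xs) = Suc (Suc (Ff (s # m # x # i # xs) - 2))" if "i < y" for i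
      proof -
        have "1 < Ff (s # m # x # i # xs)" using s that unfolding P_def by blast
        then show ?thesis by linarith
      qed
      moreover have "Ff (s # m # x # y # xs) = Suc 0" using s unfolding P_def by simp
      ultimately show "(\<exists>s. Ff (s # m # x # y # xs) = Suc 0) \<and> (\<forall>i<y. \<exists>z s. Ff (s # m # x # i # xs) = Suc (Suc z))"
        by blast
    qed
  qed
  then show ?thesis by blast
qed

text \<open>The induction covers all arities at once, because \<open>Comp\<close>,
  \<open>Prec\<close> and \<open>Mu\<close> change the number of arguments. A program applied to a
  wrong number of arguments never halts, which the constant 0 expresses.\<close>

lemma ex_stage_function:
  assumes G: "total_computable 3 (\<lambda>xs. G (xs ! 0) (xs ! 1) (xs ! 2))"
  shows "\<exists>F. stage_function G k p F"
proof (induction p arbitrary: k)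
  case Zero
  have "stage_function G k Zero (\<lambda>ys. 1)"
    by (rule stage_functionI) (auto simp: halts_within_Zero intro: computable_intros)
  then show ?case by blast
next
  case Succ
  have "stage_function G k Succ (\<lambda>ys. if k = 1 then Suc (Suc (ys ! 3)) else 0)"
    by (rule stage_functionI; cases "k = 1")
      (auto simp: halts_within_Succ numeral_3_eq_3 split: if_splits intro!: computable_intros)
  then show ?case by blast
next
  case (Proj i)
  have "stage_function G k (Proj i) (\<lambda>ys. if i < k then Suc (ys ! (i + 3)) else 0)"
    by (rule stage_functionI; cases "i < k")
      (auto simp: halts_within_Proj numeral_3_eq_3 split: if_splits intro!: computable_intros)
  then show ?case by blast
next
  case Oracle
  have "stage_function G k Oracle (\<lambda>ys. if k = 1 then G (ys ! 1) (ys ! 2) (ys ! 3) else 0)"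
  proof (rule stage_functionI)
    show "total_computable (3 + k) (\<lambda>ys. if k = 1 then G (ys ! 1) (ys ! 2) (ys ! 3) else 0)"
      by (cases "k = 1") (auto intro!: total_computable_compose3[OF G] computable_intros)
  qed (auto simp: halts_within_Oracle numeral_3_eq_3 numeral_2_eq_2 split: if_splits)
  then show ?case by blast
next
  case (Comp f gs)
  obtain Ff where Ff: "stage_function G (length gs) f Ff" using Comp(1) by blast
  obtain Fg where "\<And>g. g \<in> set gs \<Longrightarrow> stage_function G k g (Fg g)" using Comp(2)[of _ k] by metis
  with Ff show ?case by (rule stage_function_Comp)
next
  case (Prec f g)
  show ?case
  proof (cases k)
    case 0
    have "stage_function G k (Prec f g) (\<lambda>ys. 0)"
      by (rule stage_functionI) (auto simp: halts_within_Prec_Nil 0 intro: computable_intros)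
    then show ?thesis by blast
  next
    case (Suc k')
    then show ?thesis using Prec stage_function_Prec by blast
  qed
next
  case (Mu f)
  then show ?case using stage_function_Mu by blast
qed

section \<open>Strings as numbers\<close>

definition string_of :: "nat \<Rightarrow> bool list" where
  "string_of = inv string_code"

lemma string_code_string_of [simp]: "string_code (string_of n) = n"
  unfolding string_of_def by (rule surj_f_inv_f[OF surj_string_code])

lemma string_of_string_code [simp]: "string_of (string_code \<sigma>) = \<sigma>"
  unfolding string_of_def by (rule inv_f_f[OF inj_string_code])

lemma string_code_append: "string_code (\<sigma> @ \<tau>) = string_code \<sigma> + 2 ^ length \<sigma> * string_code \<tau>"
  by (induction \<sigma>) (auto simp: algebra_simps)

lemma string_code_bounds: "2 ^ length \<sigma> \<le> Suc (string_code \<sigma>) \<and> Suc (string_code \<sigma>) < 2 ^ Suc (length \<sigma>)"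
  by (induction \<sigma>) auto

lemma length_le_string_code: "length \<sigma> \<le> string_code \<sigma>"
  by (induction \<sigma>) auto

text \<open>This is floor(log(n + 1)), written as a bounded count to make it visibly
  computable.\<close>

definition code_length :: "nat \<Rightarrow> nat" where
  "code_length n = (\<Sum>k<n. of_bool (2 ^ Suc k \<le> Suc n))"

lemma code_length_string_code [simp]: "code_length (string_code \<sigma>) = length \<sigma>"
proof -
  let ?n = "string_code \<sigma>"
  have "2 ^ Suc k \<le> Suc ?n \<longleftrightarrow> k < length \<sigma>" for k
  proof
    assume "2 ^ Suc k \<le> Suc ?n"
    then have "(2::nat) ^ Suc k < 2 ^ Suc (length \<sigma>)"
      using string_code_bounds[of \<sigma>] by linarith
    then show "k < length \<sigma>" by (simp only: power_strict_increasing_iff Suc_less_eq)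
  next
    assume "k < length \<sigma>"
    then have "(2::nat) ^ Suc k \<le> 2 ^ length \<sigma>" by (intro power_increasing) auto
    then show "2 ^ Suc k \<le> Suc ?n" using string_code_bounds[of \<sigma>] by linarith
  qed
  then have "code_length ?n = card {k. k < ?n \<and> k < length \<sigma>}"
    by (simp add: code_length_def of_bool_def sum.If_cases Int_def)
  also have "{k. k < ?n \<and> k < length \<sigma>} = {..<length \<sigma>}"
    using length_le_string_code[of \<sigma>] by auto
  finally show ?thesis by simp
qed

lemma code_length_eq: "code_length n = length (string_of n)"
  by (metis code_length_string_code string_code_string_of)

lemma total_computable_code_length [computable_intros]:
  assumes "total_computable k f" shows "total_computable k (\<lambda>xs. code_length (f xs))"
proof (rule total_computable_compose1[OF _ assms])
  show "total_computable 1 (\<lambda>xs. code_length (xs ! 0))"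
    unfolding code_length_def by (intro computable_intros) simp_all
qed

text \<open>Dropping the first \<open>k\<close> bits maps the code \<open>n\<close> to \<open>(n - (2 ^ k - 1)) div 2 ^ k\<close>, and the
  parity of a nonzero code gives its first bit.\<close>

definition code_bit :: "nat \<Rightarrow> nat \<Rightarrow> bool" where
  "code_bit n k \<longleftrightarrow> even ((Suc n - 2 ^ k) div 2 ^ k)"

lemma string_code_drop:
  assumes "k \<le> length \<sigma>" shows "(Suc (string_code \<sigma>) - 2 ^ k) div 2 ^ k = string_code (drop k \<sigma>)"
proof -
  let ?u = "take k \<sigma>" and ?v = "drop k \<sigma>"
  have "string_code \<sigma> = string_code ?u + 2 ^ k * string_code ?v"
    using string_code_append[of ?u ?v] assms by simp
  moreover have "2 ^ k \<le> Suc (string_code ?u)" "Suc (string_code ?u) < 2 ^ k + 2 ^ k"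
    using string_code_bounds[of ?u] assms by auto
  ultimately have "Suc (string_code \<sigma>) - 2 ^ k = (Suc (string_code ?u) - 2 ^ k) + 2 ^ k * string_code ?v"
    "Suc (string_code ?u) - 2 ^ k < 2 ^ k" by linarith+
  then show ?thesis by simp
qed

lemma code_bit_string_code:
  assumes "k < length \<sigma>" shows "code_bit (string_code \<sigma>) k = \<sigma> ! k"
proof -
  have "drop k \<sigma> = \<sigma> ! k # drop (Suc k) \<sigma>" using assms by (simp add: Cons_nth_drop_Suc)
  then show ?thesis
    using string_code_drop[of k \<sigma>] assms unfolding code_bit_def by (cases "\<sigma> ! k") simp_all
qed

lemma decidable_even: "total_computable k f \<Longrightarrow> decidable k (\<lambda>xs. even (f xs))"
  unfolding even_iff_mod_2_eq_zero by (intro computable_intros)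

lemma decidable_code_bit [computable_intros]:
  "total_computable k f \<Longrightarrow> total_computable k g \<Longrightarrow> decidable k (\<lambda>xs. code_bit (f xs) (g xs))"
  unfolding code_bit_def by (intro computable_intros decidable_even)

text \<open>Fields of descriptions and prefixes of reals are read with the most significant bit
  first, unlike the digits in \<open>string_code\<close>.\<close>

fun bits_value :: "bool list \<Rightarrow> nat" where
  "bits_value [] = 0"
| "bits_value (b # \<sigma>) = of_bool b * 2 ^ length \<sigma> + bits_value \<sigma>"

fun to_bits :: "nat \<Rightarrow> nat \<Rightarrow> bool list" where
  "to_bits 0 j = []"
| "to_bits (Suc l) j = odd (j div 2 ^ l) # to_bits l j"

lemma length_to_bits [simp]: "length (to_bits l j) = l"
  by (induction l) auto

lemma bits_value_to_bits: "bits_value (to_bits l j) = j mod 2 ^ l"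
proof (induction l)
  case (Suc l)
  have "j mod (2 ^ l * 2) = 2 ^ l * (j div 2 ^ l mod 2) + j mod 2 ^ l"
    by (rule mod_mult2_eq)
  with Suc show ?case by (simp add: mult.commute odd_iff_mod_2_eq_one split: if_splits)
qed simp

lemma bits_value_snoc: "bits_value (\<sigma> @ [b]) = 2 * bits_value \<sigma> + of_bool b"
  by (induction \<sigma>) auto

definition code_segment :: "nat \<Rightarrow> nat \<Rightarrow> nat \<Rightarrow> nat" where
  "code_segment n a l = rec_nat 0 (\<lambda>i z. 2 * z + of_bool (code_bit n (a + i))) l"

lemma code_segment_string_code:
  assumes "a + l \<le> length \<sigma>"
  shows "code_segment (string_code \<sigma>) a l = bits_value (take l (drop a \<sigma>))"
  using assms
proof (induction l)
  case (Suc l)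
  then have "take (Suc l) (drop a \<sigma>) = take l (drop a \<sigma>) @ [\<sigma> ! (a + l)]"
    by (simp add: take_Suc_conv_app_nth)
  with Suc show ?case by (simp add: code_segment_def bits_value_snoc code_bit_string_code)
qed (simp add: code_segment_def)

lemma total_computable_code_segment [computable_intros]:
  assumes "total_computable k f" "total_computable k g" "total_computable k l"
  shows "total_computable k (\<lambda>xs. code_segment (f xs) (g xs) (l xs))"
proof (rule total_computable_compose3[OF _ assms])
  show "total_computable 3 (\<lambda>xs. code_segment (xs ! 0) (xs ! 1) (xs ! 2))"
    unfolding code_segment_def by (intro computable_intros) simp_all
qed

lemma total_computable_to_bits [computable_intros]:
  assumes "total_computable k f" "total_computable k g"
  shows "total_computable k (\<lambda>xs. string_code (to_bits (f xs) (g xs)))"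
proof (rule total_computable_compose2[OF _ assms])
  have "string_code (to_bits l j) = rec_nat 0 (\<lambda>i z. (if even (j div 2 ^ i) then 1 else 2) + 2 * z) l" for l j
    by (induction l) auto
  then show "total_computable 2 (\<lambda>xs. string_code (to_bits (xs ! 0) (xs ! 1)))"
    by (simp only:) (intro computable_intros decidable_even; simp)
qed

lemma to_bits_eq_map: "to_bits n j = map (\<lambda>i. odd (j div 2 ^ (n - i))) [1..<Suc n]"
proof (induction n)
  case (Suc n)
  have "map (\<lambda>i. odd (j div 2 ^ (Suc n - i))) [1..<Suc (Suc n)] =
      odd (j div 2 ^ n) # map (\<lambda>i. odd (j div 2 ^ (Suc n - i))) [Suc 1..<Suc (Suc n)]"
    by (subst upt_conv_Cons) auto
  also have "[Suc 1..<Suc (Suc n)] = map Suc [1..<Suc n]"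
    by (simp add: map_Suc_upt)
  finally show ?case using Suc by (simp add: comp_def)
qed simp

text \<open>Truncating a prefix of length \<open>n\<close> to length \<open>i\<close> is a division,
  so prefixes of reals can be handled as numbers.\<close>

lemma nat_floor_power2_div:
  fixes x :: real
  assumes "0 \<le> x" "i \<le> n" shows "nat \<lfloor>2 ^ n * x\<rfloor> div 2 ^ (n - i) = nat \<lfloor>2 ^ i * x\<rfloor>"
proof -
  have "\<lfloor>2 ^ i * x\<rfloor> = \<lfloor>2 ^ n * x / of_int (2 ^ (n - i))\<rfloor>"
  proof -
    have "(2::real) ^ n = 2 ^ i * 2 ^ (n - i)" using assms(2) by (simp flip: power_add)
    then show ?thesis by simp
  qed
  also have "\<dots> = \<lfloor>2 ^ n * x\<rfloor> div 2 ^ (n - i)"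
    by (rule floor_divide_real_eq_div) simp
  also have "\<dots> = int (nat \<lfloor>2 ^ n * x\<rfloor> div 2 ^ (n - i))"
    using assms by (simp add: zdiv_int)
  finally show ?thesis by simp
qed

lemma binary_digit_eq:
  assumes "0 \<le> x" "i \<le> n" shows "binary_digit x i = odd (nat \<lfloor>2 ^ n * x\<rfloor> div 2 ^ (n - i))"
  using assms by (simp add: nat_floor_power2_div binary_digit_def even_nat_iff)

lemma initial_bits_eq_to_bits:
  assumes "0 \<le> x" shows "initial_bits x n = to_bits n (nat \<lfloor>2 ^ n * x\<rfloor>)"
  unfolding initial_bits_def to_bits_eq_map using assms
  by (intro map_cong refl binary_digit_eq) auto

section \<open>Machines defined by search\<close>

text \<open>Every machine constructed below has this form, so its computability reduces to that of
  \<open>R\<close> and \<open>g\<close>.\<close>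

definition search_machine :: "(nat \<Rightarrow> nat \<Rightarrow> bool) \<Rightarrow> (nat \<Rightarrow> nat \<Rightarrow> nat) \<Rightarrow> bool list \<rightharpoonup> bool list" where
  "search_machine R g \<sigma> = (if \<exists>t. R t (string_code \<sigma>)
     then Some (string_of (g (LEAST t. R t (string_code \<sigma>)) (string_code \<sigma>))) else None)"

lemma halts_within_total:
  assumes "\<And>A xs. length xs = k \<Longrightarrow> eval A p xs (f xs) {}" "length xs = k"
  shows "halts_within A D p xs y \<longleftrightarrow> y = f xs"
  using assms eval_deterministic unfolding halts_within_def by blast

lemma partial_computable_iff:
  "partial_computable M \<longleftrightarrow> (\<exists>p. \<forall>\<sigma> \<tau>.
    M \<sigma> = Some \<tau> \<longleftrightarrow> halts_within (\<lambda>_. 0) UNIV p [string_code \<sigma>] (string_code \<tau>))"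
  unfolding partial_computable_def halts_within_def by simp

lemma partial_computable_search_machine:
  assumes R: "decidable 2 (\<lambda>xs. R (xs ! 0) (xs ! 1))"
    and g: "total_computable 2 (\<lambda>xs. g (xs ! 0) (xs ! 1))"
  shows "partial_computable (search_machine R g)"
proof -
  obtain pg where pg: "\<And>A xs. length xs = 2 \<Longrightarrow> eval A pg xs (g (xs ! 0) (xs ! 1)) {}"
    using g unfolding total_computable_def by blast
  obtain pR where pR: "\<And>A xs. length xs = 2 \<Longrightarrow> eval A pR xs (of_bool (\<not> R (xs ! 0) (xs ! 1))) {}"
    using decidable_not[OF R] unfolding total_computable_def by blast
  let ?H = "halts_within (\<lambda>_. 0) UNIV"
  have H_pR: "?H pR [t, i] y \<longleftrightarrow> y = of_bool (\<not> R t i)" for t i y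
    by (subst halts_within_total[OF pR]) simp_all
  have H_pg: "?H pg [t, i] y \<longleftrightarrow> y = g t i" for t i y
    by (subst halts_within_total[OF pg]) simp_all
  have Mu: "?H (Mu pR) [i] t \<longleftrightarrow> R t i \<and> (\<forall>t'<t. \<not> R t' i)" for i t
    unfolding halts_within_Mu H_pR by auto
  have "?H (Comp pg [Mu pR, Proj 0]) [i] y \<longleftrightarrow> (\<exists>t. R t i) \<and> y = g (LEAST t. R t i) i" for i y
  proof -
    have "?H (Comp pg [Mu pR, Proj 0]) [i] y \<longleftrightarrow> (\<exists>t. ?H (Mu pR) [i] t \<and> ?H pg [t, i] y)"
    proof
      assume "?H (Comp pg [Mu pR, Proj 0]) [i] y"
      then obtain ys where "length ys = 2" "?H (Mu pR) [i] (ys ! 0)" "?H (Proj 0) [i] (ys ! 1)" "?H pg ys y"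
        unfolding halts_within_Comp by (force simp: less_Suc_eq numeral_2_eq_2)
      moreover from this have "ys = [ys ! 0, i]"
        by (intro nth_equalityI) (auto simp: halts_within_Proj less_Suc_eq numeral_2_eq_2)
      ultimately show "\<exists>t. ?H (Mu pR) [i] t \<and> ?H pg [t, i] y" by metis
    next
      assume "\<exists>t. ?H (Mu pR) [i] t \<and> ?H pg [t, i] y"
      then obtain t where "?H (Mu pR) [i] t" "?H pg [t, i] y" by blast
      then show "?H (Comp pg [Mu pR, Proj 0]) [i] y"
        unfolding halts_within_Comp
        by (intro exI[of _ "[t, i]"]) (auto simp: halts_within_Proj less_Suc_eq)
    qed
    also have "\<dots> \<longleftrightarrow> (\<exists>t. R t i \<and> (\<forall>t'<t. \<not> R t' i) \<and> y = g t i)"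
      unfolding Mu H_pg by auto
    also have "\<dots> \<longleftrightarrow> (\<exists>t. R t i) \<and> y = g (LEAST t. R t i) i"
    proof -
      have "t = (LEAST t. R t i)" if "R t i" "\<forall>t'<t. \<not> R t' i" for t
        using that by (metis LeastI Least_le not_less order_le_less)
      moreover have "R (LEAST t. R t i) i \<and> (\<forall>t'<(LEAST t. R t i). \<not> R t' i)" if "\<exists>t. R t i"
        using that LeastI_ex not_less_Least by metis
      ultimately show ?thesis by metis
    qed
    finally show ?thesis .
  qed
  then have "search_machine R g \<sigma> = Some \<tau> \<longleftrightarrow>
      ?H (Comp pg [Mu pR, Proj 0]) [string_code \<sigma>] (string_code \<tau>)" for \<sigma> \<tau>
    by (auto simp: search_machine_def) (metis string_of_string_code)
  then show ?thesis unfolding partial_computable_iff by blast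
qed

lemma partial_computable_stages:
  assumes "partial_computable M"
  obtains F where "total_computable 2 (\<lambda>xs. F (xs ! 0) (xs ! 1))"
    "\<And>s i y s'. F s i = Suc y \<Longrightarrow> s \<le> s' \<Longrightarrow> F s' i = Suc y"
    "\<And>\<sigma> \<tau>. M \<sigma> = Some \<tau> \<longleftrightarrow> (\<exists>s. F s (string_code \<sigma>) = Suc (string_code \<tau>))"
proof -
  obtain p where p: "\<And>\<sigma> \<tau>. M \<sigma> = Some \<tau> \<longleftrightarrow>
      halts_within (\<lambda>_. 0) UNIV p [string_code \<sigma>] (string_code \<tau>)"
    using assms unfolding partial_computable_iff by blast
  \<comment> \<open>The constant 1 makes every position available with value 0: this is the zero
    oracle.\<close>
  obtain F where F: "stage_function (\<lambda>_ _ _. 1) 1 p F"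
    using ex_stage_function[of "\<lambda>_ _ _. 1" 1 p] total_computable_const by blast
  show thesis
  proof (rule that[of "\<lambda>s i. F [s, 0, 0, i]"])
    have "total_computable 2 (\<lambda>xs. F (map (\<lambda>h. h xs) [\<lambda>xs. xs ! 0, \<lambda>xs. 0, \<lambda>xs. 0, \<lambda>xs. xs ! 1]))"
      by (rule total_computable_compose)
        (use stage_function_computable[OF F] in \<open>auto intro!: computable_intros simp: numeral_eq_Suc\<close>)
    then show "total_computable 2 (\<lambda>xs. F [xs ! 0, 0, 0, xs ! 1])" by simp
  next
    show "F [s', 0, 0, i] = Suc y" if "F [s, 0, 0, i] = Suc y" "s \<le> s'" for s i y s'
      using stage_function_mono[OF F _ that(1) that(2)] by simp
  next
    show "M \<sigma> = Some \<tau> \<longleftrightarrow> (\<exists>s. F [s, 0, 0, string_code \<sigma>] = Suc (string_code \<tau>))" for \<sigma> \<tau>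
      using stage_function_iff[OF F, where xs = "[string_code \<sigma>]" and m = 0 and x = 0 and y = "string_code \<tau>"]
        p[of \<sigma> \<tau>] by simp
  qed
qed

section \<open>Halting probabilities and their approximations\<close>

lemma two_power_diff: "l \<le> s \<Longrightarrow> (2::real) ^ (s - l) = 2 ^ s * (1 / 2) ^ l"
  by (simp add: power_diff power_one_over field_simps)

text \<open>Extend all strings to a common length \<open>L\<close>: the sets of extensions are
  disjoint and together have at most \<open>2 ^ L\<close> elements.\<close>

lemma kraft_inequality:
  fixes S :: "bool list set"
  assumes "finite S" "pairwise (\<parallel>) S"
  shows "(\<Sum>\<sigma>\<in>S. (1 / 2) ^ length \<sigma>) \<le> (1::real)"
proof -
  obtain L where L: "\<And>\<sigma>. \<sigma> \<in> S \<Longrightarrow> length \<sigma> \<le> L"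
    using assms(1) by (metis finite_imageI Max_ge imageI)
  define B where "B l = {w :: bool list. length w = l}" for l
  have B: "finite (B l)" "card (B l) = 2 ^ l" for l
  proof -
    have "B l = {w. set w \<subseteq> (UNIV :: bool set) \<and> length w = l}" by (auto simp: B_def)
    then show "finite (B l)" "card (B l) = 2 ^ l"
      using finite_lists_length_eq[of "UNIV :: bool set" l] card_lists_length_eq[of "UNIV :: bool set" l]
      by simp_all
  qed
  define E where "E \<sigma> = (@) \<sigma> ` B (L - length \<sigma>)" for \<sigma>
  have E: "finite (E \<sigma>)" "card (E \<sigma>) = 2 ^ (L - length \<sigma>)" for \<sigma>
    unfolding E_def using B by (simp_all add: card_image inj_on_def)
  have "E \<sigma> \<inter> E \<tau> = {}" if "\<sigma> \<in> S" "\<tau> \<in> S" "\<sigma> \<noteq> \<tau>" for \<sigma> \<tau> :: "bool list"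
  proof -
    have "\<sigma> \<parallel> \<tau>" using that assms(2) by (auto simp: pairwise_def)
    then show ?thesis unfolding E_def
      by (auto simp: append_eq_append_conv2 parallel_def prefix_def)
  qed
  then have "(\<Sum>\<sigma>\<in>S. card (E \<sigma>)) = card (\<Union>\<sigma>\<in>S. E \<sigma>)"
    using E assms(1) by (subst card_UN_disjoint) auto
  also have "\<dots> \<le> card (B L)"
    by (intro card_mono B) (use L in \<open>auto simp: E_def B_def\<close>)
  finally have "(\<Sum>\<sigma>\<in>S. 2 ^ (L - length \<sigma>)) \<le> (2::nat) ^ L" by (simp add: E B)
  then have "real (\<Sum>\<sigma>\<in>S. 2 ^ (L - length \<sigma>)) \<le> real (2 ^ L)"
    by (simp only: of_nat_le_iff)
  moreover have "real (\<Sum>\<sigma>\<in>S. 2 ^ (L - length \<sigma>)) = 2 ^ L * (\<Sum>\<sigma>\<in>S. (1 / 2) ^ length \<sigma>)"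
    unfolding sum_distrib_left of_nat_sum
    by (intro sum.cong) (use L in \<open>auto simp: two_power_diff\<close>)
  ultimately show ?thesis by simp
qed

lemma weight_summable_on:
  fixes D :: "bool list set"
  assumes "pairwise (\<parallel>) D"
  shows "(\<lambda>\<sigma>. (1 / 2 :: real) ^ length \<sigma>) summable_on D"
proof (rule nonneg_bounded_partial_sums_imp_summable_on)
  show "\<forall>\<^sub>F S in finite_subsets_at_top D. (\<Sum>\<sigma>\<in>S. (1 / 2 :: real) ^ length \<sigma>) \<le> 1"
    by (intro eventually_finite_subsets_at_top_weakI kraft_inequality)
      (use assms in \<open>auto intro: pairwise_subset\<close>)
qed simp

locale staged_machine =
  fixes U :: "bool list \<rightharpoonup> bool list" and F :: "nat \<Rightarrow> nat \<Rightarrow> nat"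
  assumes prefix_free: "prefix_free_machine U"
    and F_computable: "total_computable 2 (\<lambda>xs. F (xs ! 0) (xs ! 1))"
    and F_mono: "F s i = Suc y \<Longrightarrow> s \<le> s' \<Longrightarrow> F s' i = Suc y"
    and F_iff: "U \<sigma> = Some \<tau> \<longleftrightarrow> (\<exists>s. F s (string_code \<sigma>) = Suc (string_code \<tau>))"
begin

definition halted :: "nat \<Rightarrow> bool list set" where
  "halted s = {\<sigma>. string_code \<sigma> < s \<and> F s (string_code \<sigma>) \<noteq> 0}"

text \<open>The numerator of \<open>approx s\<close> over \<open>2 ^ s\<close>. A string with code
  below \<open>s\<close> has length at most \<open>s\<close>, so the exponent is not truncated.
  Comparisons of \<open>approx\<close> with dyadic rationals thus become decidable.\<close>

definition scaled_approx :: "nat \<Rightarrow> nat" where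
  "scaled_approx s = (\<Sum>i<s. of_bool (F s i \<noteq> 0) * 2 ^ (s - code_length i))"

definition approx :: "nat \<Rightarrow> real" where
  "approx s = real (scaled_approx s) / 2 ^ s"

lemma total_computable_F [computable_intros]:
  "total_computable k f \<Longrightarrow> total_computable k g \<Longrightarrow> total_computable k (\<lambda>xs. F (f xs) (g xs))"
  by (rule total_computable_compose2[OF F_computable])

lemma total_computable_scaled_approx [computable_intros]:
  assumes "total_computable k f" shows "total_computable k (\<lambda>xs. scaled_approx (f xs))"
proof (rule total_computable_compose1[OF _ assms])
  show "total_computable 1 (\<lambda>xs. scaled_approx (xs ! 0))"
    unfolding scaled_approx_def by (intro computable_intros) simp_all
qed

lemma finite_halted [simp]: "finite (halted s)"
proof (rule finite_subset)
  show "halted s \<subseteq> string_of ` {..<s}"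
    unfolding halted_def by (auto simp: image_iff intro!: bexI[of _ "string_code _"])
qed simp

lemma approx_eq: "approx s = (\<Sum>\<sigma>\<in>halted s. (1 / 2) ^ length \<sigma>)"
proof -
  have "real (scaled_approx s) = (\<Sum>i<s. of_bool (F s i \<noteq> 0) * 2 ^ (s - code_length i))"
    by (simp add: scaled_approx_def)
  also have "\<dots> = (\<Sum>i | i < s \<and> F s i \<noteq> 0. 2 ^ (s - code_length i))"
    by (rule sum.mono_neutral_cong_right) auto
  also have "\<dots> = (\<Sum>\<sigma>\<in>halted s. 2 ^ (s - length \<sigma>))"
    by (rule sum.reindex_bij_witness[of _ string_code string_of])
      (auto simp: halted_def code_length_eq)
  also have "\<dots> = (\<Sum>\<sigma>\<in>halted s. 2 ^ s * (1 / 2) ^ length \<sigma>)"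
  proof (intro sum.cong refl)
    fix \<sigma> assume "\<sigma> \<in> halted s"
    then have "length \<sigma> \<le> s" using length_le_string_code[of \<sigma>] by (auto simp: halted_def)
    then show "2 ^ (s - length \<sigma>) = (2 ^ s * (1 / 2) ^ length \<sigma> :: real)"
      by (rule two_power_diff)
  qed
  finally show ?thesis by (simp add: approx_def flip: sum_distrib_left)
qed

lemma F_output: "F s (string_code \<sigma>) = Suc y \<Longrightarrow> U \<sigma> = Some (string_of y)"
  unfolding F_iff by auto

lemma halted_subset_dom: "halted s \<subseteq> dom U"
proof
  fix \<sigma> assume "\<sigma> \<in> halted s"
  then obtain y where "F s (string_code \<sigma>) = Suc y" by (auto simp: halted_def gr0_conv_Suc)
  then show "\<sigma> \<in> dom U" using F_output by blast
qed

lemma halted_mono: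
  assumes "s \<le> s'" shows "halted s \<subseteq> halted s'"
proof
  fix \<sigma> assume "\<sigma> \<in> halted s"
  then obtain y where "string_code \<sigma> < s" "F s (string_code \<sigma>) = Suc y"
    by (auto simp: halted_def gr0_conv_Suc)
  with F_mono[OF this(2) assms] assms show "\<sigma> \<in> halted s'" by (simp add: halted_def)
qed

lemma ex_halted:
  assumes "finite T" "T \<subseteq> dom U" shows "\<exists>s. T \<subseteq> halted s"
  using assms
proof (induction T rule: finite_induct)
  case (insert \<sigma> T)
  then obtain s where s: "T \<subseteq> halted s" by auto
  from insert obtain \<tau> t where t: "F t (string_code \<sigma>) = Suc (string_code \<tau>)"
    using F_iff by blast
  let ?r = "s + t + Suc (string_code \<sigma>)"
  have "\<sigma> \<in> halted ?r" using F_mono[OF t, of ?r] by (simp add: halted_def)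
  moreover have "T \<subseteq> halted ?r" using s halted_mono[of s ?r] by auto
  ultimately show ?case by blast
qed simp

lemma summable: "(\<lambda>\<sigma>. (1 / 2 :: real) ^ length \<sigma>) summable_on dom U"
  using prefix_free by (intro weight_summable_on) (simp add: prefix_free_machine_def)

lemma sum_le_halting_probability:
  assumes "finite T" "T \<subseteq> dom U"
  shows "(\<Sum>\<sigma>\<in>T. (1 / 2) ^ length \<sigma>) \<le> halting_probability U"
  unfolding halting_probability_def using assms summable by (intro finite_sum_le_infsum) auto

lemma approx_mono: "s \<le> s' \<Longrightarrow> approx s \<le> approx s'"
  unfolding approx_eq by (intro sum_mono2 halted_mono) auto

lemma ex_approx:
  assumes "x < halting_probability U" shows "\<exists>s. x < approx s"
proof -
  have "((\<lambda>\<sigma>. (1 / 2 :: real) ^ length \<sigma>) has_sum halting_probability U) (dom U)"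
    unfolding halting_probability_def by (intro has_sum_infsum summable)
  then have "\<forall>\<^sub>F T in finite_subsets_at_top (dom U). x < (\<Sum>\<sigma>\<in>T. (1 / 2) ^ length \<sigma>)"
    using assms unfolding has_sum_def by (intro order_tendstoD)
  then obtain T where T: "finite T" "T \<subseteq> dom U" "x < (\<Sum>\<sigma>\<in>T. (1 / 2) ^ length \<sigma>)"
    unfolding eventually_finite_subsets_at_top by blast
  then obtain s where "T \<subseteq> halted s" using ex_halted by blast
  then have "(\<Sum>\<sigma>\<in>T. (1 / 2 :: real) ^ length \<sigma>) \<le> approx s"
    unfolding approx_eq by (intro sum_mono2) auto
  with T show ?thesis by (intro exI[of _ s]) linarith
qed

lemma halting_probability_bounds: "0 \<le> halting_probability U" "halting_probability U \<le> 1"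
proof -
  show "0 \<le> halting_probability U"
    unfolding halting_probability_def by (intro infsum_nonneg) simp
  show "halting_probability U \<le> 1"
  proof (rule ccontr)
    assume "\<not> halting_probability U \<le> 1"
    then obtain s where "1 < approx s" using ex_approx[of 1] by auto
    moreover have "approx s \<le> 1"
      unfolding approx_eq using prefix_free halted_subset_dom
      by (intro kraft_inequality) (auto simp: prefix_free_machine_def intro: pairwise_subset)
    ultimately show False by simp
  qed
qed

end

lemma ex_staged_machine:
  assumes "prefix_free_machine U" shows "\<exists>F. staged_machine U F"
proof -
  have "partial_computable U" using assms by (simp add: prefix_free_machine_def)
  then show ?thesis
  proof (rule partial_computable_stages)
    fix F assume "total_computable 2 (\<lambda>xs. F (xs ! 0) (xs ! 1))"
      "\<And>s i y s'. F s i = Suc y \<Longrightarrow> s \<le> s' \<Longrightarrow> F s' i = Suc y"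
      "\<And>\<sigma> \<tau>. U \<sigma> = Some \<tau> \<longleftrightarrow> (\<exists>s. F s (string_code \<sigma>) = Suc (string_code \<tau>))"
    then have "staged_machine U F" using assms by unfold_locales blast+
    then show ?thesis by blast
  qed
qed

locale universal_staged_machine = staged_machine +
  assumes universal: "universal_prefix_free_machine U"
begin

text \<open>The searching machine outputs the code of a string that \<open>U\<close> has not produced by the stage
  at which the search ends. So the description of that string by \<open>U\<close> contributes
  to the halting probability only after this stage.\<close>

lemma halting_probability_gap:
  assumes R: "decidable 2 (\<lambda>xs. R (xs ! 0) (xs ! 1))"
    and R_prefix_free: "pairwise (\<parallel>) {\<sigma>. \<exists>t. R t (string_code \<sigma>)}"
  shows "\<exists>c. \<forall>\<sigma> t. R t (string_code \<sigma>) \<longrightarrow>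
    (\<exists>t0. R t0 (string_code \<sigma>) \<and> approx t0 + (1 / 2) ^ (c + length \<sigma>) \<le> halting_probability U)"
proof -
  \<comment> \<open>The sum is at least every \<open>F t k\<close> with \<open>k < t\<close>, and a
    nonzero \<open>F t k\<close> is an output code plus one. So \<open>g t i\<close> exceeds all
    output codes that have appeared below \<open>t\<close> by stage \<open>t\<close>.\<close>
  define g :: "nat \<Rightarrow> nat \<Rightarrow> nat" where "g t i = (\<Sum>k<t. F t k)" for t i
  have "total_computable 2 (\<lambda>xs. g (xs ! 0) (xs ! 1))"
    unfolding g_def by (intro computable_intros) simp_all
  then have "partial_computable (search_machine R g)"
    by (intro partial_computable_search_machine R)
  moreover have "dom (search_machine R g) = {\<sigma>. \<exists>t. R t (string_code \<sigma>)}"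
    by (auto simp: search_machine_def dom_def split: if_splits)
  ultimately have "prefix_free_machine (search_machine R g)"
    using R_prefix_free by (simp add: prefix_free_machine_def)
  then obtain \<rho> where \<rho>: "\<And>\<tau>. U (\<rho> @ \<tau>) = search_machine R g \<tau>"
    using universal unfolding universal_prefix_free_machine_def by blast
  have "\<exists>t0. R t0 (string_code \<sigma>) \<and> approx t0 + (1 / 2) ^ (length \<rho> + length \<sigma>) \<le> halting_probability U"
    if "R t (string_code \<sigma>)" for \<sigma> t
  proof -
    define t0 where "t0 = (LEAST t. R t (string_code \<sigma>))"
    have R0: "R t0 (string_code \<sigma>)" unfolding t0_def using that by (rule LeastI)
    have out: "U (\<rho> @ \<sigma>) = Some (string_of (g t0 (string_code \<sigma>)))"
      using that \<rho>[of \<sigma>] unfolding t0_def search_machine_def by auto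
    have "\<rho> @ \<sigma> \<notin> halted t0"
    proof
      assume *: "\<rho> @ \<sigma> \<in> halted t0"
      let ?i = "string_code (\<rho> @ \<sigma>)"
      from * obtain y where i: "?i < t0" "F t0 ?i = Suc y" by (auto simp: halted_def gr0_conv_Suc)
      then have "string_of y = string_of (g t0 (string_code \<sigma>))" using F_output out by auto
      then have "y = g t0 (string_code \<sigma>)" by (metis string_code_string_of)
      moreover have "F t0 ?i \<le> g t0 (string_code \<sigma>)"
        unfolding g_def using i(1) by (intro member_le_sum) auto
      ultimately show False using i(2) by simp
    qed
    then have "approx t0 + (1 / 2) ^ length (\<rho> @ \<sigma>) =
        (\<Sum>\<sigma>\<in>insert (\<rho> @ \<sigma>) (halted t0). (1 / 2) ^ length \<sigma>)"
      by (simp add: approx_eq)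
    also have "\<dots> \<le> halting_probability U"
      using out halted_subset_dom by (intro sum_le_halting_probability) auto
    finally show ?thesis using R0 by auto
  qed
  then show ?thesis by blast
qed

end

lemma omega_number_staged:
  assumes "omega_number x"
  obtains U F where "universal_staged_machine U F" "x = halting_probability U"
proof -
  obtain U where U: "universal_prefix_free_machine U" "x = halting_probability U"
    using assms unfolding omega_number_def by blast
  then obtain F where "staged_machine U F"
    using ex_staged_machine unfolding universal_prefix_free_machine_def by blast
  with U that show thesis
    unfolding universal_staged_machine_def universal_staged_machine_axioms_def by blast
qed

section \<open>Gaps to the right of dyadic rationals\<close>

lemma replicate_False_True_eq_iff:
  "replicate t False @ True # a = replicate t' False @ True # b \<longleftrightarrow> t = t' \<and> a = b"
proof (induction t arbitrary: t')
  case 0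
  show ?case by (cases t') auto
next
  case (Suc t)
  then show ?case by (cases t') auto
qed

lemma pairwise_parallelI:
  assumes "\<And>\<sigma> w. \<sigma> \<in> D \<Longrightarrow> \<sigma> @ w \<in> D \<Longrightarrow> w = []"
  shows "pairwise (\<parallel>) D"
  unfolding pairwise_def parallel_def prefix_def
proof (intro ballI impI)
  fix \<sigma> \<tau> assume *: "\<sigma> \<in> D" "\<tau> \<in> D" "\<sigma> \<noteq> \<tau>"
  then have False if "\<tau> = \<sigma> @ w \<or> \<sigma> = \<tau> @ w" for w
    using assms[of \<sigma> w] assms[of \<tau> w] that by auto
  then show "\<not> (\<exists>w. \<tau> = \<sigma> @ w) \<and> \<not> (\<exists>w. \<sigma> = \<tau> @ w)" by blast
qed

definition unary_head :: "nat \<Rightarrow> nat \<Rightarrow> bool" where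
  "unary_head t i \<longleftrightarrow> t < code_length i \<and> (\<forall>k<t. \<not> code_bit i k) \<and> code_bit i t"

lemma unary_head_iff:
  "unary_head t (string_code \<sigma>) \<longleftrightarrow> (\<exists>\<tau>. \<sigma> = replicate t False @ True # \<tau>)"
proof
  assume *: "unary_head t (string_code \<sigma>)"
  then have t: "t < length \<sigma>" by (simp add: unary_head_def)
  with * have "\<forall>k<t. \<not> \<sigma> ! k" "\<sigma> ! t"
    using code_bit_string_code[of _ \<sigma>] by (auto simp: unary_head_def)
  then have "take t \<sigma> = replicate t False" "drop t \<sigma> = True # drop (Suc t) \<sigma>"
    using t by (auto intro: nth_equalityI simp: Cons_nth_drop_Suc[symmetric])
  then show "\<exists>\<tau>. \<sigma> = replicate t False @ True # \<tau>" by (metis append_take_drop_id)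
next
  assume "\<exists>\<tau>. \<sigma> = replicate t False @ True # \<tau>"
  then obtain \<tau> where \<sigma>: "\<sigma> = replicate t False @ True # \<tau>" by blast
  then have "\<sigma> ! k \<longleftrightarrow> k = t" if "k \<le> t" for k using that by (auto simp: nth_append)
  then show "unary_head t (string_code \<sigma>)"
    using code_bit_string_code[of _ \<sigma>] \<sigma> by (auto simp: unary_head_def)
qed

lemma decidable_unary_head [computable_intros]:
  assumes "total_computable k f" "total_computable k g"
  shows "decidable k (\<lambda>xs. unary_head (f xs) (g xs))"
proof (rule total_computable_compose2[OF _ assms])
  show "decidable 2 (\<lambda>xs. unary_head (xs ! 0) (xs ! 1))"
    unfolding unary_head_def by (intro computable_intros) simp_all
qed

text \<open>A description of an \<open>(n + 1)\<close>-bit string: the number \<open>n\<close> is written with \<open>q t\<close> bits,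
  preceded by \<open>t\<close> in unary.\<close>

definition block_code :: "nat \<Rightarrow> nat \<Rightarrow> nat \<Rightarrow> nat \<Rightarrow> bool" where
  "block_code q t n i \<longleftrightarrow> unary_head t i \<and> code_length i = Suc t + q * t + Suc n \<and>
     code_segment i (Suc t) (q * t) = n"

lemma block_code_iff:
  "block_code q t n (string_code \<sigma>) \<longleftrightarrow> (\<exists>v z. \<sigma> = replicate t False @ True # v @ z \<and>
     length v = q * t \<and> bits_value v = n \<and> length z = Suc n)"
proof
  assume *: "block_code q t n (string_code \<sigma>)"
  then obtain \<tau> where \<sigma>: "\<sigma> = replicate t False @ True # \<tau>"
    unfolding block_code_def unary_head_iff by blast
  with * have "length \<tau> = q * t + Suc n" by (simp add: block_code_def)
  moreover from this * \<sigma> have "bits_value (take (q * t) \<tau>) = n"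
    by (simp add: block_code_def code_segment_string_code)
  ultimately show "\<exists>v z. \<sigma> = replicate t False @ True # v @ z \<and>
     length v = q * t \<and> bits_value v = n \<and> length z = Suc n"
    using \<sigma> by (intro exI[of _ "take (q * t) \<tau>"] exI[of _ "drop (q * t) \<tau>"]) simp
next
  assume "\<exists>v z. \<sigma> = replicate t False @ True # v @ z \<and>
     length v = q * t \<and> bits_value v = n \<and> length z = Suc n"
  then show "block_code q t n (string_code \<sigma>)"
    unfolding block_code_def unary_head_iff by (auto simp: code_segment_string_code)
qed

text \<open>Read from the left, the first \<open>True\<close> fixes \<open>t\<close>, the next
  \<open>q * t\<close> bits fix \<open>n\<close>, and \<open>n\<close> fixes the length of the rest.
  So no description properly extends another.\<close>

lemma block_code_unique:
  assumes "block_code q t n (string_code \<sigma>)" "block_code q t' n' (string_code (\<sigma> @ w))"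
  shows "t = t' \<and> n = n' \<and> w = []"
proof -
  obtain v z where 1: "\<sigma> = replicate t False @ True # v @ z" "length v = q * t" "bits_value v = n" "length z = Suc n"
    using assms(1) unfolding block_code_iff by blast
  obtain v' z' where 2: "\<sigma> @ w = replicate t' False @ True # v' @ z'" "length v' = q * t'" "bits_value v' = n'"
    "length z' = Suc n'"
    using assms(2) unfolding block_code_iff by blast
  have "replicate t False @ True # (v @ z @ w) = replicate t' False @ True # (v' @ z')"
    using 1(1) 2(1) by simp
  then have "t = t'" "v @ z @ w = v' @ z'" unfolding replicate_False_True_eq_iff by auto
  with 1 2 show ?thesis by auto
qed

lemma ex_linear_le_exponential: "\<exists>l0. \<forall>l\<ge>l0. A * Suc l + c \<le> (2::nat) ^ l"
proof -
  define B where "B = 2 * real (A + c)"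
  have "(\<lambda>l. B * (real (Suc l) * (1 / 2) ^ Suc l)) \<longlonglongrightarrow> B * 0"
    using LIMSEQ_Suc[OF powser_times_n_limit_0[of "1 / 2 :: real"]] by (intro tendsto_mult tendsto_const) simp
  then have "\<forall>\<^sub>F l in sequentially. B * (real (Suc l) * (1 / 2) ^ Suc l) < 1"
    by (rule order_tendstoD(2)) simp
  then obtain l0 where l0: "\<And>l. l \<ge> l0 \<Longrightarrow> B * (real (Suc l) * (1 / 2) ^ Suc l) < 1"
    unfolding eventually_sequentially by blast
  have "A * Suc l + c \<le> 2 ^ l" if "l \<ge> l0" for l
  proof -
    have "real ((A + c) * Suc l) \<le> real (2 ^ l)"
      using l0[OF that] by (simp add: B_def power_one_over field_simps)
    then have "(A + c) * Suc l \<le> 2 ^ l" by (simp only: of_nat_le_iff)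
    then show ?thesis by (simp add: algebra_simps)
  qed
  then show ?thesis by blast
qed

lemma code_length_bounds: "2 ^ code_length n \<le> Suc n" "Suc n < 2 ^ Suc (code_length n)"
  using string_code_bounds[of "string_of n"] by (simp_all add: code_length_eq)

lemma ex_code_length_le: "\<exists>N. \<forall>n\<ge>N. A * Suc (code_length n) + c \<le> n"
proof -
  obtain l0 where l0: "\<And>l. l \<ge> l0 \<Longrightarrow> A * Suc l + Suc c \<le> (2::nat) ^ l"
    using ex_linear_le_exponential by blast
  have "A * Suc (code_length n) + c \<le> n" if "n \<ge> A * Suc l0 + c" for n
  proof (cases "code_length n \<ge> l0")
    case True
    then show ?thesis using l0 code_length_bounds(1)[of n] by fastforce
  next
    case False
    then have "A * Suc (code_length n) \<le> A * Suc l0" by (intro mult_le_mono2) simp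
    with that show ?thesis by linarith
  qed
  then show ?thesis by blast
qed

context universal_staged_machine
begin

text \<open>The search is for a stage beyond \<open>j / 2 ^ n - 1 / 4 ^ n\<close>, not beyond \<open>j / 2 ^ n\<close>, so that it
  ends also when the halting probability is \<open>j / 2 ^ n\<close>.\<close>

lemma dyadic_gap:
  "\<exists>c. \<forall>n t j. n < 2 ^ (q * t) \<longrightarrow> Suc q * t + c \<le> n \<longrightarrow> real j / 2 ^ n \<le> halting_probability U \<longrightarrow>
     real j / 2 ^ n + (1 / 2) ^ (n + Suc q * t + c) \<le> halting_probability U"
proof -
  let ?\<Omega> = "halting_probability U"
  define j where "j t n i = code_segment i (Suc t + q * t) (Suc n)" for t n i
  \<comment> \<open>The bounds on \<open>t\<close> and \<open>n\<close> make the quantifiers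
    decidable; they hold because a description is longer than both. The inequality is
    \<open>j / 2 ^ n - 1 / 4 ^ n \<le> approx s\<close> with the denominators cleared.\<close>
  define R where "R s i \<longleftrightarrow> (\<exists>t<i. \<exists>n<i. block_code q t n i \<and>
     j t n i * 2 ^ n * 2 ^ s \<le> scaled_approx s * 4 ^ n + 2 ^ s)" for s i
  have R_iff: "R s (string_code \<sigma>) \<longleftrightarrow> (\<exists>t n. block_code q t n (string_code \<sigma>) \<and>
      real (j t n (string_code \<sigma>)) / 2 ^ n - 1 / 4 ^ n \<le> approx s)" for s \<sigma>
  proof -
    have "t < string_code \<sigma> \<and> n < string_code \<sigma>" if "block_code q t n (string_code \<sigma>)" for t n
      using that length_le_string_code[of \<sigma>] by (simp add: block_code_def)
    moreover have "j * 2 ^ n * 2 ^ s \<le> scaled_approx s * 4 ^ n + 2 ^ s \<longleftrightarrow>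
        real j / 2 ^ n - 1 / 4 ^ n \<le> approx s" for j n
    proof -
      have "j * 2 ^ n * 2 ^ s \<le> scaled_approx s * 4 ^ n + 2 ^ s \<longleftrightarrow>
          real (j * 2 ^ n * 2 ^ s) \<le> real (scaled_approx s * 4 ^ n + 2 ^ s)"
        by (simp only: of_nat_le_iff)
      also have "\<dots> \<longleftrightarrow> real j / 2 ^ n - 1 / 4 ^ n \<le> approx s"
      proof -
        have "(4::real) ^ n = 2 ^ n * 2 ^ n" by (simp flip: power_mult_distrib)
        then show ?thesis by (simp add: approx_def field_simps)
      qed
      finally show ?thesis .
    qed
    ultimately show ?thesis unfolding R_def by blast
  qed
  have "decidable 2 (\<lambda>xs. R (xs ! 0) (xs ! 1))"
    unfolding R_def j_def block_code_def by (intro computable_intros) simp_all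
  moreover have "pairwise (\<parallel>) {\<sigma>. \<exists>s. R s (string_code \<sigma>)}"
    by (rule pairwise_parallelI) (use block_code_unique in \<open>auto simp: R_iff\<close>)
  ultimately obtain c0 where c0: "\<And>\<sigma> t. R t (string_code \<sigma>) \<Longrightarrow>
      \<exists>t0. R t0 (string_code \<sigma>) \<and> approx t0 + (1 / 2) ^ (c0 + length \<sigma>) \<le> ?\<Omega>"
    using halting_probability_gap by blast
  have "real k / 2 ^ n + (1 / 2) ^ (n + Suc q * t + (c0 + 3)) \<le> ?\<Omega>"
    if n: "n < 2 ^ (q * t)" "Suc q * t + (c0 + 3) \<le> n" and k: "real k / 2 ^ n \<le> ?\<Omega>" for n t k
  proof -
    \<comment> \<open>The case \<open>k = 2 ^ n\<close> is still possible, since halting probability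
      1 is excluded only by means of this lemma. This is why \<open>k\<close> gets
      \<open>n + 1\<close> bits.\<close>
    have "real k / 2 ^ n \<le> 1" using k halting_probability_bounds(2) by linarith
    then have "real k \<le> real (2 ^ n)" by simp
    then have "k \<le> 2 ^ n" by (simp only: of_nat_le_iff)
    then have k2: "k < 2 ^ Suc n" by (rule le_less_trans) simp
    define \<sigma> where "\<sigma> = replicate t False @ True # to_bits (q * t) n @ to_bits (Suc n) k"
    have bc: "block_code q t n (string_code \<sigma>)"
      unfolding block_code_iff \<sigma>_def
      by (intro exI[of _ "to_bits (q * t) n"] exI[of _ "to_bits (Suc n) k"])
        (use n(1) in \<open>simp add: bits_value_to_bits del: to_bits.simps\<close>)
    have jk: "j t n (string_code \<sigma>) = k"
      unfolding j_def using k2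
      by (subst code_segment_string_code) (simp_all add: \<sigma>_def bits_value_to_bits del: to_bits.simps)
    have "real k / 2 ^ n - 1 / 4 ^ n < ?\<Omega>" using k by (simp add: less_le_trans[of _ "real k / 2 ^ n"])
    then obtain s where "real k / 2 ^ n - 1 / 4 ^ n \<le> approx s" using ex_approx less_imp_le by blast
    then have "R s (string_code \<sigma>)" unfolding R_iff using bc jk by blast
    then obtain t0 where t0: "R t0 (string_code \<sigma>)" "approx t0 + (1 / 2) ^ (c0 + length \<sigma>) \<le> ?\<Omega>"
      using c0 by blast
    have "block_code q t' n' (string_code \<sigma>) \<Longrightarrow> t' = t \<and> n' = n" for t' n'
      using block_code_unique[OF bc, of t' n' "[]"] by simp
    with t0(1) jk have "real k / 2 ^ n - 1 / 4 ^ n \<le> approx t0" unfolding R_iff by blast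
    with t0(2) have *: "real k / 2 ^ n - 1 / 4 ^ n + (1 / 2) ^ (c0 + length \<sigma>) \<le> ?\<Omega>" by linarith
    \<comment> \<open>\<open>\<sigma>\<close> has length \<open>n + Suc q * t + 2\<close>, so its
      weight in the gap is twice \<open>(1 / 2) ^ ?e\<close>. One half pays for the
      \<open>1 / 4 ^ n\<close> given away in the search condition.\<close>
    let ?e = "n + Suc q * t + (c0 + 3)"
    have "1 / (4::real) ^ n = (1 / 2) ^ (2 * n)" by (simp add: power_mult power_one_over)
    also have "\<dots> \<le> (1 / 2) ^ ?e" using n(2) by (intro power_decreasing) auto
    finally have "1 / (4::real) ^ n \<le> (1 / 2) ^ ?e" .
    moreover have "(1 / 2 :: real) ^ (c0 + length \<sigma>) = 2 * (1 / 2) ^ ?e"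
    proof -
      have "?e = Suc (c0 + length \<sigma>)" by (simp add: \<sigma>_def)
      then show ?thesis by (simp only: power_Suc)
    qed
    ultimately show ?thesis using * by linarith
  qed
  then show ?thesis by blast
qed

text \<open>Written over a large enough power of 2, the fraction falls under
  \<open>dyadic_gap\<close> with \<open>q = 1\<close>; at equality the number would lie strictly to
  the right of itself.\<close>

lemma halting_probability_not_dyadic: "halting_probability U \<noteq> real j / 2 ^ n"
proof
  assume *: "halting_probability U = real j / 2 ^ n"
  obtain c where c: "\<And>n t j. n < 2 ^ t \<Longrightarrow> 2 * t + c \<le> n \<Longrightarrow> real j / 2 ^ n \<le> halting_probability U \<Longrightarrow>
     real j / 2 ^ n + (1 / 2) ^ (n + 2 * t + c) \<le> halting_probability U"
    using dyadic_gap[of 1] by (auto simp: numeral_2_eq_2)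
  obtain N where N: "\<And>n. n \<ge> N \<Longrightarrow> 2 * Suc (code_length n) + c \<le> n"
    using ex_code_length_le by blast
  define n' where "n' = n + N"
  have eq: "halting_probability U = real (j * 2 ^ N) / 2 ^ n'"
    unfolding * n'_def by (simp add: power_add)
  have "n' < 2 ^ Suc (code_length n')" using code_length_bounds(2)[of n'] by linarith
  from c[OF this N, of "j * 2 ^ N"] eq
  have "halting_probability U + (1 / 2) ^ (n' + 2 * Suc (code_length n') + c) \<le> halting_probability U"
    unfolding n'_def by simp
  moreover have "(0::real) < (1 / 2) ^ (n' + 2 * Suc (code_length n') + c)" by simp
  ultimately show False by linarith
qed

end

section \<open>Redundancy larger than the logarithm suffices\<close>

text \<open>Any finite table can be built into a program. It takes care of the small
  \<open>n\<close>, where the logarithm does not yet dominate the additive constants.\<close>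

lemma total_computable_finite_modification:
  assumes "total_computable k f" "total_computable k n"
  shows "total_computable k (\<lambda>xs. if n xs < N then T (n xs) else f xs)"
proof (induction N)
  case 0
  then show ?case using assms(1) by simp
next
  case (Suc N)
  have "total_computable k (\<lambda>xs. if n xs = N then T N else if n xs < N then T (n xs) else f xs)"
    by (intro computable_intros assms Suc)
  then show ?case by (rule total_computable_cong) (auto simp: less_Suc_eq)
qed

lemma halts_within_totalI:
  assumes "\<And>A xs. length xs = k \<Longrightarrow> eval A p xs (f xs) {}" "length xs = k"
  shows "halts_within A D p xs (f xs)"
  using halts_within_total[of k p f, OF assms] by blast

lemma halts_within_Comp1:
  "halts_within A D g xs y \<Longrightarrow> halts_within A D f [y] z \<Longrightarrow> halts_within A D (Comp f [g]) xs z"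
  unfolding halts_within_Comp by (intro exI[of _ "[y]"]) simp

lemma halts_within_Comp2:
  "halts_within A D g xs y \<Longrightarrow> halts_within A D g' xs y' \<Longrightarrow> halts_within A D f [y, y'] z \<Longrightarrow>
    halts_within A D (Comp f [g, g']) xs z"
  unfolding halts_within_Comp by (intro exI[of _ "[y, y']"]) (simp add: less_Suc_eq)

lemma floor_power2_Suc:
  assumes "0 \<le> x"
  shows "nat \<lfloor>2 ^ Suc m * x\<rfloor> = 2 * nat \<lfloor>2 ^ m * x\<rfloor> + of_bool (binary_digit x (Suc m))"
proof -
  have "\<lfloor>2 ^ m * x\<rfloor> = \<lfloor>2 ^ Suc m * x / of_int 2\<rfloor>" by simp
  also have "\<dots> = \<lfloor>2 ^ Suc m * x\<rfloor> div 2" by (rule floor_divide_real_eq_div) simp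
  finally have "\<lfloor>2 ^ Suc m * x\<rfloor> = 2 * \<lfloor>2 ^ m * x\<rfloor> + of_bool (binary_digit x (Suc m))"
    unfolding binary_digit_def using mult_div_mod_eq[of 2 "\<lfloor>2 ^ Suc m * x\<rfloor>"]
    by (cases "even \<lfloor>2 ^ Suc m * x\<rfloor>") (simp_all add: odd_iff_mod_2_eq_one del: power_Suc mult_div_mod_eq)
  moreover have "0 \<le> \<lfloor>2 ^ m * x\<rfloor>" using assms by simp
  ultimately show ?thesis by (simp add: nat_add_distrib nat_mult_distrib)
qed

text \<open>Horner's scheme on the bits; the successor in front of the query makes the positions
  start at 1. In the induction the allowed set \<open>{1..M}\<close> stays fixed while
  \<open>m\<close> grows up to \<open>M\<close>.\<close>

lemma ex_oracle_reader:
  "\<exists>p. \<forall>x m. 0 \<le> x \<longrightarrow> x < 1 \<longrightarrow>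
    halts_within (\<lambda>k. of_bool (binary_digit x k)) {1..m} p [m] (nat \<lfloor>2 ^ m * x\<rfloor>)"
proof -
  have "total_computable 2 (\<lambda>xs. 2 * (xs ! 0) + xs ! 1)" by (intro computable_intros) simp_all
  then obtain q where q: "\<And>A xs. length xs = 2 \<Longrightarrow> eval A q xs (2 * (xs ! 0) + xs ! 1) {}"
    unfolding total_computable_def by blast
  let ?g = "Comp q [Proj 1, Comp Oracle [Comp Succ [Proj 0]]]"
  have "halts_within (\<lambda>k. of_bool (binary_digit x k)) {1..M} (Prec Zero ?g) [m] (nat \<lfloor>2 ^ m * x\<rfloor>)"
    if "0 \<le> x" "x < 1" "m \<le> M" for x m M
    using that(3)
  proof (induction m)
    case 0
    show ?case using that by (simp add: halts_within_Prec_0 halts_within_Zero)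
  next
    case (Suc m)
    let ?H = "halts_within (\<lambda>k. of_bool (binary_digit x k)) {1..M}"
    let ?y = "nat \<lfloor>2 ^ m * x\<rfloor>"
    have "?H (Comp Oracle [Comp Succ [Proj 0]]) [m, ?y] (of_bool (binary_digit x (Suc m)))"
      by (intro halts_within_Comp1[where y = "Suc m"] halts_within_Comp1[where y = m])
        (use Suc.prems in \<open>simp_all add: halts_within_Proj halts_within_Succ halts_within_Oracle\<close>)
    then have "?H ?g [m, ?y] (nat \<lfloor>2 ^ Suc m * x\<rfloor>)"
      using halts_within_totalI[of 2 q _ "[?y, of_bool (binary_digit x (Suc m))]", OF q]
      by (intro halts_within_Comp2[where y = ?y and y' = "of_bool (binary_digit x (Suc m))"])
        (simp_all add: halts_within_Proj floor_power2_Suc[OF that(1)] del: power_Suc)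
    with Suc show ?case unfolding halts_within_Prec_Suc by auto
  qed
  then show ?thesis by blast
qed

context universal_staged_machine
begin

text \<open>If \<open>U (\<rho> @ \<tau>) = V \<tau>\<close> for all \<open>\<tau>\<close>, then this approximates the halting probability of \<open>V\<close>
  along the stages of \<open>U\<close>.\<close>

definition suffix_approx :: "bool list \<Rightarrow> nat \<Rightarrow> real" where
  "suffix_approx \<rho> s = (\<Sum>\<tau> | \<rho> @ \<tau> \<in> halted s. (1 / 2) ^ length \<tau>)"

definition scaled_suffix_approx :: "bool list \<Rightarrow> nat \<Rightarrow> nat" where
  "scaled_suffix_approx \<rho> s = (\<Sum>i<s. of_bool (string_code \<rho> + 2 ^ length \<rho> * i < s \<and>
     F s (string_code \<rho> + 2 ^ length \<rho> * i) \<noteq> 0) * 2 ^ (s - code_length i))"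

lemma total_computable_scaled_suffix_approx:
  "total_computable k f \<Longrightarrow> total_computable k (\<lambda>xs. scaled_suffix_approx \<rho> (f xs))"
proof (erule total_computable_compose1[rotated])
  show "total_computable 1 (\<lambda>xs. scaled_suffix_approx \<rho> (xs ! 0))"
    unfolding scaled_suffix_approx_def by (intro computable_intros) simp_all
qed

lemma finite_suffix_halted: "finite {\<tau>. \<rho> @ \<tau> \<in> halted s}"
  using finite_vimageI[OF finite_halted, of "(@) \<rho>"] by (simp add: vimage_def inj_def)

lemma suffix_approx_eq: "suffix_approx \<rho> s = real (scaled_suffix_approx \<rho> s) / 2 ^ s"
proof -
  let ?P = "\<lambda>i. string_code \<rho> + 2 ^ length \<rho> * i < s \<and> F s (string_code \<rho> + 2 ^ length \<rho> * i) \<noteq> 0"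
  have P: "i < s" if "?P i" for i
  proof -
    have "i \<le> 2 ^ length \<rho> * i" by simp
    then show ?thesis using that by linarith
  qed
  have "real (scaled_suffix_approx \<rho> s) = (\<Sum>i<s. of_bool (?P i) * 2 ^ (s - code_length i))"
    by (simp add: scaled_suffix_approx_def)
  also have "\<dots> = (\<Sum>i | ?P i. 2 ^ (s - code_length i))"
    by (rule sum.mono_neutral_cong_right) (use P in auto)
  also have "\<dots> = (\<Sum>\<tau> | \<rho> @ \<tau> \<in> halted s. 2 ^ (s - length \<tau>))"
    by (rule sum.reindex_bij_witness[of _ string_code string_of])
      (auto simp: halted_def code_length_eq string_code_append)
  also have "\<dots> = (\<Sum>\<tau> | \<rho> @ \<tau> \<in> halted s. 2 ^ s * (1 / 2) ^ length \<tau>)"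
  proof (intro sum.cong refl)
    fix \<tau> assume "\<tau> \<in> {\<tau>. \<rho> @ \<tau> \<in> halted s}"
    then have "length \<tau> \<le> s" using length_le_string_code[of "\<rho> @ \<tau>"] by (auto simp: halted_def)
    then show "2 ^ (s - length \<tau>) = (2 ^ s * (1 / 2) ^ length \<tau> :: real)"
      by (rule two_power_diff)
  qed
  finally show ?thesis by (simp add: suffix_approx_def flip: sum_distrib_left)
qed

text \<open>A string in the domain of \<open>V\<close> not yet counted gives, with
  \<open>\<rho>\<close> in front, a string that enters the domain of \<open>U\<close> after stage
  \<open>s\<close>. Its weight, smaller by the factor \<open>2 ^ length \<rho>\<close>, is part of
  what \<open>approx s\<close> lacks.\<close>

lemma suffix_approx_bounds:
  assumes V: "staged_machine V G" and \<rho>: "\<And>\<tau>. U (\<rho> @ \<tau>) = V \<tau>"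
  shows "suffix_approx \<rho> s \<le> halting_probability V"
    and "halting_probability V \<le> suffix_approx \<rho> s + 2 ^ length \<rho> * (halting_probability U - approx s)"
proof -
  interpret V: staged_machine V G by (rule V)
  let ?w = "\<lambda>\<sigma>. (1 / 2 :: real) ^ length \<sigma>"
  let ?B = "{\<tau>. \<rho> @ \<tau> \<in> halted s}"
  have dom: "\<rho> @ \<tau> \<in> dom U \<longleftrightarrow> \<tau> \<in> dom V" for \<tau>
    by (simp add: domIff \<rho>)
  have "?B \<subseteq> dom V" using halted_subset_dom dom by blast
  then show "suffix_approx \<rho> s \<le> halting_probability V"
    unfolding suffix_approx_def by (intro V.sum_le_halting_probability finite_suffix_halted)
  show "halting_probability V \<le> suffix_approx \<rho> s + 2 ^ length \<rho> * (halting_probability U - approx s)"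
  proof (rule ccontr)
    assume "\<not> ?thesis"
    then obtain t where t: "suffix_approx \<rho> s + 2 ^ length \<rho> * (halting_probability U - approx s) < V.approx t"
      using V.ex_approx by (metis not_le)
    let ?C = "V.halted t - ?B"
    have "(\<Sum>\<sigma>\<in>halted s \<union> (@) \<rho> ` ?C. ?w \<sigma>) \<le> halting_probability U"
    proof (rule sum_le_halting_probability)
      show "halted s \<union> (@) \<rho> ` ?C \<subseteq> dom U"
        using halted_subset_dom V.halted_subset_dom dom by blast
    qed simp
    also have "(\<Sum>\<sigma>\<in>halted s \<union> (@) \<rho> ` ?C. ?w \<sigma>) = approx s + (\<Sum>\<sigma>\<in>(@) \<rho> ` ?C. ?w \<sigma>)"
      unfolding approx_eq by (intro sum.union_disjoint) auto
    also have "(\<Sum>\<sigma>\<in>(@) \<rho> ` ?C. ?w \<sigma>) = ?w \<rho> * (\<Sum>\<tau>\<in>?C. ?w \<tau>)"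
      by (subst sum.reindex) (auto simp: inj_on_def power_add sum_distrib_left)
    finally have "(\<Sum>\<tau>\<in>?C. ?w \<tau>) \<le> 2 ^ length \<rho> * (halting_probability U - approx s)"
      by (simp add: power_one_over field_simps)
    moreover have "V.approx t \<le> suffix_approx \<rho> s + (\<Sum>\<tau>\<in>?C. ?w \<tau>)"
    proof -
      have "V.approx t \<le> (\<Sum>\<tau>\<in>?B \<union> ?C. ?w \<tau>)"
        unfolding V.approx_eq using finite_suffix_halted by (intro sum_mono2) auto
      also have "\<dots> = suffix_approx \<rho> s + (\<Sum>\<tau>\<in>?C. ?w \<tau>)"
        unfolding suffix_approx_def using finite_suffix_halted by (intro sum.union_disjoint) auto
      finally show ?thesis .
    qed
    ultimately show False using t by linarith
  qed
qed

end

text \<open>With \<open>t = Suc (code_length n div q)\<close> the number \<open>n\<close> fits into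
  \<open>q * t\<close> bits. \<open>K\<close> collects the terms that do not grow, and the slack
  \<open>\<delta> * log 2 n\<close> exceeds it from \<open>2 powr (K / \<delta>)\<close> on. The
  first conjunct is the side condition of \<open>dyadic_gap\<close>.\<close>

lemma redundancy_bound:
  fixes \<epsilon> :: real and C c :: nat
  assumes "1 + 1 / real q < \<epsilon>" "q > 0"
  shows "\<exists>N\<ge>1. \<forall>n\<ge>N. Suc q * Suc (code_length n div q) + c \<le> n \<and>
    real (Suc q * Suc (code_length n div q) + C) \<le> \<epsilon> * log 2 (real n)"
proof -
  obtain N1 where N1: "\<And>n. n \<ge> N1 \<Longrightarrow> Suc q * Suc (code_length n) + c \<le> n"
    using ex_code_length_le by blast
  define K where "K = 1 + 1 / real q + real q + 1 + real C"
  define \<delta> where "\<delta> = \<epsilon> - (1 + 1 / real q)"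
  have \<delta>: "\<delta> > 0" using assms by (simp add: \<delta>_def)
  define N where "N = N1 + nat \<lceil>2 powr (K / \<delta>)\<rceil> + 1"
  have "Suc q * Suc (code_length n div q) + c \<le> n \<and>
    real (Suc q * Suc (code_length n div q) + C) \<le> \<epsilon> * log 2 (real n)" if n: "n \<ge> N" for n
  proof
    have "Suc q * Suc (code_length n div q) \<le> Suc q * Suc (code_length n)"
      by (intro mult_le_mono2) simp
    with N1[of n] n show "Suc q * Suc (code_length n div q) + c \<le> n"
      unfolding N_def by linarith
  next
    have n1: "real n \<ge> 1" using n by (simp add: N_def)
    have "real (nat \<lceil>2 powr (K / \<delta>)\<rceil>) \<le> real n" using n by (simp add: N_def)
    then have "2 powr (K / \<delta>) \<le> real n" by linarith
    then have "log 2 (2 powr (K / \<delta>)) \<le> log 2 (real n)" by (subst log_le_cancel_iff) (use n1 in auto)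
    then have K: "K \<le> \<delta> * log 2 (real n)" using \<delta> by (simp add: field_simps)
    have "real (2 ^ code_length n) \<le> real (Suc n)"
      using code_length_bounds(1)[of n] by (simp only: of_nat_le_iff)
    also have "\<dots> \<le> 2 * real n" using n1 by simp
    finally have "log 2 (2 ^ code_length n) \<le> log 2 (2 * real n)"
      by (subst log_le_cancel_iff) (use n1 in auto)
    also have "\<dots> = 1 + log 2 (real n)" using n1 by (simp add: log_mult)
    finally have l: "real (code_length n) \<le> 1 + log 2 (real n)" by (simp add: log_nat_power)
    have "real (code_length n div q) \<le> real (code_length n) / real q"
      by (rule of_nat_div_le_of_nat)
    then have "real (Suc q) * real (Suc (code_length n div q)) \<le> real (Suc q) * (real (code_length n) / real q + 1)"
      by (intro mult_left_mono) auto
    also have "\<dots> = (1 + 1 / real q) * real (code_length n) + real q + 1"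
      using assms(2) by (simp add: field_simps)
    also have "\<dots> \<le> (1 + 1 / real q) * (1 + log 2 (real n)) + real q + 1"
      using l by (intro add_right_mono mult_left_mono) auto
    finally have "real (Suc q * Suc (code_length n div q) + C) \<le> (1 + 1 / real q) * log 2 (real n) + K"
      unfolding K_def of_nat_add of_nat_mult by (simp add: algebra_simps)
    with K show "real (Suc q * Suc (code_length n div q) + C) \<le> \<epsilon> * log 2 (real n)"
      unfolding \<delta>_def by (simp add: algebra_simps)
  qed
  then show ?thesis by (intro exI[of _ N]) (simp add: N_def)
qed

theorem computes_with_redundancy_gt_1:
  assumes "omega_number \<Omega>\<^sub>0" "omega_number \<Omega>\<^sub>1" "\<epsilon> > 1"
  shows "computes_with_redundancy \<Omega>\<^sub>0 \<Omega>\<^sub>1 (h \<epsilon>)"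
proof -
  obtain U F where U: "universal_staged_machine U F" and \<Omega>0: "\<Omega>\<^sub>0 = halting_probability U"
    using omega_number_staged[OF assms(1)] .
  obtain V G where V: "universal_staged_machine V G" and \<Omega>1: "\<Omega>\<^sub>1 = halting_probability V"
    using omega_number_staged[OF assms(2)] .
  interpret U: universal_staged_machine U F by (rule U)
  interpret V: universal_staged_machine V G by (rule V)
  obtain \<rho> where \<rho>: "\<And>\<tau>. U (\<rho> @ \<tau>) = V \<tau>"
    using U.universal V.prefix_free unfolding universal_prefix_free_machine_def by blast
  note V_bounds = U.suffix_approx_bounds[OF V.staged_machine_axioms \<rho>, folded \<Omega>0 \<Omega>1]
  obtain q' where "inverse (real (Suc q')) < \<epsilon> - 1" using reals_Archimedean[of "\<epsilon> - 1"] assms(3) by auto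
  define q where "q = Suc q'"
  have q: "1 + 1 / real q < \<epsilon>" "q > 0" using \<open>inverse _ < _\<close> by (simp_all add: q_def field_simps)
  obtain c where c: "\<And>n t j. n < 2 ^ (q * t) \<Longrightarrow> Suc q * t + c \<le> n \<Longrightarrow> real j / 2 ^ n \<le> \<Omega>\<^sub>1 \<Longrightarrow>
     real j / 2 ^ n + (1 / 2) ^ (n + Suc q * t + c) \<le> \<Omega>\<^sub>1"
    using V.dyadic_gap[of q, folded \<Omega>1] by blast
  define t where "t n = Suc (code_length n div q)" for n
  obtain N where N: "N \<ge> 1" "\<And>n. n \<ge> N \<Longrightarrow> Suc q * t n + c \<le> n"
    "\<And>n. n \<ge> N \<Longrightarrow> real (Suc q * t n + (c + length \<rho>)) \<le> \<epsilon> * log 2 (real n)"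
    using redundancy_bound[OF q, of c "c + length \<rho>"] unfolding t_def by blast
  \<comment> \<open>Small \<open>n\<close> are answered from a table without any query. Otherwise
    \<open>length \<rho>\<close> bits are added to the exponent of the gap, to absorb the factor
    \<open>2 ^ length \<rho>\<close> in the error.\<close>
  define m where "m n = (if n < N then 0 else n + (Suc q * t n + (c + length \<rho>)))" for n
  define stop where "stop s n B \<longleftrightarrow> n < N \<or> B * 2 ^ s \<le> U.scaled_approx s * 2 ^ m n" for s n B
  define out where "out s n = (if n < N then string_code (initial_bits \<Omega>\<^sub>1 n)
    else string_code (to_bits n (U.scaled_suffix_approx \<rho> s * 2 ^ n div 2 ^ s)))" for s n
  have "0 \<le> \<Omega>\<^sub>0" "\<Omega>\<^sub>0 < 1"
    using U.halting_probability_bounds U.halting_probability_not_dyadic[of 1 0] unfolding \<Omega>0 by auto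
  have m_comp: "total_computable k (\<lambda>xs. m (f xs))" if "total_computable k f" for k f
    unfolding m_def t_def by (intro computable_intros that)
  obtain pm where pm: "\<And>A xs. length xs = 1 \<Longrightarrow> eval A pm xs (m (xs ! 0)) {}"
    using m_comp[OF total_computable_nth[of 0 1]] unfolding total_computable_def by auto
  have "decidable 3 (\<lambda>xs. \<not> stop (xs ! 0) (xs ! 1) (xs ! 2))"
    unfolding stop_def by (intro computable_intros m_comp) simp_all
  then obtain ps where ps: "\<And>A xs. length xs = 3 \<Longrightarrow> eval A ps xs (of_bool (\<not> stop (xs ! 0) (xs ! 1) (xs ! 2))) {}"
    unfolding total_computable_def by blast
  have "total_computable 2 (\<lambda>xs. out (xs ! 0) (xs ! 1))"
    unfolding out_def
    by (intro total_computable_finite_modification[where T = "\<lambda>n. string_code (initial_bits \<Omega>\<^sub>1 n)"]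
        computable_intros U.total_computable_scaled_suffix_approx) simp_all
  then obtain po where po: "\<And>A xs. length xs = 2 \<Longrightarrow> eval A po xs (out (xs ! 0) (xs ! 1)) {}"
    unfolding total_computable_def by blast
  obtain pr where pr: "\<And>x m. 0 \<le> x \<Longrightarrow> x < 1 \<Longrightarrow>
      halts_within (\<lambda>k. of_bool (binary_digit x k)) {1..m} pr [m] (nat \<lfloor>2 ^ m * x\<rfloor>)"
    using ex_oracle_reader by blast
  let ?p = "Comp po [Comp (Mu ps) [Proj 0, Comp pr [pm]], Proj 0]"
  have "\<exists>Q. eval (\<lambda>k. of_bool (binary_digit \<Omega>\<^sub>0 k)) ?p [n] (string_code (initial_bits \<Omega>\<^sub>1 n)) Q \<and>
     (\<forall>k\<in>Q. 1 \<le> k \<and> int k \<le> \<lfloor>real n + h \<epsilon> n\<rfloor>)" for n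
  proof -
    let ?H = "halts_within (\<lambda>k. of_bool (binary_digit \<Omega>\<^sub>0 k)) {1..m n}"
    define B where "B = nat \<lfloor>2 ^ m n * \<Omega>\<^sub>0\<rfloor>"
    have "real B = of_int \<lfloor>2 ^ m n * \<Omega>\<^sub>0\<rfloor>" using \<open>0 \<le> \<Omega>\<^sub>0\<close> by (simp add: B_def)
    then have B: "real B \<le> 2 ^ m n * \<Omega>\<^sub>0" "2 ^ m n * \<Omega>\<^sub>0 < real B + 1" by linarith+
    have stop_iff: "stop s n B \<longleftrightarrow> n < N \<or> real B / 2 ^ m n \<le> U.approx s" for s
    proof -
      have "B * 2 ^ s \<le> U.scaled_approx s * 2 ^ m n \<longleftrightarrow> real (B * 2 ^ s) \<le> real (U.scaled_approx s * 2 ^ m n)"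
        by (simp only: of_nat_le_iff)
      then show ?thesis by (simp add: stop_def U.approx_def field_simps)
    qed
    \<comment> \<open>A number that is not dyadic lies strictly above its truncation, so the
      approximations pass the truncation and the search ends.\<close>
    have "\<exists>s. stop s n B"
    proof -
      have "real B / 2 ^ m n \<le> \<Omega>\<^sub>0" using B(1) by (simp add: field_simps)
      then have "real B / 2 ^ m n < \<Omega>\<^sub>0"
        using U.halting_probability_not_dyadic[of B "m n"] unfolding \<Omega>0 by linarith
      then obtain s where "real B / 2 ^ m n < U.approx s" using U.ex_approx unfolding \<Omega>0 by blast
      then show ?thesis unfolding stop_iff by (intro exI[of _ s]) simp
    qed
    define s where "s = (LEAST s. stop s n B)"
    have s: "stop s n B" "\<And>s'. s' < s \<Longrightarrow> \<not> stop s' n B"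
      unfolding s_def using \<open>\<exists>s. stop s n B\<close> by (rule LeastI_ex) (rule not_less_Least)
    have out: "out s n = string_code (initial_bits \<Omega>\<^sub>1 n)"
    proof (cases "n < N")
      case False
      let ?a = "U.suffix_approx \<rho> s" and ?e = "n + Suc q * t n + c"
      define J where "J = nat \<lfloor>2 ^ n * \<Omega>\<^sub>1\<rfloor>"
      have pos: "0 \<le> \<Omega>\<^sub>1" using V.halting_probability_bounds unfolding \<Omega>1 by simp
      then have "real J = of_int \<lfloor>2 ^ n * \<Omega>\<^sub>1\<rfloor>" by (simp add: J_def)
      then have J: "real J \<le> 2 ^ n * \<Omega>\<^sub>1" "2 ^ n * \<Omega>\<^sub>1 < real J + 1" by linarith+
      have m: "m n = ?e + length \<rho>" using False by (simp add: m_def)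
      have "code_length n < q * t n"
        using q(2) dividend_less_times_div[of q "code_length n"] by (simp add: t_def algebra_simps)
      then have "(2::nat) ^ Suc (code_length n) \<le> 2 ^ (q * t n)" by (intro power_increasing) auto
      then have "n < 2 ^ (q * t n)" using code_length_bounds(2)[of n] by linarith
      from c[OF this N(2), of J] False J(1)
      have gap: "real J / 2 ^ n + (1 / 2) ^ ?e \<le> \<Omega>\<^sub>1" by (simp add: field_simps)
      have "\<Omega>\<^sub>0 - U.approx s < (1 / 2) ^ m n"
      proof -
        have "\<Omega>\<^sub>0 < real B / 2 ^ m n + (1 / 2) ^ m n"
          using B(2) by (simp add: power_one_over field_simps)
        then show ?thesis using s(1) False unfolding stop_iff by linarith
      qed
      then have "2 ^ length \<rho> * (\<Omega>\<^sub>0 - U.approx s) < 2 ^ length \<rho> * (1 / 2) ^ m n" by simp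
      also have "\<dots> = (1 / 2) ^ ?e" unfolding m by (simp add: power_add power_one_over field_simps)
      \<comment> \<open>The error of \<open>?a\<close> is smaller than the gap, so \<open>?a\<close>
        cannot fall below the multiple of 2^-n to the left of
        \<open>\<Omega>\<^sub>1\<close>.\<close>
      finally have "real J / 2 ^ n < ?a" using V_bounds(2)[of s] gap by linarith
      then have "real J \<le> 2 ^ n * ?a" by (simp add: field_simps)
      moreover have "2 ^ n * ?a < real J + 1"
      proof -
        have "2 ^ n * ?a \<le> 2 ^ n * \<Omega>\<^sub>1" using V_bounds(1)[of s] by simp
        with J(2) show ?thesis by linarith
      qed
      ultimately have "\<lfloor>2 ^ n * ?a\<rfloor> = int J" by (intro floor_unique) simp_all
      moreover have "2 ^ n * ?a = real (U.scaled_suffix_approx \<rho> s * 2 ^ n) / real (2 ^ s)"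
        by (simp add: U.suffix_approx_eq)
      ultimately have "U.scaled_suffix_approx \<rho> s * 2 ^ n div 2 ^ s = J"
        by (simp only: floor_divide_of_nat_eq of_nat_eq_iff)
      then show ?thesis using False pos by (simp add: out_def initial_bits_eq_to_bits J_def)
    qed (simp add: out_def)
    have "?H pm [n] (m n)"
      using halts_within_totalI[of 1 pm _ "[n]", OF pm] by simp
    then have "?H (Comp pr [pm]) [n] B"
      unfolding B_def by (rule halts_within_Comp1) (intro pr \<open>0 \<le> \<Omega>\<^sub>0\<close> \<open>\<Omega>\<^sub>0 < 1\<close>)
    moreover have "?H ps [s', n, B] (of_bool (\<not> stop s' n B))" for s'
      using halts_within_totalI[of 3 ps _ "[s', n, B]", OF ps] by (simp add: numeral_2_eq_2)
    with s have "?H (Mu ps) [n, B] s"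
      unfolding halts_within_Mu by (metis (full_types) One_nat_def of_bool_eq)
    moreover have "?H po [s, n] (out s n)"
      using halts_within_totalI[of 2 po _ "[s, n]", OF po] by simp
    moreover have "?H (Proj 0) [n] n" by (simp add: halts_within_Proj)
    ultimately have "?H ?p [n] (out s n)" by (meson halts_within_Comp2)
    then obtain Q where Q: "eval (\<lambda>k. of_bool (binary_digit \<Omega>\<^sub>0 k)) ?p [n] (out s n) Q" "Q \<subseteq> {1..m n}"
      unfolding halts_within_def by blast
    have "1 \<le> k \<and> int k \<le> \<lfloor>real n + h \<epsilon> n\<rfloor>" if "k \<in> Q" for k
    proof -
      have k: "1 \<le> k" "k \<le> m n" using that Q(2) by auto
      then have n: "N \<le> n" unfolding m_def by (metis le_zero_eq not_less not_one_le_zero)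
      then have "real (m n) \<le> real n + \<epsilon> * log 2 (real n)"
        using N(3)[OF n] unfolding m_def by simp
      moreover have "h \<epsilon> n = \<epsilon> * log 2 (real n)" using n N(1) by (simp add: h_def)
      moreover have "real k \<le> real (m n)" using k(2) by simp
      ultimately have "of_int (int k) \<le> real n + h \<epsilon> n" by simp
      then show ?thesis using k(1) by (simp only: le_floor_iff)
    qed
    with Q(1) out show ?thesis by auto
  qed
  then show ?thesis unfolding computes_with_redundancy_def by blast
qed

section \<open>Halting probabilities pass computable statistical tests\<close>

lemma total_computable_Least [computable_intros]:
  assumes R: "decidable (Suc k) (\<lambda>ys. R (ys ! 0) (tl ys))" and ex: "\<And>xs. length xs = k \<Longrightarrow> \<exists>t. R t xs"
  shows "total_computable k (\<lambda>xs. LEAST t. R t xs)"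
proof -
  obtain p where p: "\<And>A ys. length ys = Suc k \<Longrightarrow> eval A p ys (of_bool (\<not> R (ys ! 0) (tl ys))) {}"
    using decidable_not[OF R] unfolding total_computable_def by blast
  have "eval A (Mu p) xs (LEAST t. R t xs) {}" if "length xs = k" for A xs
  proof -
    let ?y = "LEAST t. R t xs"
    have "eval A (Mu p) xs ?y ({} \<union> (\<Union>i<?y. {}))"
    proof (rule eval_Mu[where z = "\<lambda>_. 0"])
      show "eval A p (?y # xs) 0 {}"
        using p[of "?y # xs" A] LeastI_ex[OF ex[OF that]] that by simp
      show "eval A p (i # xs) (Suc 0) {}" if "i < ?y" for i
        using p[of "i # xs" A] not_less_Least[OF that] \<open>length xs = k\<close> by simp
    qed
    then show ?thesis by simp
  qed
  then show ?thesis unfolding total_computable_def by blast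
qed

text \<open>A Martin-Loef test: level \<open>d\<close> accepts at most a fraction 4^-d of the
  prefixes of length \<open>M d\<close>. An accepted prefix is described by \<open>d\<close> in
  unary and its rank among the accepted ones, with \<open>M d - d + 1\<close> bits in all. The bound
  4^-d leaves a saving of about \<open>d\<close> bits after the unary \<open>d\<close> is paid for,
  and for large \<open>d\<close> the resulting gap is longer than the interval of the
  prefix.\<close>

lemma (in universal_staged_machine) ex_outside_test:
  fixes M :: "nat \<Rightarrow> nat" and ok :: "nat \<Rightarrow> nat \<Rightarrow> nat \<Rightarrow> bool"
  assumes M: "total_computable 1 (\<lambda>xs. M (xs ! 0))"
    and ok: "decidable 3 (\<lambda>xs. ok (xs ! 0) (xs ! 1) (xs ! 2))"
    and M_ge: "\<And>d. 2 * d \<le> M d"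
    and card_le: "\<And>d. card {x. x < 2 ^ M d \<and> (\<exists>s. ok d s x)} \<le> 2 ^ (M d - 2 * d)"
  shows "\<exists>d. \<forall>s. \<not> ok d s (nat \<lfloor>2 ^ M d * halting_probability U\<rfloor>)"
proof (rule ccontr)
  assume contr: "\<not> ?thesis"
  let ?\<Omega> = "halting_probability U"
  text \<open>The number \<open>u\<close> stands for stage \<open>u div 2 ^ M d\<close> and element \<open>u mod 2 ^ M d\<close>.\<close>
  define new where "new d u \<longleftrightarrow> ok d (u div 2 ^ M d) (u mod 2 ^ M d) \<and>
    (\<forall>u'<u. u' mod 2 ^ M d = u mod 2 ^ M d \<longrightarrow> \<not> ok d (u' div 2 ^ M d) (u' mod 2 ^ M d))" for d u
  \<comment> \<open>\<open>new\<close> marks the first acceptance of an element, so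
    \<open>rank\<close> numbers the accepted elements without repetition.\<close>
  define rank where "rank d u = (\<Sum>u'<u. of_bool (new d u') :: nat)" for d u
  define R where "R t i \<longleftrightarrow> (\<exists>d<i. unary_head d i \<and> code_length i = Suc d + (M d - 2 * d) \<and>
     (\<exists>u<t. new d u \<and> rank d u = code_segment i (Suc d) (M d - 2 * d) \<and>
        (u mod 2 ^ M d) * 2 ^ t \<le> scaled_approx t * 2 ^ M d))" for t i
  have M': "total_computable k (\<lambda>xs. M (f xs))" if "total_computable k f" for k f
    using total_computable_compose1[OF M that] .
  have ok': "decidable k (\<lambda>xs. ok (f xs) (g xs) (l xs))"
    if "total_computable k f" "total_computable k g" "total_computable k l" for k f g l
    using total_computable_compose3[of "\<lambda>x y z. of_bool (ok x y z)", OF ok that] .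
  have new': "decidable k (\<lambda>xs. new (f xs) (g xs))"
    if "total_computable k f" "total_computable k g" for k f g
  proof (rule total_computable_compose2[OF _ that])
    show "decidable 2 (\<lambda>xs. new (xs ! 0) (xs ! 1))"
      unfolding new_def by (intro computable_intros M' ok') simp_all
  qed
  have rank': "total_computable k (\<lambda>xs. rank (f xs) (g xs))"
    if "total_computable k f" "total_computable k g" for k f g
  proof (rule total_computable_compose2[OF _ that])
    show "total_computable 2 (\<lambda>xs. rank (xs ! 0) (xs ! 1))"
      unfolding rank_def by (intro computable_intros new') simp_all
  qed
  have "decidable 2 (\<lambda>xs. R (xs ! 0) (xs ! 1))"
    unfolding R_def by (intro computable_intros M' new' rank') simp_all
  moreover have "pairwise (\<parallel>) {\<sigma>. \<exists>t. R t (string_code \<sigma>)}"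
  proof (rule pairwise_parallelI, clarify)
    fix \<sigma> w t t' assume "R t (string_code \<sigma>)" "R t' (string_code (\<sigma> @ w))"
    then obtain d d' \<tau> \<tau>' where *: "\<sigma> = replicate d False @ True # \<tau>" "length \<sigma> = Suc d + (M d - 2 * d)"
      "\<sigma> @ w = replicate d' False @ True # \<tau>'" "length (\<sigma> @ w) = Suc d' + (M d' - 2 * d')"
      unfolding R_def unary_head_iff by (auto simp del: length_append)
    then have "replicate d False @ True # (\<tau> @ w) = replicate d' False @ True # \<tau>'" by simp
    then have "d = d'" unfolding replicate_False_True_eq_iff by blast
    with *(2,4) have "length (\<sigma> @ w) = length \<sigma>" by metis
    then show "w = []" by simp
  qed
  ultimately obtain c where c: "\<And>\<sigma> t. R t (string_code \<sigma>) \<Longrightarrow>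
      \<exists>t0. R t0 (string_code \<sigma>) \<and> approx t0 + (1 / 2) ^ (c + length \<sigma>) \<le> ?\<Omega>"
    using halting_probability_gap by blast
  \<comment> \<open>With this \<open>d\<close> the description has length
    \<open>M d - 1 - c\<close>, so the gap is twice the length of the interval determined by
    \<open>x\<close>.\<close>
  define d where "d = c + 2"
  define x where "x = nat \<lfloor>2 ^ M d * ?\<Omega>\<rfloor>"
  have "real x = of_int \<lfloor>2 ^ M d * ?\<Omega>\<rfloor>" using halting_probability_bounds(1) by (simp add: x_def)
  then have x: "real x \<le> 2 ^ M d * ?\<Omega>" "2 ^ M d * ?\<Omega> < real x + 1" by linarith+
  have "?\<Omega> < 1" using halting_probability_bounds(2) halting_probability_not_dyadic[of 1 0] by simp
  then have "2 ^ M d * ?\<Omega> < 2 ^ M d * 1" by (intro mult_strict_left_mono) auto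
  then have "real x < real (2 ^ M d)" using x(1) by (metis le_less_trans mult_1_right of_nat_numeral of_nat_power)
  then have x_less: "x < 2 ^ M d" by (simp only: of_nat_less_iff)
  obtain s where s: "ok d s x" using contr unfolding x_def by blast
  have "\<exists>u. u mod 2 ^ M d = x \<and> ok d (u div 2 ^ M d) x"
    using s x_less by (intro exI[of _ "x + 2 ^ M d * s"]) simp
  then obtain u where u: "u mod 2 ^ M d = x" "ok d (u div 2 ^ M d) x"
    "\<And>u'. u' < u \<Longrightarrow> \<not> (u' mod 2 ^ M d = x \<and> ok d (u' div 2 ^ M d) x)"
    using exists_least_iff[of "\<lambda>u. u mod 2 ^ M d = x \<and> ok d (u div 2 ^ M d) x"] by auto
  then have new_u: "new d u" unfolding new_def by auto
  have rank_eq: "rank d u = card {u'. u' < u \<and> new d u'}" for u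
    by (simp add: rank_def of_bool_def sum.If_cases Int_def)
  have rank_mono: "rank d u' < rank d u''" if "u' < u''" "new d u'" for u' u''
    unfolding rank_eq using that by (intro psubset_card_mono) auto
  have rank_inj: "u' = u" if "new d u'" "rank d u' = rank d u" for u'
    using rank_mono[of u' u] rank_mono[of u u'] new_u that by (metis linorder_neqE_nat less_irrefl)
  have rank_less: "rank d u < 2 ^ (M d - 2 * d)"
  proof -
    let ?E = "{x. x < 2 ^ M d \<and> (\<exists>s. ok d s x)}"
    have "inj_on (\<lambda>u'. u' mod 2 ^ M d) {u'. u' \<le> u \<and> new d u'}"
    proof (rule inj_onI, clarify)
      fix u1 u2 assume "new d u1" "new d u2" "u1 mod 2 ^ M d = u2 mod 2 ^ M d"
      then show "u1 = u2" unfolding new_def by (metis linorder_neqE_nat)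
    qed
    then have "card {u'. u' \<le> u \<and> new d u'} \<le> card ?E"
      by (rule card_inj_on_le) (auto simp: new_def)
    moreover have "{u'. u' < u \<and> new d u'} \<subset> {u'. u' \<le> u \<and> new d u'}" using new_u by auto
    then have "rank d u < card {u'. u' \<le> u \<and> new d u'}"
      unfolding rank_eq by (intro psubset_card_mono) auto
    ultimately show ?thesis using card_le[of d] by linarith
  qed
  define \<sigma> where "\<sigma> = replicate d False @ True # to_bits (M d - 2 * d) (rank d u)"
  have \<sigma>: "unary_head d (string_code \<sigma>)" "length \<sigma> = Suc d + (M d - 2 * d)"
    "code_segment (string_code \<sigma>) (Suc d) (M d - 2 * d) = rank d u"
    using rank_less unfolding unary_head_iff
    by (auto simp: \<sigma>_def code_segment_string_code bits_value_to_bits)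
  have approx_iff: "x * 2 ^ t \<le> scaled_approx t * 2 ^ M d \<longleftrightarrow> real x / 2 ^ M d \<le> approx t" for t
  proof -
    have "x * 2 ^ t \<le> scaled_approx t * 2 ^ M d \<longleftrightarrow> real (x * 2 ^ t) \<le> real (scaled_approx t * 2 ^ M d)"
      by (simp only: of_nat_le_iff)
    then show ?thesis by (simp add: approx_def field_simps)
  qed
  have "real x / 2 ^ M d \<le> ?\<Omega>" using x(1) by (simp add: field_simps)
  then have "real x / 2 ^ M d < ?\<Omega>" using halting_probability_not_dyadic[of x "M d"] by linarith
  then obtain t1 where "real x / 2 ^ M d < approx t1" using ex_approx by blast
  moreover define t where "t = t1 + Suc u"
  ultimately have "real x / 2 ^ M d \<le> approx t" using approx_mono[of t1 t] by simp
  then have "R t (string_code \<sigma>)"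
    unfolding R_def using \<sigma> u(1) new_u approx_iff[of t] length_le_string_code[of \<sigma>]
    by (intro exI[of _ d] exI[of _ u] conjI) (simp_all add: t_def)
  then obtain t0 where t0: "R t0 (string_code \<sigma>)" "approx t0 + (1 / 2) ^ (c + length \<sigma>) \<le> ?\<Omega>"
    using c by blast
  \<comment> \<open>The stage \<open>t0\<close> may differ from \<open>t\<close>, but the
    description determines \<open>d\<close> and \<open>u\<close>, so at \<open>t0\<close> the
    approximation has reached the same fraction.\<close>
  obtain d' u' where d': "unary_head d' (string_code \<sigma>)" and u': "new d' u'"
    "rank d' u' = code_segment (string_code \<sigma>) (Suc d') (M d' - 2 * d')"
    "(u' mod 2 ^ M d') * 2 ^ t0 \<le> scaled_approx t0 * 2 ^ M d'"
    using t0(1) unfolding R_def by blast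
  have "d' = d"
    using d' unfolding \<sigma>_def unary_head_iff replicate_False_True_eq_iff by blast
  with u' \<sigma>(3) rank_inj have "u' = u" by simp
  with u'(3) \<open>d' = d\<close> u(1) have "real x / 2 ^ M d \<le> approx t0" using approx_iff by simp
  with t0(2) have "real x / 2 ^ M d + (1 / 2) ^ (c + length \<sigma>) \<le> ?\<Omega>" by linarith
  moreover have "(1 / 2 :: real) ^ (c + length \<sigma>) = 2 / 2 ^ M d"
  proof -
    have "M d = Suc (c + length \<sigma>)" using M_ge[of d] \<sigma>(2) by (simp add: d_def)
    then show ?thesis by (simp add: power_one_over)
  qed
  ultimately have "(real x + 2) / 2 ^ M d \<le> ?\<Omega>" by (simp only: add_divide_distrib)
  then have "real x + 2 \<le> 2 ^ M d * ?\<Omega>" by (simp add: pos_divide_le_eq mult.commute)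
  with x(2) show False by linarith
qed

section \<open>Logarithmic redundancy does not suffice\<close>

text \<open>For \<open>n \<ge> 1\<close> this is floor(log n) + 4: the oracle bits beyond
  \<open>n\<close>, 2 more because a block begins at length \<open>n - 2\<close>, and 2 more for
  cutting into quarters.\<close>

definition block_size :: "nat \<Rightarrow> nat" where
  "block_size n = code_length (n - 1) + 4"

definition start :: "nat \<Rightarrow> nat" where
  "start k = rec_nat 2 (\<lambda>_ n. n + block_size n) k"

text \<open>As 3 * 4/3 * 2^-n = 2^-(n - 2), all dyadic intervals of length 2^-(n - 2) meet the
  multiples of 4/3 2^-n in the same pattern. The initial value 2 of \<open>start\<close> makes level
  0 the whole unit interval.\<close>

definition level :: "nat \<Rightarrow> nat" where
  "level k = start k - 2"

lemma start_0: "start 0 = 2" and start_Suc: "start (Suc k) = start k + block_size (start k)"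
  by (simp_all add: start_def)

lemma start_ge: "k + 2 \<le> start k"
  by (induction k) (auto simp: start_0 start_Suc block_size_def)

lemma level_0: "level 0 = 0" and level_Suc: "level (Suc k) = level k + block_size (start k)"
  using start_ge[of k] by (simp_all add: level_def start_0 start_Suc)

lemma start_eq_level: "start k = level k + 2"
  using start_ge[of k] by (simp add: level_def)

lemma level_mono: "k \<le> k' \<Longrightarrow> level k \<le> level k'"
  by (rule lift_Suc_mono_le) (simp_all add: level_Suc)

lemma total_computable_start [computable_intros]:
  assumes "total_computable k f" shows "total_computable k (\<lambda>xs. start (f xs))"
proof (rule total_computable_compose1[OF _ assms])
  show "total_computable 1 (\<lambda>xs. start (xs ! 0))"
    unfolding start_def block_size_def by (intro computable_intros) simp_all
qed

lemma total_computable_level [computable_intros]: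
  "total_computable k f \<Longrightarrow> total_computable k (\<lambda>xs. level (f xs))"
  unfolding level_def by (intro computable_intros)

lemma total_computable_block_size [computable_intros]:
  "total_computable k f \<Longrightarrow> total_computable k (\<lambda>xs. block_size (f xs))"
  unfolding block_size_def by (intro computable_intros)

lemma block_size_bounds:
  assumes "n \<ge> 1" shows "2 ^ block_size n \<le> 16 * n" "16 * n < 2 ^ Suc (block_size n)"
  using code_length_bounds[of "n - 1"] assms by (simp_all add: block_size_def power_add)

lemma floor_log_eq:
  assumes "n \<ge> 1" shows "\<lfloor>log 2 (real n)\<rfloor> = int (block_size n) - 4"
proof -
  have "2 ^ code_length (n - 1) \<le> n \<and> n < 2 ^ Suc (code_length (n - 1))"
    using code_length_bounds[of "n - 1"] assms by simp
  then have "\<lfloor>log 2 (real n)\<rfloor> = int (code_length (n - 1))"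
    using floor_log_nat_eq_if[of 2 "code_length (n - 1)" n] by simp
  then show ?thesis by (simp add: block_size_def)
qed

text \<open>\<open>ln ln\<close> is an antiderivative of \<open>1 / (n ln n)\<close>, and \<open>start\<close> advances by about \<open>ln n\<close> at \<open>n\<close>.\<close>

lemma ln_ln_start_diff:
  "ln (ln (real (start (Suc k)))) - ln (ln (real (start k))) \<le> 80 / ln 2 * (1 / 2) ^ block_size (start k)"
proof -
  let ?n = "start k" let ?r = "block_size ?n" let ?m = "start (Suc k)"
  have n: "real ?n \<ge> 2" using start_ge[of k] by simp
  have m: "real ?m = real ?n + real ?r" by (simp add: start_Suc)
  have ln2: "0 < ln (2::real)" by simp
  have ln_n: "ln 2 \<le> ln (real ?n)" using n by simp
  \<comment> \<open>From 2^r <= 16 n and n >= 2. The factor 5 and a second use of the factor 16 make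
    up the constant 80.\<close>
  have r: "real ?r * ln 2 \<le> 5 * ln (real ?n)"
  proof -
    have "real (2 ^ ?r) \<le> real (16 * ?n)"
      using block_size_bounds(1)[of ?n] n by (simp only: of_nat_le_iff)
    then have "ln (2 ^ ?r) \<le> ln (16 * real ?n)" using n by (subst ln_le_cancel_iff) auto
    also have "\<dots> = ln (2 ^ 4) + ln (real ?n)" using n by (simp add: ln_mult)
    also have "ln (2 ^ 4 :: real) = 4 * ln 2" by (subst ln_realpow) auto
    finally show ?thesis using ln_n by (simp add: ln_realpow)
  qed
  have "ln (ln (real ?m)) - ln (ln (real ?n)) \<le> (ln (real ?m) - ln (real ?n)) / ln (real ?n)"
    using n m ln2 ln_n by (intro ln_diff_le) (auto intro!: ln_gt_zero)
  also have "\<dots> \<le> ((real ?m - real ?n) / real ?n) / ln (real ?n)"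
    using n m ln2 ln_n by (intro divide_right_mono ln_diff_le) auto
  also have "\<dots> = (real ?r * ln 2 / ln (real ?n)) / (real ?n * ln 2)"
    using n ln2 ln_n m by (simp add: field_simps)
  also have "\<dots> \<le> 5 / (real ?n * ln 2)"
    using r n ln2 ln_n by (intro divide_right_mono) (auto simp: divide_le_eq)
  also have "\<dots> \<le> 80 / ln 2 * (1 / 2) ^ ?r"
  proof -
    have "real (2 ^ ?r) \<le> real (16 * ?n)"
      using block_size_bounds(1)[of ?n] n by (simp only: of_nat_le_iff)
    then have "1 / real ?n \<le> 16 * (1 / 2) ^ ?r" using n by (simp add: power_one_over field_simps)
    then have "5 / ln 2 * (1 / real ?n) \<le> 5 / ln 2 * (16 * (1 / 2) ^ ?r)"
      using ln2 by (intro mult_left_mono) auto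
    then show ?thesis by (simp add: field_simps)
  qed
  finally show ?thesis .
qed

text \<open>The differences of \<open>ln ln\<close> telescope, and \<open>start K\<close> exceeds
  \<open>K\<close>.\<close>

lemma sum_blocks_unbounded: "\<exists>K. B \<le> (\<Sum>k<K. (1 / 2 :: real) ^ block_size (start k))"
proof -
  let ?S = "\<lambda>K. \<Sum>k<K. (1 / 2 :: real) ^ block_size (start k)"
  let ?C = "80 / ln (2::real)"
  have C: "?C > 0" by simp
  have *: "ln (ln (real (start K))) - ln (ln 2) \<le> ?C * ?S K" for K
  proof (induction K)
    case (Suc K)
    then show ?case using ln_ln_start_diff[of K] by (simp add: distrib_left)
  qed (simp add: start_0)
  define b where "b = exp (exp (?C * B + ln (ln 2)))"
  obtain K where K: "b \<le> real K" using real_arch_simple by blast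
  have "b > 1" by (simp add: b_def)
  have bK: "b \<le> real (start K)" using K start_ge[of K] by linarith
  have "ln (ln b) \<le> ln (ln (real (start K)))"
    using \<open>b > 1\<close> bK by (intro ln_mono ln_gt_zero) auto
  moreover have "ln (ln b) = ?C * B + ln (ln 2)" by (simp add: b_def)
  ultimately have "?C * B \<le> ?C * ?S K" using *[of K] by linarith
  then have "B \<le> ?S K" using C by (simp only: mult_le_cancel_left_pos)
  then show ?thesis by blast
qed

text \<open>What is left of the \<open>2 ^ level K\<close> prefixes when at each level every prefix
  loses one of its extensions.\<close>

definition survivors :: "nat \<Rightarrow> nat" where
  "survivors K = (\<Prod>k<K. 2 ^ block_size (start k) - 1)"

lemma survivors_Suc: "survivors (Suc K) = survivors K * (2 ^ block_size (start K) - 1)"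
  by (simp add: survivors_def)

lemma total_computable_survivors [computable_intros]:
  assumes "total_computable k f" shows "total_computable k (\<lambda>xs. survivors (f xs))"
proof (rule total_computable_compose1[OF _ assms])
  have "survivors K = rec_nat 1 (\<lambda>k z. z * (2 ^ block_size (start k) - 1)) K" for K
    by (induction K) (simp_all add: survivors_def mult.commute)
  then show "total_computable 1 (\<lambda>xs. survivors (xs ! 0))"
    by (simp only:) (intro computable_intros; simp)
qed

lemma survivors_eq:
  "real (survivors K) = 2 ^ level K * (\<Prod>k<K. 1 - (1 / 2) ^ block_size (start k))"
proof (induction K)
  case (Suc K)
  have "real (2 ^ block_size (start K) - 1) = 2 ^ block_size (start K) * (1 - (1 / 2) ^ block_size (start K))"
    by (simp add: of_nat_diff power_one_over field_simps)
  with Suc show ?case by (simp add: survivors_Suc level_Suc power_add)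
qed (simp add: survivors_def level_0)

text \<open>By \<open>1 - x \<le> exp (- x)\<close> the fraction of survivors is at most the
  exponential of minus the divergent sum.\<close>

lemma ex_survivors_le: "\<exists>K. survivors K * 4 ^ d \<le> 2 ^ level K"
proof -
  obtain K where K: "ln (4 ^ d) \<le> (\<Sum>k<K. (1 / 2 :: real) ^ block_size (start k))"
    using sum_blocks_unbounded by blast
  have "(\<Prod>k<K. 1 - (1 / 2 :: real) ^ block_size (start k)) \<le> (\<Prod>k<K. exp (- ((1 / 2) ^ block_size (start k))))"
    by (intro prod_mono) (auto simp: power_le_one intro: order_trans[OF _ exp_ge_add_one_self])
  also have "\<dots> = exp (- (\<Sum>k<K. (1 / 2 :: real) ^ block_size (start k)))"
    by (simp add: exp_sum flip: sum_negf)
  also have "\<dots> \<le> exp (- ln (4 ^ d))" using K by simp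
  also have "\<dots> = 1 / 4 ^ d" by (simp add: exp_minus field_simps)
  finally have "real (survivors K) \<le> 2 ^ level K * (1 / 4 ^ d)"
    unfolding survivors_eq by (intro mult_left_mono) auto
  then have "real (survivors K * 4 ^ d) \<le> real (2 ^ level K)" by (simp add: field_simps)
  then show ?thesis by (simp only: of_nat_le_iff) blast
qed

text \<open>A least number found by a terminating search is computable, so no explicit rate of
  divergence has to be programmed.\<close>

definition depth :: "nat \<Rightarrow> nat" where
  "depth d = (LEAST K. survivors K * 4 ^ d \<le> 2 ^ level K)"

lemma total_computable_depth [computable_intros]:
  assumes "total_computable k f" shows "total_computable k (\<lambda>xs. depth (f xs))"
proof (rule total_computable_compose1[OF _ assms])
  show "total_computable 1 (\<lambda>xs. depth (xs ! 0))"
    unfolding depth_def by (intro computable_intros ex_survivors_le) simp_all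
qed

lemma survivors_depth: "survivors (depth d) * 4 ^ d \<le> 2 ^ level (depth d)"
  unfolding depth_def by (rule LeastI_ex) (rule ex_survivors_le)

text \<open>\<open>\<Phi> s k y\<close> is the stage function of a reduction that is to compute the first \<open>start k\<close> bits of
  \<open>3 / 4 * x\<close> from the first \<open>level (Suc k) - 2\<close> bits of \<open>x\<close>, given as the number \<open>y\<close>.\<close>

locale block_test =
  fixes \<Phi> :: "nat \<Rightarrow> nat \<Rightarrow> nat \<Rightarrow> nat"
  assumes \<Phi>_computable: "total_computable 3 (\<lambda>xs. \<Phi> (xs ! 0) (xs ! 1) (xs ! 2))"
    and \<Phi>_mono: "\<Phi> s k y = Suc v \<Longrightarrow> s \<le> s' \<Longrightarrow> \<Phi> s' k y = Suc v"
begin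

text \<open>The interval of \<open>z\<close> at level \<open>Suc k\<close> meets the interval of the
  reals \<open>x\<close> for which \<open>3 / 4 * x\<close> has the number \<open>j\<close> as its
  prefix of length \<open>start k\<close>; both are scaled by
  \<open>3 * 2 ^ level (Suc k)\<close>.\<close>

definition fits :: "nat \<Rightarrow> nat \<Rightarrow> nat \<Rightarrow> bool" where
  "fits k j z \<longleftrightarrow> 3 * z < 4 * Suc j * 2 ^ (block_size (start k) - 2) \<and>
     4 * j * 2 ^ (block_size (start k) - 2) < 3 * Suc z"

text \<open>\<open>z div 4\<close> removes the last two bits of the prefix, which lie beyond the use
  of the reduction.\<close>

definition passes :: "nat \<Rightarrow> nat \<Rightarrow> nat \<Rightarrow> bool" where
  "passes s k z \<longleftrightarrow> \<Phi> s k (z div 4) \<noteq> 0 \<and> fits k (code_segment (\<Phi> s k (z div 4) - 1) 0 (start k)) z"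

definition passes_all :: "nat \<Rightarrow> nat \<Rightarrow> nat \<Rightarrow> bool" where
  "passes_all K s x \<longleftrightarrow> (\<forall>k<K. passes s k (x div 2 ^ (level K - level (Suc k))))"

lemma \<Phi>_computable' [computable_intros]:
  "total_computable k f \<Longrightarrow> total_computable k g \<Longrightarrow> total_computable k l \<Longrightarrow>
    total_computable k (\<lambda>xs. \<Phi> (f xs) (g xs) (l xs))"
  by (rule total_computable_compose3[OF \<Phi>_computable])

lemma decidable_passes_all: "decidable 3 (\<lambda>xs. passes_all (xs ! 0) (xs ! 1) (xs ! 2))"
proof -
  have "decidable 3 (\<lambda>xs. passes (xs ! 0) (xs ! 1) (xs ! 2))"
    unfolding passes_def fits_def by (intro computable_intros) simp_all
  then have *: "decidable k (\<lambda>xs. passes (f xs) (g xs) (l xs))"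
    if "total_computable k f" "total_computable k g" "total_computable k l" for k f g l
    using total_computable_compose3[of "\<lambda>x y z. of_bool (passes x y z)"] that by blast
  show ?thesis
    unfolding passes_all_def by (intro computable_intros *) simp_all
qed

text \<open>The interval of the reals with prefix \<open>x * P + P div 3\<close>, where \<open>P\<close> is a quarter of the number of
  blocks, contains the point \<open>4 / 3 * (3 * x + 1) / 2 ^ start k\<close>, which divides it in the ratio 1 to 2 or
  2 to 1. An output of \<open>\<Phi>\<close> for this prefix decides on which side of the point the real is, and thus excludes
  the first or the last quarter of the interval.\<close>

lemma ex_not_passes: "\<exists>b<2 ^ block_size (start k). \<forall>s. \<not> passes s k (x * 2 ^ block_size (start k) + b)"
proof -
  let ?r = "block_size (start k)"
  define P :: nat where "P = 2 ^ (?r - 2)"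
  define a e where "a = P div 3" and "e = P mod 3"
  have r: "?r = (?r - 2) + 2" by (simp add: block_size_def)
  have r4: "2 ^ ?r = 4 * P" unfolding P_def by (subst r) (simp add: power_add)
  have "4 \<le> P"
  proof -
    have "(2::nat) ^ 2 \<le> 2 ^ (?r - 2)" by (intro power_increasing) (auto simp: block_size_def)
    then show ?thesis by (simp add: P_def)
  qed
  have P: "P = 3 * a + e" by (simp add: a_def e_def)
  \<comment> \<open>Hence the point lies strictly inside the short interval, at one third or two
    thirds of it.\<close>
  have "\<not> 3 dvd P"
  proof
    assume "3 dvd P"
    then have "(3::nat) dvd 2" unfolding P_def using prime_dvd_power[of "3::nat" 2] by simp
    then show False by simp
  qed
  then have e: "1 \<le> e" "e \<le> 2" using pos_mod_bound[of 3 P] by (auto simp: e_def dvd_eq_mod_eq_0)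
  let ?y = "x * P + a"
  have y: "(x * 2 ^ ?r + 4 * a) div 4 = ?y" "(x * 2 ^ ?r + (4 * a + 3)) div 4 = ?y"
    unfolding r4 by (simp_all add: algebra_simps)
  have "\<exists>b\<in>{4 * a, 4 * a + 3}. \<forall>s. \<not> passes s k (x * 2 ^ ?r + b)"
  proof (cases "\<forall>s. \<Phi> s k ?y = 0")
    \<comment> \<open>A reduction that never answers on this prefix lets none of the quarters
      pass.\<close>
    case True
    then show ?thesis by (simp add: passes_def y)
  next
    case False
    then obtain s0 v where v: "\<Phi> s0 k ?y = Suc v" by (meson not0_implies_Suc)
    have val: "\<Phi> s k ?y - 1 = v" if nz: "\<Phi> s k ?y \<noteq> 0" for s
    proof -
      obtain v' where v': "\<Phi> s k ?y = Suc v'" using not0_implies_Suc[OF nz] ..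
      have "\<Phi> (s + s0) k ?y = Suc v" by (rule \<Phi>_mono[OF v]) simp
      moreover have "\<Phi> (s + s0) k ?y = Suc v'" by (rule \<Phi>_mono[OF v']) simp
      ultimately show ?thesis using v' by simp
    qed
    let ?j = "code_segment v 0 (start k)"
    have xP: "4 * ((3 * x + 1) * P) = 12 * (x * P) + 12 * a + 4 * e"
      using P by (simp add: algebra_simps)
    \<comment> \<open>In twelfths of the short interval the point is at \<open>4 * e\<close>. The
      first quarter ends at 3, before it, and the last one begins at 9, behind it, as
      \<open>e\<close> is 1 or 2.\<close>
    have arith1: "3 * Suc (4 * w + 4 * a) \<le> 4 * i" if "12 * w + 12 * a + 4 * e \<le> 4 * i" for w i
      using that e by simp
    have arith2: "4 * i \<le> 3 * (4 * w + 4 * a + 3)" if "4 * i \<le> 12 * w + 12 * a + 4 * e" for w i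
      using that e by simp
    show ?thesis
    proof (cases "3 * x + 1 \<le> ?j")
      case True
      then have "4 * ((3 * x + 1) * P) \<le> 4 * (?j * P)" by (intro mult_le_mono2 mult_le_mono1)
      then have "3 * Suc (4 * (x * P) + 4 * a) \<le> 4 * (?j * P)" unfolding xP by (rule arith1)
      then have "\<not> fits k ?j (x * 2 ^ ?r + 4 * a)" by (simp add: fits_def r4 P_def[symmetric] algebra_simps)
      then have "\<not> passes s k (x * 2 ^ ?r + 4 * a)" for s
        using val[of s] unfolding passes_def y by auto
      then show ?thesis by blast
    next
      case False
      then have "4 * (Suc ?j * P) \<le> 4 * ((3 * x + 1) * P)" by (intro mult_le_mono2 mult_le_mono1) simp
      then have "4 * (Suc ?j * P) \<le> 3 * (4 * (x * P) + 4 * a + 3)" unfolding xP by (rule arith2)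
      then have "\<not> fits k ?j (x * 2 ^ ?r + (4 * a + 3))" by (simp add: fits_def r4 P_def[symmetric] algebra_simps)
      then have "\<not> passes s k (x * 2 ^ ?r + (4 * a + 3))" for s
        using val[of s] unfolding passes_def y by auto
      then show ?thesis by blast
    qed
  qed
  then obtain b where b: "b \<in> {4 * a, 4 * a + 3}" "\<forall>s. \<not> passes s k (x * 2 ^ ?r + b)" by blast
  moreover have "4 * a + 3 < 2 ^ ?r" using \<open>4 \<le> P\<close> P unfolding r4 by linarith
  then have "b < 2 ^ ?r" using b(1) by auto
  ultimately show ?thesis by blast
qed

lemma passes_all_mod:
  assumes "passes_all (Suc K) s (x * 2 ^ block_size (start K) + b)" "b < 2 ^ block_size (start K)"
  shows "passes_all K s x" "passes s K (x * 2 ^ block_size (start K) + b)"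
proof -
  show "passes s K (x * 2 ^ block_size (start K) + b)"
    using assms(1) unfolding passes_all_def by (auto dest: spec[of _ K])
  have "(x * 2 ^ block_size (start K) + b) div 2 ^ (level (Suc K) - level (Suc k)) = x div 2 ^ (level K - level (Suc k))"
    if "k < K" for k
  proof -
    have "level (Suc k) \<le> level K" using that by (intro level_mono) simp
    then have "level (Suc K) - level (Suc k) = block_size (start K) + (level K - level (Suc k))"
      by (simp add: level_Suc)
    then show ?thesis using assms(2) by (simp add: power_add div_mult2_eq)
  qed
  then show "passes_all K s x" using assms(1) unfolding passes_all_def by (metis less_SucI)
qed

text \<open>The failing extension from \<open>ex_not_passes\<close> depends on the prefix but not on
  the stage, so it is also missing from the union over all stages.\<close>

lemma card_passes_all: "card {x. x < 2 ^ level K \<and> (\<exists>s. passes_all K s x)} \<le> survivors K"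
proof (induction K)
  case 0
  have "{x :: nat. x < 2 ^ level 0 \<and> (\<exists>s. passes_all 0 s x)} \<subseteq> {0}" by (auto simp: level_0)
  then show ?case using card_mono[of "{0::nat}"] by (simp add: survivors_def)
next
  case (Suc K)
  let ?E = "\<lambda>K. {x. x < 2 ^ level K \<and> (\<exists>s. passes_all K s x)}" and ?R = "2 ^ block_size (start K) :: nat"
  obtain c where c: "\<And>x. c x < ?R" "\<And>x s. \<not> passes s K (x * ?R + c x)"
    using ex_not_passes by metis
  let ?ext = "\<lambda>x. (\<lambda>b. x * ?R + b) ` ({..<?R} - {c x})"
  have "?E (Suc K) \<subseteq> (\<Union>x\<in>?E K. ?ext x)"
  proof
    fix z assume "z \<in> ?E (Suc K)"
    then obtain s where z: "z < 2 ^ level K * ?R" "passes_all (Suc K) s z"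
      by (auto simp: level_Suc power_add)
    let ?x = "z div ?R" and ?b = "z mod ?R"
    have eq: "z = ?x * ?R + ?b" by (simp only: div_mult_mod_eq)
    have b: "?b < ?R" by simp
    have "passes_all K s ?x" "passes s K z"
      using passes_all_mod[of K s ?x ?b] z(2) eq b by metis+
    moreover have "?x < 2 ^ level K" using z(1) by (simp add: div_less_iff_less_mult)
    moreover have "?b \<noteq> c ?x" using c(2)[of s ?x] \<open>passes s K z\<close> eq by metis
    ultimately show "z \<in> (\<Union>x\<in>?E K. ?ext x)"
      using eq b by (intro UN_I[of ?x] image_eqI[of _ _ ?b]) auto
  qed
  then have "card (?E (Suc K)) \<le> card (\<Union>x\<in>?E K. ?ext x)" by (intro card_mono) auto
  also have "\<dots> \<le> (\<Sum>x\<in>?E K. card (?ext x))" by (intro card_UN_le) simp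
  also have "\<dots> = card (?E K) * (?R - 1)"
    using c(1) by (simp add: card_image inj_on_def card_Diff_singleton)
  also have "\<dots> \<le> survivors (Suc K)" unfolding survivors_Suc by (intro mult_le_mono1 Suc)
  finally show ?case .
qed

lemma ex_not_passes_all:
  assumes "universal_staged_machine U F"
  shows "\<exists>K. \<forall>s. \<not> passes_all K s (nat \<lfloor>2 ^ level K * halting_probability U\<rfloor>)"
proof -
  interpret universal_staged_machine U F by (rule assms)
  have "\<exists>d. \<forall>s. \<not> passes_all (depth d) s (nat \<lfloor>2 ^ level (depth d) * halting_probability U\<rfloor>)"
  proof (rule ex_outside_test)
    show "total_computable 1 (\<lambda>xs. level (depth (xs ! 0)))" by (intro computable_intros) simp
    show "decidable 3 (\<lambda>xs. passes_all (depth (xs ! 0)) (xs ! 1) (xs ! 2))"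
      by (rule total_computable_compose3[OF decidable_passes_all]; intro computable_intros; simp)
  next
    fix d
    \<comment> \<open>At least one survivor means \<open>4 ^ d \<le> 2 ^ level (depth d)\<close>, so
      the exponent \<open>level (depth d) - 2 * d\<close> is not truncated.\<close>
    have pos: "1 \<le> survivors K" for K
      unfolding survivors_def
    proof (intro prod_ge_1)
      fix k
      have "(2::nat) ^ 1 \<le> 2 ^ block_size (start k)" by (intro power_increasing) (auto simp: block_size_def)
      then show "1 \<le> (2::nat) ^ block_size (start k) - 1" by simp
    qed
    have "(2::nat) ^ (2 * d) \<le> survivors (depth d) * 4 ^ d"
      using mult_le_mono1[OF pos[of "depth d"], of "4 ^ d"] by (simp add: power_mult)
    with survivors_depth[of d] have "(2::nat) ^ (2 * d) \<le> 2 ^ level (depth d)" by linarith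
    then show le: "2 * d \<le> level (depth d)" by (simp only: power_increasing_iff)
    have "survivors (depth d) * 4 ^ d \<le> 2 ^ (level (depth d) - 2 * d) * 4 ^ d"
    proof -
      have "(2::nat) ^ level (depth d) = 2 ^ (level (depth d) - 2 * d) * 2 ^ (2 * d)"
        using le by (simp flip: power_add)
      with survivors_depth[of d] show ?thesis by (simp add: power_mult)
    qed
    then have "survivors (depth d) \<le> 2 ^ (level (depth d) - 2 * d)" by simp
    with card_passes_all[of "depth d"]
    show "card {x. x < 2 ^ level (depth d) \<and> (\<exists>s. passes_all (depth d) s x)} \<le> 2 ^ (level (depth d) - 2 * d)"
      by linarith
  qed
  then show ?thesis by blast
qed

end

section \<open>Three quarters of an omega number\<close>

definition tripled :: "(bool list \<rightharpoonup> bool list) \<Rightarrow> bool list \<rightharpoonup> bool list" where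
  "tripled U \<sigma> = (if 2 \<le> length \<sigma> \<and> \<not> (\<sigma> ! 0 \<and> \<sigma> ! 1) then U (drop 2 \<sigma>) else None)"

lemma dom_tripled: "dom (tripled U) = (\<Union>a\<in>{[False, False], [False, True], [True, False]}. (@) a ` dom U)"
proof -
  have *: "\<sigma> \<in> dom (tripled U) \<longleftrightarrow> (\<exists>a\<in>{[False, False], [False, True], [True, False]}. \<exists>\<tau>\<in>dom U. \<sigma> = a @ \<tau>)" for \<sigma>
  proof (cases "2 \<le> length \<sigma>")
    case True
    then obtain b c \<tau> where "\<sigma> = b # c # \<tau>"
      by (cases \<sigma>; cases "tl \<sigma>") auto
    then show ?thesis by (cases b; cases c) (auto simp: tripled_def domIff)
  next
    case False
    then show ?thesis by (auto simp: tripled_def domIff)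
  qed
  show ?thesis by (rule set_eqI) (simp only: * UN_iff image_iff)
qed

lemma (in staged_machine) prefix_free_tripled: "prefix_free_machine (tripled U)"
proof -
  define R where "R t i \<longleftrightarrow> 2 \<le> code_length i \<and> \<not> (code_bit i 0 \<and> code_bit i 1) \<and>
    F t ((Suc i - 2 ^ 2) div 2 ^ 2) \<noteq> 0" for t i
  define g where "g t i = F t ((Suc i - 2 ^ 2) div 2 ^ 2) - 1" for t i
  have "tripled U = search_machine R g"
  proof
    fix \<sigma>
    show "tripled U \<sigma> = search_machine R g \<sigma>"
    proof (cases "2 \<le> length \<sigma> \<and> \<not> (\<sigma> ! 0 \<and> \<sigma> ! 1)")
      case True
      let ?\<tau> = "drop 2 \<sigma>"
      have drop: "(Suc (string_code \<sigma>) - 2 ^ 2) div 2 ^ 2 = string_code ?\<tau>"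
        using True by (intro string_code_drop) simp
      have bits: "code_bit (string_code \<sigma>) 0 = \<sigma> ! 0" "code_bit (string_code \<sigma>) 1 = \<sigma> ! 1"
        using True by (auto intro!: code_bit_string_code)
      have R: "R t (string_code \<sigma>) \<longleftrightarrow> F t (string_code ?\<tau>) \<noteq> 0" for t
        using True unfolding R_def drop bits code_length_string_code by blast
      have g: "g t (string_code \<sigma>) = F t (string_code ?\<tau>) - 1" for t
        unfolding g_def drop ..
      show ?thesis
      proof (cases "\<exists>t. F t (string_code ?\<tau>) \<noteq> 0")
        case ex: True
        let ?t = "LEAST t. F t (string_code ?\<tau>) \<noteq> 0"
        have "F ?t (string_code ?\<tau>) \<noteq> 0" using LeastI_ex[OF ex] .
        then have "U ?\<tau> = Some (string_of (F ?t (string_code ?\<tau>) - 1))"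
          by (intro F_output[of ?t]) simp
        then show ?thesis
          using True ex by (simp only: tripled_def search_machine_def R g if_True simp_thms)
      next
        case nex: False
        then have "U ?\<tau> = None" using F_iff[of ?\<tau>] by (cases "U ?\<tau>") auto
        then show ?thesis using True nex by (simp only: tripled_def search_machine_def R if_True if_False simp_thms)
      qed
    next
      case False
      moreover have "code_bit (string_code \<sigma>) 0 = \<sigma> ! 0" "code_bit (string_code \<sigma>) 1 = \<sigma> ! 1" if "2 \<le> length \<sigma>"
        using that by (auto intro!: code_bit_string_code)
      ultimately have "\<not> R t (string_code \<sigma>)" for t
        unfolding R_def code_length_string_code by blast
      with False show ?thesis by (simp only: tripled_def search_machine_def if_False simp_thms)
    qed
  qed
  moreover have "partial_computable (search_machine R g)"
  proof (rule partial_computable_search_machine)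
    show "decidable 2 (\<lambda>xs. R (xs ! 0) (xs ! 1))"
      unfolding R_def by (intro computable_intros) simp_all
    show "total_computable 2 (\<lambda>xs. g (xs ! 0) (xs ! 1))"
      unfolding g_def by (intro computable_intros) simp_all
  qed
  moreover have "pairwise (\<parallel>) (dom (tripled U))"
  proof (rule pairwise_parallelI)
    fix \<sigma> w assume "\<sigma> \<in> dom (tripled U)" "\<sigma> @ w \<in> dom (tripled U)"
    then have "drop 2 \<sigma> \<in> dom U" "drop 2 \<sigma> @ w \<in> dom U"
      by (auto simp: tripled_def domIff split: if_splits)
    then have "drop 2 \<sigma> = drop 2 \<sigma> @ w"
      using prefix_free unfolding prefix_free_machine_def pairwise_def by (metis parallelD1 prefixI)
    then show "w = []" by simp
  qed
  ultimately show ?thesis by (simp add: prefix_free_machine_def)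
qed

lemma (in universal_staged_machine) universal_tripled: "universal_prefix_free_machine (tripled U)"
  unfolding universal_prefix_free_machine_def
proof (intro conjI allI impI)
  fix M assume "prefix_free_machine M"
  then obtain \<rho> where "\<And>\<tau>. U (\<rho> @ \<tau>) = M \<tau>"
    using universal unfolding universal_prefix_free_machine_def by blast
  then show "\<exists>\<rho>. \<forall>\<tau>. tripled U (\<rho> @ \<tau>) = M \<tau>"
    by (intro exI[of _ "False # False # \<rho>"]) (simp add: tripled_def)
qed (rule prefix_free_tripled)

lemma (in staged_machine) halting_probability_tripled:
  "halting_probability (tripled U) = 3 / 4 * halting_probability U"
proof -
  let ?w = "\<lambda>\<sigma>. (1 / 2 :: real) ^ length \<sigma>" and ?\<Omega> = "halting_probability U"
  have "(?w has_sum ?\<Omega>) (dom U)"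
    unfolding halting_probability_def by (intro has_sum_infsum summable)
  then have "((\<lambda>\<tau>. 1 / 4 * ?w \<tau>) has_sum (1 / 4 * ?\<Omega>)) (dom U)" by (rule has_sum_cmult_right)
  then have *: "(?w has_sum (1 / 4 * ?\<Omega>)) ((@) a ` dom U)" if "length a = 2" for a
    using that by (subst has_sum_reindex) (auto simp: inj_on_def comp_def power_add power2_eq_square)
  have "(?w has_sum (1 / 4 * ?\<Omega> + 1 / 4 * ?\<Omega>)) ((@) [False, False] ` dom U \<union> (@) [False, True] ` dom U)"
    by (intro has_sum_Un_disjoint *) auto
  then have "(?w has_sum (1 / 4 * ?\<Omega> + 1 / 4 * ?\<Omega> + 1 / 4 * ?\<Omega>))
      (((@) [False, False] ` dom U \<union> (@) [False, True] ` dom U) \<union> (@) [True, False] ` dom U)"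
    by (intro has_sum_Un_disjoint *) auto
  moreover have "((@) [False, False] ` dom U \<union> (@) [False, True] ` dom U) \<union> (@) [True, False] ` dom U = dom (tripled U)"
    unfolding dom_tripled by auto
  ultimately show ?thesis unfolding halting_probability_def by (simp add: infsumI)
qed

lemma (in universal_staged_machine) not_computes_three_quarters:
  "\<not> computes_with_redundancy (halting_probability U) (3 / 4 * halting_probability U) (h 1)"
proof
  let ?\<Omega> = "halting_probability U"
  assume "computes_with_redundancy ?\<Omega> (3 / 4 * ?\<Omega>) (h 1)"
  then obtain p where p: "\<And>n. \<exists>Q. eval (\<lambda>k. of_bool (binary_digit ?\<Omega> k)) p [n] (string_code (initial_bits (3 / 4 * ?\<Omega>) n)) Q \<and>
     (\<forall>k\<in>Q. 1 \<le> k \<and> int k \<le> \<lfloor>real n + h 1 n\<rfloor>)"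
    unfolding computes_with_redundancy_def by blast
  have \<Omega>: "0 \<le> ?\<Omega>" "?\<Omega> < 1"
    using halting_probability_bounds halting_probability_not_dyadic[of 1 0] by auto
  define G where "G m y k = (if 1 \<le> k \<and> k \<le> m then Suc (of_bool (odd (y div 2 ^ (m - k)))) else 0)"
    for m y k :: nat
  have "total_computable 3 (\<lambda>xs. G (xs ! 0) (xs ! 1) (xs ! 2))"
    unfolding G_def by (intro computable_intros decidable_even) simp_all
  then obtain Fp where Fp: "stage_function G 1 p Fp" using ex_stage_function by blast
  define \<Phi> where "\<Phi> s k y = Fp [s, level (Suc k) - 2, y, start k]" for s k y
  have "block_test \<Phi>"
  proof
    have "total_computable 3 (\<lambda>xs. Fp (map (\<lambda>g. g xs)
        [\<lambda>xs. xs ! 0, \<lambda>xs. level (Suc (xs ! 1)) - 2, \<lambda>xs. xs ! 2, \<lambda>xs. start (xs ! 1)]))"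
      by (rule total_computable_compose)
        (use stage_function_computable[OF Fp] in \<open>auto intro!: computable_intros simp: numeral_eq_Suc\<close>)
    then show "total_computable 3 (\<lambda>xs. \<Phi> (xs ! 0) (xs ! 1) (xs ! 2))" by (simp add: \<Phi>_def)
    show "\<Phi> s' k y = Suc v" if "\<Phi> s k y = Suc v" "s \<le> s'" for s k y v s'
      using stage_function_mono[OF Fp _ _ that(2)] that(1) unfolding \<Phi>_def by simp
  qed
  then interpret block_test \<Phi> .
  have "\<exists>s. passes s k (nat \<lfloor>2 ^ level (Suc k) * ?\<Omega>\<rfloor>)" for k
  proof -
    let ?n = "start k" let ?r = "block_size ?n" let ?m = "level (Suc k) - 2"
    let ?A = "\<lambda>k. of_bool (binary_digit ?\<Omega> k) :: nat" and ?v = "string_code (initial_bits (3 / 4 * ?\<Omega>) ?n)"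
    define z where "z = nat \<lfloor>2 ^ level (Suc k) * ?\<Omega>\<rfloor>"
    have r: "4 \<le> ?r" by (simp add: block_size_def)
    have n: "1 \<le> ?n" using start_ge[of k] by simp
    \<comment> \<open>\<open>?m\<close> is exactly the number of oracle bits that redundancy log n
      allows, so all queries fall into the prefix \<open>y\<close>.\<close>
    have m: "int ?m = int ?n + (int ?r - 4)" using r start_eq_level[of k] by (simp add: level_Suc)
    have level_eq: "level (Suc k) = ?n + (?r - 2)" using r start_eq_level[of k] by (simp add: level_Suc)
    define y where "y = nat \<lfloor>2 ^ ?m * ?\<Omega>\<rfloor>"
    have zy: "z div 4 = y"
      using nat_floor_power2_div[OF \<Omega>(1), of ?m "level (Suc k)"] r by (simp add: z_def y_def level_Suc)
    obtain Q where Q: "eval ?A p [?n] ?v Q" "\<And>i. i \<in> Q \<Longrightarrow> 1 \<le> i \<and> int i \<le> \<lfloor>real ?n + h 1 ?n\<rfloor>"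
      using p by blast
    have "\<lfloor>real ?n + h 1 ?n\<rfloor> = int ?m"
    proof -
      have "\<lfloor>real ?n + h 1 ?n\<rfloor> = int ?n + \<lfloor>log 2 (real ?n)\<rfloor>" using n by (simp add: h_def)
      then show ?thesis using floor_log_eq[OF n] m by simp
    qed
    with Q(2) have Q': "i \<in> Q \<Longrightarrow> 1 \<le> i \<and> i \<le> ?m" for i by auto
    have "of_bool (binary_digit ?\<Omega> i) = G ?m y i - 1" if "i \<in> Q" for i
      using Q'[OF that] binary_digit_eq[OF \<Omega>(1), of i ?m] by (simp add: G_def y_def)
    then have "eval (\<lambda>i. G ?m y i - 1) p [?n] ?v Q" by (rule eval_oracle_cong[OF Q(1)])
    moreover have "Q \<subseteq> {i. G ?m y i \<noteq> 0}" using Q' by (auto simp: G_def)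
    ultimately have "halts_within (\<lambda>i. G ?m y i - 1) {i. G ?m y i \<noteq> 0} p [?n] ?v"
      unfolding halts_within_def by blast
    then obtain s where s: "\<Phi> s k y = Suc ?v"
      using stage_function_iff[OF Fp, of "[?n]"] unfolding \<Phi>_def by auto
    define j where "j = nat \<lfloor>2 ^ ?n * (3 / 4 * ?\<Omega>)\<rfloor>"
    have "real j = of_int \<lfloor>2 ^ ?n * (3 / 4 * ?\<Omega>)\<rfloor>" using \<Omega>(1) by (simp add: j_def)
    then have j: "real j \<le> 2 ^ ?n * (3 / 4 * ?\<Omega>)" "2 ^ ?n * (3 / 4 * ?\<Omega>) < real j + 1" by linarith+
    have "2 ^ ?n * (3 / 4 * ?\<Omega>) < 2 ^ ?n * 1" using \<Omega> by (intro mult_strict_left_mono) auto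
    then have "real j < real (2 ^ ?n)" using j(1) by (metis le_less_trans mult_1_right of_nat_numeral of_nat_power)
    then have "j < 2 ^ ?n" by (simp only: of_nat_less_iff)
    then have seg: "code_segment ?v 0 ?n = j"
      using \<Omega>(1) by (simp add: initial_bits_eq_to_bits code_segment_string_code bits_value_to_bits j_def)
    have "real z = of_int \<lfloor>2 ^ level (Suc k) * ?\<Omega>\<rfloor>" using \<Omega>(1) by (simp add: z_def)
    then have z: "real z \<le> 2 ^ level (Suc k) * ?\<Omega>" "2 ^ level (Suc k) * ?\<Omega> < real z + 1" by linarith+
    let ?P = "2 ^ (?r - 2) :: real"
    \<comment> \<open>The two intervals compared in \<open>fits\<close> meet because both contain
      the halting probability.\<close>
    have scale: "3 * (2 ^ level (Suc k) * ?\<Omega>) = 4 * ?P * (2 ^ ?n * (3 / 4 * ?\<Omega>))"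
      unfolding level_eq by (simp add: power_add)
    have "4 * ?P * real j \<le> 3 * (2 ^ level (Suc k) * ?\<Omega>)"
      unfolding scale using j(1) by (intro mult_left_mono) auto
    moreover have "3 * (2 ^ level (Suc k) * ?\<Omega>) < 3 * (real z + 1)"
      using z(2) by (intro mult_strict_left_mono) auto
    ultimately have "4 * ?P * real j < 3 * (real z + 1)" by (rule le_less_trans)
    have "3 * (2 ^ level (Suc k) * ?\<Omega>) < 4 * ?P * (real j + 1)"
      unfolding scale using j(2) by (intro mult_strict_left_mono) auto
    moreover have "3 * real z \<le> 3 * (2 ^ level (Suc k) * ?\<Omega>)"
      using z(1) by (intro mult_left_mono) auto
    ultimately have "3 * real z < 4 * ?P * (real j + 1)" by (metis le_less_trans)
    with \<open>4 * ?P * real j < 3 * (real z + 1)\<close>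
    have "real (3 * z) < real (4 * Suc j * 2 ^ (?r - 2))" "real (4 * j * 2 ^ (?r - 2)) < real (3 * Suc z)"
      by (simp_all add: algebra_simps)
    then have "fits k j z" unfolding fits_def by (simp only: of_nat_less_iff)
    moreover have "\<Phi> s k y - 1 = ?v" by (simp only: s diff_Suc_1)
    ultimately have "passes s k z" unfolding passes_def zy using s by (simp only: seg) simp
    then show ?thesis unfolding z_def by blast
  qed
  then obtain S where S: "\<And>k. passes (S k) k (nat \<lfloor>2 ^ level (Suc k) * ?\<Omega>\<rfloor>)" by metis
  have "\<exists>s. passes_all K s (nat \<lfloor>2 ^ level K * ?\<Omega>\<rfloor>)" for K
  proof -
    \<comment> \<open>One stage has to serve for all \<open>k < K\<close>; passing persists because
      outputs of \<open>\<Phi>\<close> do.\<close>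
    define s where "s = (\<Sum>k<K. S k)"
    have "passes s k (nat \<lfloor>2 ^ level K * ?\<Omega>\<rfloor> div 2 ^ (level K - level (Suc k)))" if "k < K" for k
    proof -
      have "S k \<le> s" unfolding s_def using that by (intro member_le_sum) auto
      have eq: "nat \<lfloor>2 ^ level K * ?\<Omega>\<rfloor> div 2 ^ (level K - level (Suc k)) = nat \<lfloor>2 ^ level (Suc k) * ?\<Omega>\<rfloor>"
        using that by (intro nat_floor_power2_div \<Omega> level_mono) simp
      let ?z = "nat \<lfloor>2 ^ level (Suc k) * ?\<Omega>\<rfloor>"
      obtain v where "\<Phi> (S k) k (?z div 4) = Suc v"
        using S[of k] unfolding passes_def by (meson not0_implies_Suc)
      with \<Phi>_mono[OF this \<open>S k \<le> s\<close>] S[of k] show ?thesis unfolding eq passes_def by simp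
    qed
    then show ?thesis unfolding passes_all_def by blast
  qed
  then show False using ex_not_passes_all[OF universal_staged_machine_axioms] by blast
qed

theorem theorem1p3:
  fixes \<epsilon> :: real
  assumes "\<epsilon> \<ge> 1"
  shows "(\<epsilon> > 1 \<longrightarrow> (\<forall>\<Omega>\<^sub>0 \<Omega>\<^sub>1. omega_number \<Omega>\<^sub>0 \<longrightarrow> omega_number \<Omega>\<^sub>1 \<longrightarrow>
            computes_with_redundancy \<Omega>\<^sub>0 \<Omega>\<^sub>1 (h \<epsilon>))) \<and>
         (\<epsilon> = 1 \<longrightarrow> (\<forall>\<Omega>. omega_number \<Omega> \<longrightarrow>
            (\<exists>\<Omega>'. omega_number \<Omega>' \<and> \<Omega>' \<noteq> \<Omega> \<and> \<not> computes_with_redundancy \<Omega> \<Omega>' (h 1))))"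
proof (intro conjI impI allI)
  fix \<Omega>\<^sub>0 \<Omega>\<^sub>1 assume "1 < \<epsilon>" "omega_number \<Omega>\<^sub>0" "omega_number \<Omega>\<^sub>1"
  then show "computes_with_redundancy \<Omega>\<^sub>0 \<Omega>\<^sub>1 (h \<epsilon>)" by (intro computes_with_redundancy_gt_1)
next
  fix \<Omega> assume "omega_number \<Omega>"
  then obtain U F where U: "universal_staged_machine U F" and \<Omega>: "\<Omega> = halting_probability U"
    by (rule omega_number_staged)
  interpret universal_staged_machine U F by (rule U)
  have "omega_number (3 / 4 * \<Omega>)"
    unfolding omega_number_def \<Omega> using universal_tripled halting_probability_tripled by metis
  \<comment> \<open>Only 0 equals three quarters of itself, and 0 is dyadic.\<close>
  moreover have "3 / 4 * \<Omega> \<noteq> \<Omega>" using halting_probability_not_dyadic[of 0 0] by (simp add: \<Omega>)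
  ultimately show "\<exists>\<Omega>'. omega_number \<Omega>' \<and> \<Omega>' \<noteq> \<Omega> \<and> \<not> computes_with_redundancy \<Omega> \<Omega>' (h 1)"
    using not_computes_three_quarters unfolding \<Omega> by blast
qed

end
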